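(* Let $\alpha\in(0,1)$, $\beta\in(0,1]$, $N>4\beta$, $\gamma\in\mathbb{R}$ and $p\in[1,\infty]$, and put $p_{\rm c}=N/(N-2\beta)$. Let $f:\mathbb{R}^N\times[0,\infty)\to\mathbb{R}$ be measurable and suppose that there is $C_0>0$ with $$\|f(\cdot,t)\|_{L^1(\mathbb{R}^N)}\le \frac{C_0}{(1+t)^{\gamma}}\qquad\text{for all } t\ge 0 .$$ If $p\ge p_{\rm c}$, suppose in addition that there are $C_1,R_0>0$ with $$|f(x,t)|\le C_1|x|^{-N}(1+t)^{-\gamma}\qquad\text{for all } |x|\ge R_0,\ t\ge0 .$$ Let $u$ be the mild solution of $\partial_t^\alpha u+(-\Delta)^\beta u=f$ in $\mathbb{R}^N\times(0,\infty)$, $u(\cdot,0)=0$. Then for every $\nu>0$ there are constants $C>0$ and $t_0\ge 2$ such that for all $t\ge t_0$ $$\|u(\cdot,t)\|_{L^p(\{x\in\mathbb{R}^N:\,|x|\ge \nu t^{\alpha/(2\beta)}\})}\le C\,\Phi(t),\qquad \Phi(t):=\begin{cases} t^{-\gamma+\alpha-\frac{\alpha N}{2\beta}(1-\frac1p)},&\gamma<1,\\ t^{-1+\alpha-\frac{\alpha N}{2\beta}(1-\frac1p)}\log t,&\gamma=1,\\ t^{-1+\alpha-\frac{\alpha N}{2\beta}(1-\frac1p)},&\gamma>1. \end{cases}$$ These estimates are sharp: for all $\alpha\in(0,1)$, $\beta\in(0,1]$, $N>4\beta$, $\gamma\in\mathbb{R}$, $p\in[1,\infty]$ and every $\nu>0$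 there exist a measurable function $f:\mathbb{R}^N\times[0,\infty)\to\mathbb{R}$ satisfying, for some $C_0>0$, $\|f(\cdot,t)\|_{L^1(\mathbb{R}^N)}\le C_0(1+t)^{-\gamma}$ for all $t\ge0$ and, if $p\ge p_{\rm c}$, also, for some $C_1,R_0>0$, $|f(x,t)|\le C_1|x|^{-N}(1+t)^{-\gamma}$ for all $|x|\ge R_0$, $t\ge0$, and constants $c>0$, $t_1\ge2$ such that the corresponding mild solution $u$ satisfies $\|u(\cdot,t)\|_{L^p(\{|x|\ge \nu t^{\alpha/(2\beta)}\})}\ge c\,\Phi(t)$ for all $t\ge t_1$.
   Context: $N$ is a positive integer (the space dimension), and $1/p=0$ when $p=\infty$. $\partial_t^\alpha$, $\alpha\in(0,1)$, is the Caputo derivative, defined for smooth functions by $$\partial_t^\alpha u(x,t)=\frac1{\Gamma(1-\alpha)}\,\partial_t\int_0^t\frac{u(x,\tau)-u(x,0)}{(t-\tau)^{\alpha}}\,{\rm d}\tau,$$ and $(-\Delta)^\beta=\mathcal{F}^{-1}(|\cdot|^{2\beta}\mathcal{F})$, with $\mathcal{F}$ the Fourier transform in space. Kernel $Y$: let $Z$ be the fundamental solution, i.e. the solution of $\partial_t^\alpha Z+(-\Delta)^\beta Z=0$ in $\mathbb{R}^N\times(0,\infty)$ with $Z(\cdot,0)=\delta_0$ (Dirac mass at the origin), and $Y(x,t)=\partial_t^{1-\alpha}Z(x,t)$ for $x\ne0$, $t>0$ (where $Z(x,0)=0$ for $x\neq 0$). Equivalently, $Y(\cdot,t)\in L^1(\mathbb{R}^N)$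 is the function with $\int_{\mathbb{R}^N}e^{-ix\cdot\xi}Y(x,t)\,{\rm d}x=t^{\alpha-1}E_{\alpha,\alpha}(-|\xi|^{2\beta}t^\alpha)$ for $t>0$, where $E_{\alpha,\alpha}(z)=\sum_{k\ge0}z^k/\Gamma(\alpha k+\alpha)$. The function $Y$ is nonnegative. The mild solution of $\partial_t^\alpha u+(-\Delta)^\beta u=f$ in $\mathbb{R}^N\times(0,\infty)$, $u(\cdot,0)=0$, is the function $$u(x,t)=\int_0^t\int_{\mathbb{R}^N}Y(x-y,t-s)f(y,s)\,{\rm d}y\,{\rm d}s .$$ *)

theory Defs
  imports "HOL-Probability.Probability"
begin

text \<open>
  The norm of \<open>L\<^sup>p(M)\<close> for \<open>p \<in> [1,\<infinity>]\<close>, with value \<open>\<top>\<close> if \<open>g\<close> is not in \<open>L\<^sup>p(M)\<close>.  It is meaningful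
  only for measurable \<open>g\<close>; measurability is stated separately wherever the norm is used.
\<close>

definition Lp_norm :: "ennreal \<Rightarrow> 'a measure \<Rightarrow> ('a \<Rightarrow> real) \<Rightarrow> ennreal" where
  "Lp_norm p M g =
    (if p = \<top> then esssup M (\<lambda>x. ennreal \<bar>g x\<bar>)
     else let I = (\<integral>\<^sup>+x. ennreal (\<bar>g x\<bar> powr enn2real p) \<partial>M)
          in if I = \<top> then \<top> else ennreal (enn2real I powr (1 / enn2real p)))"

definition mittag_leffler :: "real \<Rightarrow> real \<Rightarrow> real \<Rightarrow> real" where
  "mittag_leffler a b z = (\<Sum>k. z ^ k / Gamma (a * real k + b))"

text \<open>
  \<open>is_kernel_slice \<alpha> \<beta> t g\<close> says that \<open>g\<close> is the time slice \<open>Y(\<cdot>,t)\<close>: an integrable function whose Fourier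
  transform (with the convention \<open>\<integral> e\<^bsup>-ix\<cdot>\<xi>\<^esup> g(x) dx\<close>) is \<open>t\<^bsup>\<alpha>-1\<^esup> E\<^bsub>\<alpha>,\<alpha>\<^esub>(-|\<xi>|\<^bsup>2\<beta>\<^esup> t\<^bsup>\<alpha>\<^esup>)\<close>.
  This determines \<open>g\<close> up to a null set.
\<close>

definition is_kernel_slice :: "real \<Rightarrow> real \<Rightarrow> real \<Rightarrow> (real ^ 'n \<Rightarrow> real) \<Rightarrow> bool" where
  "is_kernel_slice \<alpha> \<beta> t g \<longleftrightarrow>
    integrable lborel g \<and>
    (\<forall>\<xi>. (LINT x|lborel. exp (- (\<i> * complex_of_real (x \<bullet> \<xi>))) * complex_of_real (g x)) =
          complex_of_real
            (t powr (\<alpha> - 1) * mittag_leffler \<alpha> \<alpha> (- (norm \<xi> powr (2 * \<beta>) * t powr \<alpha>))))"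

text \<open>
  The choice of representative is immaterial: \<open>kernel_Y\<close> enters only through the spatial integral in
  \<open>mild_solution\<close>, which depends, for each fixed time, only on the almost-everywhere class of the slice.
\<close>

definition kernel_Y :: "real \<Rightarrow> real \<Rightarrow> real ^ 'n \<Rightarrow> real \<Rightarrow> real" where
  "kernel_Y \<alpha> \<beta> x t = (SOME g. is_kernel_slice \<alpha> \<beta> t g) x"

definition mild_solution ::
    "real \<Rightarrow> real \<Rightarrow> (real ^ 'n \<Rightarrow> real \<Rightarrow> real) \<Rightarrow> real ^ 'n \<Rightarrow> real \<Rightarrow> real" where
  "mild_solution \<alpha> \<beta> f x t =
    (LINT s:{0..t}|lebesgue. (LINT y|lebesgue. kernel_Y \<alpha> \<beta> (x - y) (t - s) * f y s))"

definition source_measurable :: "(real ^ 'n \<Rightarrow> real \<Rightarrow> real) \<Rightarrow> bool" where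
  "source_measurable f \<longleftrightarrow>
    (\<lambda>(x, t). f x t) \<in> borel_measurable (lebesgue_on (UNIV \<times> {0..}))"

text \<open>
  Joint Lebesgue measurability only gives measurable slices for almost every \<open>t\<close>; the \<open>L\<^sup>1\<close> bound, which is
  imposed for every \<open>t \<ge> 0\<close>, includes measurability of each slice.
\<close>

definition source_L1_bound :: "real \<Rightarrow> (real ^ 'n \<Rightarrow> real \<Rightarrow> real) \<Rightarrow> bool" where
  "source_L1_bound \<gamma> f \<longleftrightarrow>
    (\<exists>C\<^sub>0>0. \<forall>t\<ge>0. (\<lambda>x. f x t) \<in> borel_measurable lebesgue \<and>
       Lp_norm 1 lebesgue (\<lambda>x. f x t) \<le> ennreal (C\<^sub>0 / (1 + t) powr \<gamma>))"

definition source_spatial_decay :: "real \<Rightarrow> (real ^ 'n \<Rightarrow> real \<Rightarrow> real) \<Rightarrow> bool" where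
  "source_spatial_decay \<gamma> f \<longleftrightarrow>
    (\<exists>C\<^sub>1>0. \<exists>R\<^sub>0>0. \<forall>x t. norm x \<ge> R\<^sub>0 \<longrightarrow> t \<ge> 0 \<longrightarrow>
       \<bar>f x t\<bar> \<le> C\<^sub>1 * norm x powr (- real CARD('n)) * (1 + t) powr (- \<gamma>))"

definition critical_exponent :: "nat \<Rightarrow> real \<Rightarrow> real" where
  "critical_exponent N \<beta> = real N / (real N - 2 * \<beta>)"

definition exterior_region :: "real \<Rightarrow> real \<Rightarrow> real \<Rightarrow> real \<Rightarrow> (real ^ 'n) set" where
  "exterior_region \<alpha> \<beta> \<nu> t = {x. norm x \<ge> \<nu> * t powr (\<alpha> / (2 * \<beta>))}"

text \<open>For \<open>p = \<top>\<close> the term \<open>enn2real (1 / p)\<close> is \<open>0\<close>.\<close>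

definition decay_rate :: "nat \<Rightarrow> real \<Rightarrow> real \<Rightarrow> real \<Rightarrow> ennreal \<Rightarrow> real \<Rightarrow> real" where
  "decay_rate N \<alpha> \<beta> \<gamma> p t =
    (let \<sigma> = \<alpha> * real N / (2 * \<beta>) * (1 - enn2real (1 / p)) in
     if \<gamma> < 1 then t powr (- \<gamma> + \<alpha> - \<sigma>)
     else if \<gamma> = 1 then t powr (- 1 + \<alpha> - \<sigma>) * ln t
     else t powr (- 1 + \<alpha> - \<sigma>))"

end

theory Submission
  imports Defs
begin

text \<open>
  Write \<open>\<delta> = \<alpha> / (2\<beta>)\<close>, \<open>N\<close> for the space dimension, \<open>\<sigma> = \<delta> N (1 - 1/p)\<close>, and \<open>L(t)\<close> for \<open>t\<^bsup>1-\<gamma>\<^esup>\<close>,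
  \<open>log t\<close> or \<open>1\<close> according as \<open>\<gamma> < 1\<close>, \<open>\<gamma> = 1\<close> or \<open>\<gamma> > 1\<close>.  The claimed rate is \<open>t\<^bsup>\<alpha>-1-\<sigma>\<^esup> L(t)\<close>.

  Everything rests on one formula for the kernel: there is a finite measure \<open>\<mu>\<close> on \<open>(0,\<infinity>)\<close> with
  \<open>Y(x,t) = t\<^bsup>\<alpha>-1\<^esup> \<integral> h(r t\<^bsup>\<alpha>/\<beta>\<^esup>, x) d\<mu>(r)\<close>, where \<open>h(r,\<cdot>)\<close> is the Gaussian with Fourier transform
  \<open>exp(-r |\<xi>|\<^sup>2)\<close>.  Comparing Fourier transforms, the measure \<open>\<mu>\<close> must have Laplace transform
  \<open>s \<mapsto> E\<^bsub>\<alpha>,\<alpha>\<^esub>(-s\<^bsup>\<beta>\<^esup>)\<close>.  If \<open>A\<close> and \<open>B\<close> are independent positive stable variables of index \<open>\<alpha>\<close> and \<open>\<beta>\<close>, that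
  is, with Laplace transforms \<open>exp(-s\<^bsup>\<alpha>\<^esup>)\<close> and \<open>exp(-s\<^bsup>\<beta>\<^esup>)\<close>, then the law of \<open>A\<^bsup>-\<alpha>/\<beta>\<^esup> B\<close> weighted with
  \<open>\<alpha> A\<^bsup>-\<alpha>\<^esup>\<close> does this (\<open>mixing_measure_exists\<close>): integrating out \<open>B\<close> leaves the mean of
  \<open>\<alpha> A\<^bsup>-\<alpha>\<^esup> exp(-s\<^bsup>\<beta>\<^esup> A\<^bsup>-\<alpha>\<^esup>)\<close>, and the negative moments of \<open>A\<close> are the quotients of Gamma values that turn the
  exponential series into the Mittag-Leffler series (\<open>mittag_leffler_stable\<close>).  Positive stable laws are
  limits of rescaled sums of independent Sibuya variables (\<open>positive_stable_exists\<close>).  An integrable function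
  on \<open>\<real>\<^sup>N\<close> is determined almost everywhere by its Fourier transform (\<open>fourier_unique_AE\<close>), so the function
  chosen in the definition of \<open>kernel_Y\<close> agrees almost everywhere with the Gaussian mixture, and mild solutions
  may be computed with the latter.

  Four facts about the mixture suffice, and each follows from the corresponding fact about Gaussians.  First,
  \<open>Y(\<cdot>,t)\<close> is nonnegative and has integral of order \<open>t\<^bsup>\<alpha>-1\<^esup>\<close> (\<open>nn_integral_Y\<close>).  Second,
  \<open>Y(x,t) \<le> C t\<^bsup>\<alpha>-1\<^esup> |x|\<^bsup>-N\<^esup>\<close>, because \<open>h(r,x) \<le> C |x|\<^bsup>-N\<^esup>\<close> uniformly in \<open>r\<close> (\<open>Y_le\<close>).  Third,
  \<open>\<parallel>Y(\<cdot>,t)\<parallel>\<^sub>p \<le> C t\<^bsup>\<alpha>-1-\<sigma>\<^esup>\<close> if \<open>p\<close> is below the critical exponent (\<open>Y_Lp\<close>).  Fourth,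
  \<open>Y(x,t) \<ge> c t\<^bsup>\<alpha>-1-\<delta>N\<^esup>\<close> for \<open>|x| \<le> M t\<^bsup>\<delta>\<^esup>\<close> (\<open>Y_lower\<close>).

  Upper bound below the critical exponent: there \<open>\<sigma> < \<alpha>\<close>, and Minkowski's integral inequality bounds
  \<open>\<parallel>u(\<cdot>,t)\<parallel>\<^sub>p\<close> by \<open>\<integral>\<^sub>0\<^sup>t (t-s)\<^bsup>\<alpha>-\<sigma>-1\<^esup> (1+s)\<^bsup>-\<gamma>\<^esup> ds\<close>, which is of order \<open>t\<^bsup>\<alpha>-\<sigma>-1\<^esup> L(t)\<close>
  (\<open>singular_weight_integral_le\<close>).  Upper bound from the critical exponent on: for \<open>|x| \<ge> \<nu> t\<^bsup>\<delta>\<^esup>\<close> split the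
  integral over \<open>y\<close> at \<open>|y| = |x|/2\<close>.  Where \<open>|y| \<le> |x|/2\<close>, the kernel is at most \<open>C (t-s)\<^bsup>\<alpha>-1\<^esup> |x|\<^bsup>-N\<^esup>\<close> and
  \<open>f(\<cdot>,s)\<close> is integrable; elsewhere \<open>|f(y,s)| \<le> C |x|\<^bsup>-N\<^esup> (1+s)\<^bsup>-\<gamma>\<^esup>\<close> and the kernel is integrable.  Hence
  \<open>|u(x,t)| \<le> C |x|\<^bsup>-N\<^esup> t\<^bsup>\<alpha>-1\<^esup> L(t)\<close> (\<open>mild_solution_pointwise\<close>), and as \<open>p > 1\<close> the norm of \<open>|x|\<^bsup>-N\<^esup>\<close> over
  \<open>|x| \<ge> \<nu> t\<^bsup>\<delta>\<^esup>\<close> is a multiple of \<open>t\<^bsup>-\<sigma>\<^esup>\<close>.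

  Sharpness: take \<open>f(y,s) = (1+s)\<^bsup>-\<gamma>\<^esup>\<close> for \<open>|y| \<le> 1\<close> and \<open>0\<close> elsewhere.  For \<open>\<nu> t\<^bsup>\<delta>\<^esup> \<le> |x| \<le> 2\<nu> t\<^bsup>\<delta>\<^esup>\<close> the times
  \<open>s \<le> t/2\<close> alone contribute at least \<open>c t\<^bsup>\<alpha>-1-\<delta>N\<^esup> L(t)\<close> (\<open>mild_solution_bump_lower\<close>), and this shell has
  measure of order \<open>t\<^bsup>\<delta>N\<^esup>\<close>.
\<close>

section \<open>Positive stable laws\<close>

text \<open>
  The point weights of the Sibuya law: its generating function is \<open>1 - (1 - s)\<^bsup>a\<^esup>\<close>, so the coefficients are
  those of the binomial series up to sign.
\<close>

definition sibuya_weight :: "real \<Rightarrow> nat \<Rightarrow> real" where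
  "sibuya_weight a k = (if k = 0 then 0 else - ((a gchoose k) * (- 1) ^ k))"

text \<open>
  Consecutive coefficients have the ratio \<open>(m - a) / (m + 1)\<close>, which is nonnegative from \<open>m = 1\<close> on because
  \<open>a < 1\<close>.
\<close>

lemma sibuya_weight_nonneg:
  assumes "0 < a" "a < 1"
  shows "0 \<le> sibuya_weight a k"
proof (cases k)
  case 0
  then show ?thesis by (simp add: sibuya_weight_def)
next
  case (Suc m)
  have "0 \<le> - ((a gchoose Suc m) * (- 1) ^ Suc m)"
  proof (induction m)
    case 0
    then show ?case using assms by simp
  next
    case (Suc m)
    have "(a gchoose Suc (Suc m)) * (real m + 2) = (a gchoose Suc m) * (a - (real m + 1))"
      using gbinomial_mult_1[of a "Suc m"] by (simp add: algebra_simps del: gbinomial_Suc)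
    then have eq: "(a gchoose Suc (Suc m)) = (a gchoose Suc m) * (a - real (Suc m)) / real (Suc (Suc m))"
      by (simp add: field_simps)
    have "- ((a gchoose Suc (Suc m)) * (- 1) ^ Suc (Suc m)) =
        - ((a gchoose Suc m) * (- 1) ^ Suc m) * ((real (Suc m) - a) / real (Suc (Suc m)))"
      unfolding eq by (simp add: divide_simps) (simp add: algebra_simps)
    also have "\<dots> \<ge> 0"
      using Suc assms by (intro mult_nonneg_nonneg divide_nonneg_nonneg) auto
    finally show ?case .
  qed
  then show ?thesis using Suc by (simp add: sibuya_weight_def)
qed

lemma sibuya_weight_gf:
  assumes "0 \<le> s" "s < 1"
  shows "(\<lambda>k. sibuya_weight a k * s ^ k) sums (1 - (1 - s) powr a)"
proof -
  have "(\<lambda>k. (a gchoose k) * (- s) ^ k) sums (1 + - s) powr a"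
    using assms by (intro gen_binomial_real) auto
  then have "(\<lambda>k. (if k = 0 then 1 else 0) - (a gchoose k) * (- s) ^ k) sums (1 - (1 - s) powr a)"
    using sums_single[of 0 "\<lambda>_. 1::real"] by (intro sums_diff) auto
  moreover have "(if k = 0 then 1 else 0) - (a gchoose k) * (- s) ^ k = sibuya_weight a k * s ^ k" for k
    by (simp add: sibuya_weight_def power_minus[of s])
  ultimately show ?thesis by simp
qed

text \<open>
  The total mass is the value of the generating function at \<open>1\<close>, on the boundary of the disc of convergence.
  Since the weights are nonnegative, both inequalities follow by letting \<open>s\<close> increase to \<open>1\<close>: in the partial
  sums for the upper bound, in the full sum for the lower bound.
\<close>

lemma sibuya_weight_sums:
  assumes a: "0 < a" "a < 1"
  shows "sibuya_weight a sums 1"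
proof -
  note nn = sibuya_weight_nonneg[OF a]
  have le1: "(\<Sum>k<n. sibuya_weight a k) \<le> 1" for n
  proof (rule tendsto_upperbound)
    show "((\<lambda>s. \<Sum>k<n. sibuya_weight a k * s ^ k) \<longlongrightarrow> (\<Sum>k<n. sibuya_weight a k)) (at_left 1)"
      by (auto intro!: tendsto_eq_intros)
    show "eventually (\<lambda>s. (\<Sum>k<n. sibuya_weight a k * s ^ k) \<le> 1) (at_left (1::real))"
    proof (rule eventually_at_leftI[of 0])
      fix s :: real assume s: "s \<in> {0<..<1}"
      have gf: "(\<lambda>k. sibuya_weight a k * s ^ k) sums (1 - (1 - s) powr a)"
        using s by (intro sibuya_weight_gf) auto
      have "(\<Sum>k<n. sibuya_weight a k * s ^ k) \<le> (\<Sum>k. sibuya_weight a k * s ^ k)"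
        using s nn gf by (intro sum_le_suminf) (auto simp: sums_iff)
      also have "\<dots> = 1 - (1 - s) powr a"
        using gf by (simp add: sums_iff)
      finally have "(\<Sum>k<n. sibuya_weight a k * s ^ k) \<le> 1 - (1 - s) powr a" .
      then show "(\<Sum>k<n. sibuya_weight a k * s ^ k) \<le> 1"
        using powr_ge_zero[of "1 - s" a] by linarith
    qed auto
  qed auto
  have summ: "summable (sibuya_weight a)"
    by (rule bounded_imp_summable[where B=1]) (use nn le1 in \<open>auto simp only: lessThan_Suc_atMost[symmetric]\<close>)
  have "(\<Sum>k. sibuya_weight a k) \<le> 1"
    by (rule suminf_le_const[OF summ]) (rule le1)
  moreover have "1 \<le> (\<Sum>k. sibuya_weight a k)"
  proof (rule tendsto_upperbound)
    have "((\<lambda>s. 1 - (1 - s) powr a) \<longlongrightarrow> 1 - (1 - 1) powr a) (at_left 1)"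
      using a by (intro tendsto_diff tendsto_const tendsto_powr2) (auto intro!: tendsto_eq_intros eventually_at_leftI[of 0])
    then show "((\<lambda>s. 1 - (1 - s) powr a) \<longlongrightarrow> 1) (at_left 1)" using a by simp
    show "eventually (\<lambda>s. 1 - (1 - s) powr a \<le> (\<Sum>k. sibuya_weight a k)) (at_left 1)"
    proof (rule eventually_at_leftI[of 0])
      fix s :: real assume s: "s \<in> {0<..<1}"
      have "(\<Sum>k. sibuya_weight a k * s ^ k) \<le> (\<Sum>k. sibuya_weight a k)"
        using sibuya_weight_gf[of s a] s nn power_le_one[of s]
        by (intro suminf_le summ) (auto simp: sums_iff intro!: mult_left_le)
      then show "1 - (1 - s) powr a \<le> (\<Sum>k. sibuya_weight a k)"
        using sibuya_weight_gf[of s a] s by (simp add: sums_iff)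
    qed auto
  qed auto
  ultimately show ?thesis using summ by (simp add: sums_iff)
qed

definition sibuya_pmf :: "real \<Rightarrow> nat pmf" where
  "sibuya_pmf a = embed_pmf (sibuya_weight a)"

lemma sibuya_pmf_gf:
  assumes a: "0 < a" "a < 1" and s: "0 \<le> s" "s < 1"
  shows "(\<integral>\<^sup>+k. ennreal (s ^ k) \<partial>sibuya_pmf a) = ennreal (1 - (1 - s) powr a)"
proof -
  have 1: "(\<integral>\<^sup>+k. ennreal (sibuya_weight a k) \<partial>count_space UNIV) = 1"
    using suminf_ennreal_eq[OF sibuya_weight_nonneg[OF a] sibuya_weight_sums[OF a]]
    by (simp add: nn_integral_count_space_nat)
  have "pmf (sibuya_pmf a) k = sibuya_weight a k" for k
    unfolding sibuya_pmf_def by (rule pmf_embed_pmf[OF sibuya_weight_nonneg[OF a] 1])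
  then have "(\<integral>\<^sup>+k. ennreal (s ^ k) \<partial>sibuya_pmf a) = (\<Sum>k. ennreal (sibuya_weight a k * s ^ k))"
    using s sibuya_weight_nonneg[OF a]
    by (simp add: nn_integral_measure_pmf nn_integral_count_space_nat ennreal_mult)
  also have "\<dots> = ennreal (1 - (1 - s) powr a)"
    using sibuya_weight_gf[OF s] s sibuya_weight_nonneg[OF a] by (intro suminf_ennreal_eq) auto
  finally show ?thesis .
qed

primrec sibuya_sum :: "real \<Rightarrow> nat \<Rightarrow> nat pmf" where
  "sibuya_sum a 0 = return_pmf 0"
| "sibuya_sum a (Suc n) = bind_pmf (sibuya_pmf a) (\<lambda>j. map_pmf ((+) j) (sibuya_sum a n))"

lemma sibuya_sum_gf:
  assumes a: "0 < a" "a < 1" and s: "0 \<le> s" "s < 1"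
  shows "(\<integral>\<^sup>+k. ennreal (s ^ k) \<partial>sibuya_sum a n) = ennreal ((1 - (1 - s) powr a) ^ n)"
proof (induction n)
  case (Suc n)
  have nn: "0 \<le> 1 - (1 - s) powr a" using a s by (simp add: powr_le1)
  have "(\<integral>\<^sup>+k. ennreal (s ^ k) \<partial>sibuya_sum a (Suc n)) =
      (\<integral>\<^sup>+j. ennreal (s ^ j) * (\<integral>\<^sup>+k. ennreal (s ^ k) \<partial>sibuya_sum a n) \<partial>sibuya_pmf a)"
    using s by (simp add: power_add ennreal_mult nn_integral_cmult)
  also have "\<dots> = ennreal (1 - (1 - s) powr a) * ennreal ((1 - (1 - s) powr a) ^ n)"
    using Suc sibuya_pmf_gf[OF a s] by (simp add: nn_integral_multc)
  finally show ?case using nn by (simp add: ennreal_mult)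
qed simp

text \<open>
  Sums of \<open>n + 1\<close> independent Sibuya variables, scaled by \<open>(n + 1)\<^bsup>-1/a\<^esup>\<close>; the shift of the index keeps the
  number of summands positive.
\<close>

definition scaled_sibuya :: "real \<Rightarrow> nat \<Rightarrow> real measure" where
  "scaled_sibuya a n =
     distr (sibuya_sum a (Suc n)) borel (\<lambda>k. real k * real (Suc n) powr (- 1 / a))"

lemma real_distribution_scaled_sibuya: "real_distribution (scaled_sibuya a n)"
  unfolding scaled_sibuya_def real_distribution_def real_distribution_axioms_def
  by (auto intro!: prob_space.prob_space_distr measure_pmf.prob_space_axioms)

lemma AE_scaled_sibuya_nonneg: "AE x in scaled_sibuya a n. 0 \<le> x"
  unfolding scaled_sibuya_def by (subst AE_distr_iff) auto

lemma scaled_sibuya_laplace: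
  assumes a: "0 < a" "a < 1" and l: "0 < l"
  shows "(\<integral>\<^sup>+x. ennreal (exp (- (l * x))) \<partial>scaled_sibuya a n) =
    ennreal ((1 - (1 - exp (- (l * real (Suc n) powr (- 1 / a)))) powr a) ^ Suc n)"
proof -
  define s where "s = exp (- (l * real (Suc n) powr (- 1 / a)))"
  have s: "0 \<le> s" "s < 1" using l by (auto simp: s_def)
  have "(\<integral>\<^sup>+x. ennreal (exp (- (l * x))) \<partial>scaled_sibuya a n) = (\<integral>\<^sup>+k. ennreal (s ^ k) \<partial>sibuya_sum a (Suc n))"
  proof -
    have "exp (- (l * (real k * real (Suc n) powr (- 1 / a)))) = s ^ k" for k
      unfolding s_def exp_of_nat_mult[symmetric] by (simp add: mult.left_commute)
    then show ?thesis
      unfolding scaled_sibuya_def by (simp add: nn_integral_distr del: sibuya_sum.simps of_nat_Suc)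
  qed
  then show ?thesis using sibuya_sum_gf[OF a s, of "Suc n"] by (simp add: s_def)
qed

text \<open>
  A lower bound for the Laplace transform near \<open>0\<close> that is uniform in \<open>n\<close>.  It controls the mass far out and so
  gives tightness.  It is Bernoulli's inequality applied to the \<open>(n + 1)\<close>-st power in the Laplace transform.
\<close>

lemma scaled_sibuya_laplace_ge:
  assumes a: "0 < a" "a < 1" and l: "0 < l" "l \<le> 1"
  shows "(\<integral>\<^sup>+x. ennreal (exp (- (l * x))) \<partial>scaled_sibuya a n) \<ge> ennreal (1 - l powr a)"
proof -
  define h where "h = real (Suc n) powr (- 1 / a)"
  define y where "y = (1 - exp (- (l * h))) powr a"
  have "h powr a = real (Suc n) powr (- 1)" using a unfolding h_def powr_powr by simp
  then have h: "h > 0" "h powr a = 1 / real (Suc n)"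
    by (simp_all add: h_def powr_minus_divide del: of_nat_Suc)
  have "1 - exp (- (l * h)) \<le> l * h" using exp_ge_add_one_self[of "- (l * h)"] by linarith
  moreover have "0 \<le> 1 - exp (- (l * h))" using h l by simp
  ultimately have "y \<le> (l * h) powr a" unfolding y_def using a by (intro powr_mono2) auto
  then have y: "y \<le> l powr a / real (Suc n)" using h l by (simp add: powr_mult)
  have "y \<le> 1" unfolding y_def using \<open>0 \<le> 1 - exp (- (l * h))\<close> a by (intro powr_le1) auto
  then have "1 + real (Suc n) * (- y) \<le> (1 + (- y)) ^ Suc n"
    by (intro Bernoulli_inequality) auto
  moreover have "real (Suc n) * y \<le> l powr a" using y by (simp add: field_simps)
  ultimately have "1 - l powr a \<le> (1 - y) ^ Suc n" by simp
  then show ?thesis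
    unfolding scaled_sibuya_laplace[OF a l(1)] y_def h_def by (rule ennreal_leI)
qed

text \<open>
  With \<open>q\<^sub>n = (1 - exp(-l (n+1)\<^bsup>-1/a\<^esup>))\<^bsup>a\<^esup>\<close> one has \<open>(n+1) q\<^sub>n \<rightarrow> l\<^bsup>a\<^esup>\<close>, because \<open>1 - exp(-l h)\<close> is
  asymptotic to \<open>l h\<close> as \<open>h\<close> tends to \<open>0\<close>; therefore \<open>(1 - q\<^sub>n)\<^bsup>n+1\<^esup> \<rightarrow> exp(-l\<^bsup>a\<^esup>)\<close>.
\<close>

lemma scaled_sibuya_laplace_tendsto:
  assumes a: "0 < a" "a < 1" and l: "0 < l"
  shows "(\<lambda>n. (1 - (1 - exp (- (l * real (Suc n) powr (- 1 / a)))) powr a) ^ Suc n)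
    \<longlonglongrightarrow> exp (- (l powr a))"
proof -
  define y where "y n = (real (Suc n) powr (1 / a) * (1 - exp (- (l * real (Suc n) powr (- 1 / a))))) powr a" for n
  have "(\<lambda>h::real. (1 - exp (- (l * h))) / h) \<midarrow>0\<rightarrow> l"
  proof -
    have "((\<lambda>h. 1 - exp (- (l * h))) has_real_derivative l) (at 0)"
      by (auto intro!: derivative_eq_intros)
    then show ?thesis by (simp add: DERIV_def)
  qed
  moreover have "filterlim (\<lambda>n. real (Suc n) powr (- 1 / a)) (at 0) sequentially"
  proof (rule filterlim_atI)
    show "(\<lambda>n. real (Suc n) powr (- 1 / a)) \<longlonglongrightarrow> 0"
      using a by (intro tendsto_neg_powr filterlim_compose[OF filterlim_real_sequentially] filterlim_Suc) auto
  qed auto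
  ultimately have "(\<lambda>n. (1 - exp (- (l * real (Suc n) powr (- 1 / a)))) / real (Suc n) powr (- 1 / a)) \<longlonglongrightarrow> l"
    by (rule filterlim_compose)
  then have "(\<lambda>n. real (Suc n) powr (1 / a) * (1 - exp (- (l * real (Suc n) powr (- 1 / a))))) \<longlonglongrightarrow> l"
    by (simp add: powr_minus_divide[of _ "1/a"] mult.commute)
  then have y: "y \<longlonglongrightarrow> l powr a"
    unfolding y_def using l by (intro tendsto_intros) auto
  define q where "q n = (1 - exp (- (l * real (Suc n) powr (- 1 / a)))) powr a" for n
  have q: "0 < q n" "q n < 1" for n
    unfolding q_def using a l powr_less_mono2[of a "1 - exp (- (l * real (Suc n) powr (- 1 / a)))" 1] by auto
  have yq: "y n = real (Suc n) * q n" for n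
    unfolding y_def q_def using a l by (subst powr_mult) (auto simp: powr_powr)
  have "(\<lambda>n. y n * (1 / real (Suc n))) \<longlonglongrightarrow> l powr a * 0"
    by (intro tendsto_mult y LIMSEQ_Suc[OF lim_1_over_n])
  then have "q \<longlonglongrightarrow> 0" by (simp add: yq del: of_nat_Suc)
  moreover have qn: "q n \<noteq> 0" for n using q(1)[of n] by simp
  ultimately have "filterlim q (at 0) sequentially"
    by (intro filterlim_atI) simp_all
  moreover have "(\<lambda>h::real. ln (1 - h) / h) \<midarrow>0\<rightarrow> - 1"
  proof -
    have "((\<lambda>h::real. ln (1 - h)) has_real_derivative - 1) (at 0)"
      by (auto intro!: derivative_eq_intros)
    then show ?thesis by (simp add: DERIV_def)
  qed
  ultimately have "(\<lambda>n. ln (1 - q n) / q n) \<longlonglongrightarrow> - 1" by (rule filterlim_compose[rotated])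
  from tendsto_exp[OF tendsto_mult[OF y this]]
  have "(\<lambda>n. exp (y n * (ln (1 - q n) / q n))) \<longlonglongrightarrow> exp (- (l powr a))" by simp
  moreover have "exp (y n * (ln (1 - q n) / q n)) = (1 - q n) ^ Suc n" for n
  proof -
    have "exp (y n * (ln (1 - q n) / q n)) = exp (real (Suc n) * ln (1 - q n))"
      using q[of n] by (simp add: yq)
    also have "\<dots> = (1 - q n) ^ Suc n"
      using q[of n] by (simp only: exp_of_nat_mult) simp
    finally show ?thesis .
  qed
  ultimately show ?thesis by (simp only: q_def)
qed

text \<open>
  On \<open>x > 1/l\<close> the function \<open>exp(-l x)\<close> is at most \<open>1/2\<close>.  Hence a Laplace transform at least \<open>1 - l\<^bsup>a\<^esup>\<close> forces
  the mass of \<open>[0, 1/l]\<close> to be at least \<open>1 - 2 l\<^bsup>a\<^esup>\<close>, whatever \<open>n\<close> is.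
\<close>

lemma tight_scaled_sibuya:
  assumes a: "0 < a" "a < 1"
  shows "tight (scaled_sibuya a)"
  unfolding tight_def
proof (intro conjI allI impI real_distribution_scaled_sibuya)
  fix e :: real assume e: "0 < e"
  define l where "l = min 1 ((e / 4) powr (1 / a))"
  have l: "0 < l" "l \<le> 1" using e by (auto simp: l_def)
  have "l powr a \<le> ((e / 4) powr (1 / a)) powr a"
    using l a by (intro powr_mono2) (auto simp: l_def)
  then have la: "l powr a \<le> e / 4" using a e by (simp add: powr_powr)
  have "measure (scaled_sibuya a n) {-1<..1/l} > 1 - e" for n
  proof -
    interpret M: real_distribution "scaled_sibuya a n" by (rule real_distribution_scaled_sibuya)
    obtain c :: real where c: "0 \<le> c" "c = 1/2" by (metis half_gt_zero_iff less_eq_real_def zero_less_one)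
    define p where "p = measure (scaled_sibuya a n) {-1<..1/l}"
    have "ennreal (1 - l powr a) \<le> (\<integral>\<^sup>+x. ennreal (exp (- (l * x))) \<partial>scaled_sibuya a n)"
      by (rule scaled_sibuya_laplace_ge[OF a l])
    also have "\<dots> \<le> (\<integral>\<^sup>+x. ennreal c + ennreal c * indicator {-1<..1/l} x \<partial>scaled_sibuya a n)"
    proof (rule nn_integral_mono_AE)
      show "AE x in scaled_sibuya a n.
          ennreal (exp (- (l * x))) \<le> ennreal c + ennreal c * indicator {-1<..1/l} x"
        using AE_scaled_sibuya_nonneg
      proof eventually_elim
        case (elim x)
        show ?case
        proof (cases "x \<le> 1/l")
          case True
          then have "ennreal c + ennreal c * indicator {-1<..1/l} x = ennreal 1"
            using elim l c(1) by (simp add: ennreal_plus[symmetric] del: ennreal_plus) (simp add: c(2))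
          then show ?thesis using elim l by (auto intro!: ennreal_leI)
        next
          case False
          then have "exp (- (l * x)) \<le> exp (-1)" using l by (simp add: field_simps)
          also have "exp (-1) \<le> c" unfolding c(2)
            using exp_ge_add_one_self[of 1] by (simp add: exp_minus field_simps)
          finally have "ennreal (exp (- (l * x))) \<le> ennreal c" by (rule ennreal_leI)
          then show ?thesis by (rule order_trans) simp
        qed
      qed
    qed
    also have "\<dots> = ennreal (c + c * p)"
      using c(1) M.emeasure_space_1
      by (subst nn_integral_add)
        (auto simp: nn_integral_cmult p_def M.emeasure_eq_measure ennreal_mult ennreal_plus)
    finally have "1 - l powr a \<le> c + c * p"
      by (subst (asm) ennreal_le_iff) (use c(1) in \<open>auto simp: p_def\<close>)
    then show ?thesis using la e by (simp add: p_def c(2))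
  qed
  then show "\<exists>u v. u < v \<and> (\<forall>n. 1 - e < measure (scaled_sibuya a n) {u<..v})"
    using l by (intro exI[of _ "-1"] exI[of _ "1/l"]) (simp add: less_trans[of _ 0])
qed

definition positive_stable :: "real \<Rightarrow> real measure \<Rightarrow> bool" where
  "positive_stable a M \<longleftrightarrow> prob_space M \<and> sets M = sets borel \<and> (AE x in M. 0 < x) \<and>
     (\<forall>l>0. (\<integral>\<^sup>+x. ennreal (exp (- (l * x))) \<partial>M) = ennreal (exp (- (l powr a))))"

text \<open>
  For \<open>a < 1\<close> the law is a weak limit of the scaled Sibuya sums along a subsequence, which exists by tightness;
  the Laplace transform passes to the limit because \<open>exp(-l max(0,x))\<close> is bounded and continuous.  There is no
  atom at \<open>0\<close>, since the Laplace transform tends to \<open>0\<close> at infinity.  For \<open>a = 1\<close> the law is the unit mass at \<open>1\<close>.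
\<close>

lemma positive_stable_exists:
  assumes a: "0 < a" "a \<le> 1"
  shows "\<exists>M. positive_stable a M"
proof (cases "a = 1")
  case True
  show ?thesis
  proof (intro exI[of _ "return borel (1::real)"])
    show "positive_stable a (return borel 1)"
      unfolding positive_stable_def using True
      by (auto simp: prob_space_return AE_return nn_integral_return)
  qed
next
  case False
  then have a: "0 < a" "a < 1" using a by auto
  obtain r M where r: "strict_mono (r :: nat \<Rightarrow> nat)" and M: "real_distribution M"
      and w: "weak_conv_m (scaled_sibuya a \<circ> id \<circ> r) M"
    using tight_imp_convergent_subsubsequence[OF tight_scaled_sibuya[OF a] strict_mono_id] by blast
  interpret M: real_distribution M by fact
  interpret rd: real_distribution "scaled_sibuya a n" for n by (rule real_distribution_scaled_sibuya)
  have rd': "\<And>n. real_distribution ((scaled_sibuya a \<circ> id \<circ> r) n)"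
    by (auto intro: real_distribution_scaled_sibuya)
  have conv: "(\<lambda>n. integral\<^sup>L (scaled_sibuya a (r n)) f) \<longlonglongrightarrow> integral\<^sup>L M f"
    if "\<And>x. isCont f x" "\<And>x. norm (f x) \<le> B" for f :: "real \<Rightarrow> real" and B
    using weak_conv_imp_integral_bdd_continuous_conv[OF rd' M w that] by (simp add: o_def)
  have [measurable_cong]: "sets (scaled_sibuya a n) = sets borel" for n by simp
  have nonneg: "AE x in M. 0 \<le> x"
  proof -
    \<comment> \<open>A bounded continuous function that vanishes exactly on \<open>[0,\<infinity>)\<close> detects mass on the negative axis.\<close>
    define f :: "real \<Rightarrow> real" where "f x = min 1 (max 0 (- x))" for x
    have [measurable]: "f \<in> borel_measurable borel" unfolding f_def by measurable
    have fcont: "isCont f x" for x unfolding f_def by (intro continuous_intros)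
    have "integral\<^sup>L (scaled_sibuya a n) f = 0" for n
    proof (rule integral_eq_zero_AE)
      show "AE x in scaled_sibuya a n. f x = 0"
        using AE_scaled_sibuya_nonneg[of a n] by eventually_elim (auto simp: f_def)
    qed
    moreover have "(\<lambda>n. integral\<^sup>L (scaled_sibuya a (r n)) f) \<longlonglongrightarrow> integral\<^sup>L M f"
      by (rule conv[OF fcont, of 1]) (auto simp: f_def)
    ultimately have "integral\<^sup>L M f = 0" by (simp add: LIMSEQ_const_iff)
    moreover have "integrable M f"
      by (rule M.integrable_const_bound[where B=1]) (auto simp: f_def)
    ultimately have "AE x in M. f x = 0"
      by (subst (asm) integral_nonneg_eq_0_iff_AE) (auto simp: f_def)
    then show ?thesis by eventually_elim (auto simp: f_def min_def max_def split: if_splits)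
  qed
  have lap: "(\<integral>\<^sup>+x. ennreal (exp (- (l * x))) \<partial>M) = ennreal (exp (- (l powr a)))" if l: "l > 0" for l
  proof -
    define f :: "real \<Rightarrow> real" where "f x = exp (- (l * max 0 x))" for x
    have [measurable]: "f \<in> borel_measurable borel" unfolding f_def by measurable
    have f01: "0 \<le> f x" "f x \<le> 1" for x using l by (auto simp: f_def)
    have fcont: "isCont f x" for x unfolding f_def by (intro continuous_intros)
    have eq: "(\<integral>\<^sup>+x. ennreal (exp (- (l * x))) \<partial>N) = ennreal (integral\<^sup>L N f)"
      if N: "real_distribution N" "AE x in N. 0 \<le> x" for N
    proof -
      interpret N: real_distribution N by fact
      have "(\<integral>\<^sup>+x. ennreal (exp (- (l * x))) \<partial>N) = (\<integral>\<^sup>+x. ennreal (f x) \<partial>N)"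
        by (rule nn_integral_cong_AE) (use N(2) in eventually_elim, auto simp: f_def)
      also have "\<dots> = ennreal (integral\<^sup>L N f)"
        by (intro nn_integral_eq_integral N.integrable_const_bound[where B=1]) (use f01 in auto)
      finally show ?thesis .
    qed
    have nn: "0 \<le> (1 - (1 - exp (- (l * real (Suc n) powr (- 1 / a)))) powr a)" for n
      using a l by (simp add: powr_le1)
    have 1: "integral\<^sup>L (scaled_sibuya a n) f =
        (1 - (1 - exp (- (l * real (Suc n) powr (- 1 / a)))) powr a) ^ Suc n" for n
    proof -
      have "ennreal (integral\<^sup>L (scaled_sibuya a n) f) =
          ennreal ((1 - (1 - exp (- (l * real (Suc n) powr (- 1 / a)))) powr a) ^ Suc n)"
        unfolding eq[OF real_distribution_scaled_sibuya AE_scaled_sibuya_nonneg, symmetric]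
        by (rule scaled_sibuya_laplace[OF a l])
      moreover have "0 \<le> integral\<^sup>L (scaled_sibuya a n) f"
        using f01 by (intro integral_nonneg_AE) auto
      moreover have "0 \<le> (1 - (1 - exp (- (l * real (Suc n) powr (- 1 / a)))) powr a) ^ Suc n"
        using nn by (rule zero_le_power)
      ultimately show ?thesis by (simp only: ennreal_inj)
    qed
    have "(\<lambda>n. integral\<^sup>L (scaled_sibuya a (r n)) f) \<longlonglongrightarrow> exp (- (l powr a))"
      unfolding 1 using LIMSEQ_subseq_LIMSEQ[OF scaled_sibuya_laplace_tendsto[OF a l] r] by (simp only: o_def)
    moreover have "(\<lambda>n. integral\<^sup>L (scaled_sibuya a (r n)) f) \<longlonglongrightarrow> integral\<^sup>L M f"
      using f01 by (intro conv[OF fcont, of 1]) auto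
    ultimately have "integral\<^sup>L M f = exp (- (l powr a))" using LIMSEQ_unique by blast
    then show ?thesis using eq[OF M nonneg] by simp
  qed
  have "emeasure M {0} \<le> ennreal e" if e: "e > 0" for e
  proof -
    \<comment> \<open>For this \<open>l\<close> the Laplace transform is \<open>exp(-1/e)\<close>, which is at most \<open>e\<close>.\<close>
    define l where "l = (1 / e) powr (1 / a)"
    have "l powr a = 1 / e" using e a by (simp add: l_def powr_powr)
    moreover have "1 + 1 / e \<le> exp (1 / e)" by (rule exp_ge_add_one_self)
    then have "exp (- (1 / e)) \<le> e" using e by (simp add: exp_minus field_simps)
    ultimately have l: "l > 0" "exp (- (l powr a)) \<le> e" using e by (auto simp: l_def)
    have "emeasure M {0} = (\<integral>\<^sup>+x. indicator {0} x \<partial>M)" by simp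
    also have "\<dots> \<le> (\<integral>\<^sup>+x. ennreal (exp (- (l * x))) \<partial>M)"
      by (intro nn_integral_mono) (auto split: split_indicator)
    also have "\<dots> \<le> ennreal e" using lap[OF l(1)] l by (auto intro: ennreal_leI)
    finally show ?thesis .
  qed
  note zero = this
  have "emeasure M {0} \<le> 0" by (rule ennreal_le_epsilon) (simp add: zero)
  then have z: "{0} \<in> null_sets M" by (simp add: null_sets_def)
  have "AE x in M. 0 < x"
    using nonneg AE_not_in[OF z] by eventually_elim auto
  then have "positive_stable a M"
    unfolding positive_stable_def using lap M.prob_space_axioms M.events_eq_borel by blast
  then show ?thesis by (rule exI)
qed

section \<open>Mittag-Leffler functions and the mixing measure\<close>

lemma nn_integral_powr_Icc:
  fixes s c :: real
  assumes "0 < s" "0 \<le> c"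
  shows "(\<integral>\<^sup>+l. ennreal (indicator {0..c} l * l powr (s - 1)) \<partial>lborel) = ennreal (c powr s / s)"
proof -
  have "((\<lambda>x. x powr (s - 1)) has_integral (c powr (s - 1 + 1) / (s - 1 + 1))) {0..c}"
    using assms by (intro has_integral_powr_from_0) auto
  from nn_integral_has_integral_lebesgue[OF _ this] show ?thesis by simp
qed

lemma nn_integral_powr_exp:
  fixes s x :: real
  assumes s: "0 < s" and x: "0 < x"
  shows "(\<integral>\<^sup>+l. ennreal (indicator {0..} l * l powr (s - 1) * exp (- (l * x))) \<partial>lborel) =
    ennreal (Gamma s * x powr (- s))"
proof -
  let ?I = "\<integral>\<^sup>+l. ennreal (indicator {0..} l * l powr (s - 1) * exp (- (l * x))) \<partial>lborel"
  have "ennreal (Gamma s) = \<bar>x\<bar> * (\<integral>\<^sup>+l. ennreal (indicator {0..} (0 + x * l) * (0 + x * l) powr (s - 1) / exp (0 + x * l)) \<partial>lborel)"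
    unfolding Gamma_conv_nn_integral_real[OF s] using x by (subst nn_integral_real_affine[where c=x and t=0]) auto
  also have "(\<integral>\<^sup>+l. ennreal (indicator {0..} (0 + x * l) * (0 + x * l) powr (s - 1) / exp (0 + x * l)) \<partial>lborel) =
      (\<integral>\<^sup>+l. ennreal (x powr (s - 1)) * ennreal (indicator {0..} l * l powr (s - 1) * exp (- (l * x))) \<partial>lborel)"
    using x by (intro nn_integral_cong)
      (auto simp: powr_mult exp_minus field_simps zero_le_mult_iff ennreal_mult[symmetric] split: split_indicator)
  also have "\<dots> = ennreal (x powr (s - 1)) * ?I" by (rule nn_integral_cmult) auto
  finally have "ennreal (Gamma s) = ennreal (x powr s) * ?I"
    using x by (simp add: mult.assoc[symmetric] ennreal_mult[symmetric] powr_diff)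
  then have "ennreal (x powr (- s)) * ennreal (Gamma s) = ennreal (x powr (- s) * x powr s) * ?I"
    by (simp add: ennreal_mult mult.assoc)
  then show ?thesis
    using x s Gamma_real_pos[OF s] by (simp add: powr_minus ennreal_mult[symmetric] mult.commute)
qed

text \<open>
  All negative moments of a positive stable law are finite and explicit.  Insert
  \<open>\<Gamma>(s) x\<^bsup>-s\<^esup> = \<integral>\<^sub>0\<^sup>\<infinity> l\<^bsup>s-1\<^esup> exp(-l x) dl\<close> and exchange the integrals, which gives \<open>\<integral>\<^sub>0\<^sup>\<infinity> l\<^bsup>s-1\<^esup> exp(-l\<^bsup>a\<^esup>) dl\<close>.
  Instead of substituting \<open>u = l\<^bsup>a\<^esup>\<close>, whose derivative is singular at \<open>0\<close>, write \<open>exp(-l\<^bsup>a\<^esup>)\<close> as the integral of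
  \<open>exp(-u)\<close> over \<open>u \<ge> l\<^bsup>a\<^esup>\<close> and exchange once more.
\<close>

lemma positive_stable_moment:
  assumes M: "positive_stable a M" and a: "0 < a" and s: "0 < s"
  shows "(\<integral>\<^sup>+x. ennreal (x powr (- s)) \<partial>M) = ennreal (Gamma (s / a + 1) / Gamma (s + 1))"
proof -
  interpret M: prob_space M using M by (simp add: positive_stable_def)
  have [measurable_cong]: "sets M = sets borel" using M by (simp add: positive_stable_def)
  interpret P: pair_sigma_finite M lborel ..
  have pos: "AE x in M. 0 < x" using M by (simp add: positive_stable_def)
  have lap: "(\<integral>\<^sup>+x. ennreal (exp (- (l * x))) \<partial>M) = ennreal (exp (- (l powr a)))" if "l > 0" for l
    using M that by (simp add: positive_stable_def)
  have G: "0 < Gamma s" using s by (rule Gamma_real_pos)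
  have "ennreal (Gamma s) * (\<integral>\<^sup>+x. ennreal (x powr (- s)) \<partial>M) =
      (\<integral>\<^sup>+x. ennreal (Gamma s * x powr (- s)) \<partial>M)"
    using G by (simp add: nn_integral_cmult ennreal_mult)
  also have "\<dots> = (\<integral>\<^sup>+x. (\<integral>\<^sup>+l. ennreal (indicator {0..} l * l powr (s - 1) * exp (- (l * x))) \<partial>lborel) \<partial>M)"
    by (rule nn_integral_cong_AE) (use pos in eventually_elim, use s in \<open>simp add: nn_integral_powr_exp\<close>)
  also have "\<dots> = (\<integral>\<^sup>+l. (\<integral>\<^sup>+x. ennreal (indicator {0..} l * l powr (s - 1) * exp (- (l * x))) \<partial>M) \<partial>lborel)"
    by (rule P.Fubini'[symmetric]) measurable
  also have "\<dots> = (\<integral>\<^sup>+l. ennreal (indicator {0..} l * l powr (s - 1)) * ennreal (exp (- (l powr a))) \<partial>lborel)"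
  proof (rule nn_integral_cong)
    fix l :: real
    have "(\<integral>\<^sup>+x. ennreal (indicator {0..} l * l powr (s - 1) * exp (- (l * x))) \<partial>M) =
        ennreal (indicator {0..} l * l powr (s - 1)) * (\<integral>\<^sup>+x. ennreal (exp (- (l * x))) \<partial>M)"
      by (simp add: nn_integral_cmult ennreal_mult)
    also have "\<dots> = ennreal (indicator {0..} l * l powr (s - 1)) * ennreal (exp (- (l powr a)))"
      by (cases "l > 0") (auto simp: lap indicator_def)
    finally show "(\<integral>\<^sup>+x. ennreal (indicator {0..} l * l powr (s - 1) * exp (- (l * x))) \<partial>M) =
        ennreal (indicator {0..} l * l powr (s - 1)) * ennreal (exp (- (l powr a)))" .
  qed
  also have "\<dots> = (\<integral>\<^sup>+l. (\<integral>\<^sup>+u. ennreal (indicator {0..} l * l powr (s - 1)) *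
      (ennreal (exp (- u)) * indicator {l powr a..} u) \<partial>lborel) \<partial>lborel)"
  proof (rule nn_integral_cong)
    fix l :: real
    have "(\<integral>\<^sup>+u. ennreal (exp (- u)) * indicator {l powr a..} u \<partial>lborel) = ennreal (0 - (- exp (- (l powr a))))"
    proof (rule nn_integral_FTC_atLeast)
      show "((\<lambda>u::real. - exp (- u)) \<longlongrightarrow> 0) at_top"
        using tendsto_minus[OF filterlim_compose[OF exp_at_bot filterlim_uminus_at_bot_at_top]] by simp
    qed (auto intro!: derivative_eq_intros)
    then show "ennreal (indicator {0..} l * l powr (s - 1)) * ennreal (exp (- (l powr a))) =
        (\<integral>\<^sup>+u. ennreal (indicator {0..} l * l powr (s - 1)) * (ennreal (exp (- u)) * indicator {l powr a..} u) \<partial>lborel)"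
      by (subst nn_integral_cmult) auto
  qed
  also have "\<dots> = (\<integral>\<^sup>+u. (\<integral>\<^sup>+l. ennreal (indicator {0..} l * l powr (s - 1)) *
      (ennreal (exp (- u)) * indicator {l powr a..} u) \<partial>lborel) \<partial>lborel)"
    by (rule lborel_pair.Fubini') (unfold indicator_def atLeast_iff, measurable)
  also have "\<dots> = (\<integral>\<^sup>+u. ennreal (1 / s) * ennreal (indicator {0..} u * u powr (s / a + 1 - 1) / exp u) \<partial>lborel)"
  proof (rule nn_integral_cong)
    fix u :: real
    have iff: "l powr a \<le> u \<longleftrightarrow> l \<le> u powr (1 / a)" if "0 \<le> u" "0 \<le> l" for l
      using that a powr_mono2[of a l "u powr (1/a)"] powr_mono2[of "1/a" "l powr a" u]
      by (auto simp: powr_powr)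
    have "(\<integral>\<^sup>+l. ennreal (indicator {0..} l * l powr (s - 1)) * (ennreal (exp (- u)) * indicator {l powr a..} u) \<partial>lborel)
       = (\<integral>\<^sup>+l. ennreal (indicator {0..} u * exp (- u)) * ennreal (indicator {0..u powr (1/a)} l * l powr (s - 1)) \<partial>lborel)"
    proof (rule nn_integral_cong)
      fix l :: real
      show "ennreal (indicator {0..} l * l powr (s - 1)) * (ennreal (exp (- u)) * indicator {l powr a..} u) =
        ennreal (indicator {0..} u * exp (- u)) * ennreal (indicator {0..u powr (1/a)} l * l powr (s - 1))"
      proof (cases "0 \<le> u \<and> 0 \<le> l")
        case True
        then show ?thesis using iff[of l] by (auto simp: indicator_def mult.commute)
      next
        case False
        have "\<not> l powr a \<le> u" if "u < 0" using that powr_ge_zero[of l a] by linarith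
        then show ?thesis using False by (auto simp: indicator_def)
      qed
    qed
    also have "\<dots> = ennreal (indicator {0..} u * exp (- u)) * ennreal ((u powr (1/a)) powr s / s)"
      using s by (simp add: nn_integral_cmult nn_integral_powr_Icc)
    also have "\<dots> = ennreal (1 / s) * ennreal (indicator {0..} u * u powr (s / a + 1 - 1) / exp u)"
      using s by (simp add: ennreal_mult[symmetric] powr_powr exp_minus field_simps)
    finally show "(\<integral>\<^sup>+l. ennreal (indicator {0..} l * l powr (s - 1)) * (ennreal (exp (- u)) * indicator {l powr a..} u) \<partial>lborel)
       = ennreal (1 / s) * ennreal (indicator {0..} u * u powr (s / a + 1 - 1) / exp u)" .
  qed
  also have "\<dots> = ennreal (1 / s) * ennreal (Gamma (s / a + 1))"
    using s a Gamma_conv_nn_integral_real[of "s / a + 1"] by (subst nn_integral_cmult) (auto simp: add_pos_pos)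
  finally have eq: "ennreal (Gamma s) * (\<integral>\<^sup>+x. ennreal (x powr (- s)) \<partial>M) = ennreal (1 / s * Gamma (s / a + 1))"
    using s by (subst ennreal_mult') auto
  have "(\<integral>\<^sup>+x. ennreal (x powr (- s)) \<partial>M) = ennreal (1 / Gamma s * Gamma s) * (\<integral>\<^sup>+x. ennreal (x powr (- s)) \<partial>M)"
    using G by simp
  also have "\<dots> = ennreal (1 / Gamma s) * (ennreal (Gamma s) * (\<integral>\<^sup>+x. ennreal (x powr (- s)) \<partial>M))"
    using G by (subst ennreal_mult) (auto simp: mult.assoc)
  also have "\<dots> = ennreal (1 / Gamma s * (1 / s * Gamma (s / a + 1)))"
    unfolding eq using G by (subst ennreal_mult') auto
  also have "1 / Gamma s * (1 / s * Gamma (s / a + 1)) = Gamma (s / a + 1) / Gamma (s + 1)"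
    using s Gamma_plus1[of s] by (simp add: nonpos_Ints_def field_simps)
  finally show ?thesis .
qed

text \<open>
  Only the part \<open>u \<ge> K\<close> of Euler's integral is kept.  As \<open>K\<close> is arbitrary, \<open>\<Gamma>\<close> grows faster than every
  exponential, which is what the convergence of the Mittag-Leffler series needs.
\<close>

lemma Gamma_ge_powr:
  fixes y K :: real
  assumes y: "1 \<le> y" and K: "0 \<le> K"
  shows "K powr (y - 1) * exp (- K) \<le> Gamma y"
proof -
  have "ennreal (K powr (y - 1) * exp (- K)) = ennreal (K powr (y - 1)) * ennreal (0 - (- exp (- K)))"
    by (simp add: ennreal_mult)
  also have "ennreal (0 - (- exp (- K))) = (\<integral>\<^sup>+u. ennreal (exp (- u)) * indicator {K..} u \<partial>lborel)"
  proof (rule nn_integral_FTC_atLeast[symmetric])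
    show "((\<lambda>u::real. - exp (- u)) \<longlongrightarrow> 0) at_top"
      using tendsto_minus[OF filterlim_compose[OF exp_at_bot filterlim_uminus_at_bot_at_top]] by simp
  qed (auto intro!: derivative_eq_intros)
  also have "ennreal (K powr (y - 1)) * \<dots> = (\<integral>\<^sup>+u. ennreal (K powr (y - 1)) * (ennreal (exp (- u)) * indicator {K..} u) \<partial>lborel)"
    by (rule nn_integral_cmult[symmetric]) auto
  also have "\<dots> \<le> (\<integral>\<^sup>+u. ennreal (indicator {0..} u * u powr (y - 1) / exp u) \<partial>lborel)"
  proof (rule nn_integral_mono)
    fix u :: real
    show "ennreal (K powr (y - 1)) * (ennreal (exp (- u)) * indicator {K..} u) \<le>
        ennreal (indicator {0..} u * u powr (y - 1) / exp u)"
    proof (cases "K \<le> u")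
      case True
      then have "K powr (y - 1) \<le> u powr (y - 1)" using y K by (intro powr_mono2) auto
      then show ?thesis using True K
        by (auto simp: ennreal_mult[symmetric] exp_minus field_simps intro!: ennreal_leI)
    qed auto
  qed
  also have "\<dots> = ennreal (Gamma y)" using y by (intro Gamma_conv_nn_integral_real[symmetric]) auto
  finally show ?thesis using Gamma_real_pos[of y] y by (subst (asm) ennreal_le_iff) auto
qed

lemma summable_mittag_leffler:
  fixes a x :: real
  assumes a: "0 < a" and x: "0 \<le> x"
  shows "summable (\<lambda>k. x ^ k / Gamma (a * real k + a))"
proof -
  \<comment> \<open>With this choice the terms are dominated by a geometric series of ratio \<open>x / (2 x + 1)\<close>.\<close>
  define K where "K = (2 * x + 1) powr (1 / a)"
  have K: "0 < K" "K powr a = 2 * x + 1" using x a by (auto simp: K_def powr_powr)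
  define C where "C = exp K * K powr (1 - a)"
  obtain N where N: "1 / a \<le> real N" using real_arch_simple by blast
  show ?thesis
  proof (rule summable_comparison_test')
    show "summable (\<lambda>k. C * (x / (2 * x + 1)) ^ k)"
      using x by (intro summable_mult summable_geometric) auto
    fix k assume "N \<le> k"
    then have "1 / a \<le> real k" using N by linarith
    then have y: "1 \<le> a * real k + a" using a by (simp add: field_simps)
    have "K powr (a * real k + a - 1) * exp (- K) \<le> Gamma (a * real k + a)"
      using y K by (intro Gamma_ge_powr) auto
    moreover have "K powr (a * real k + a - 1) * exp (- K) = (2 * x + 1) ^ k / C"
    proof -
      have "K powr (a * real k + a - 1) = K powr (a * real k) / K powr (1 - a)"
        by (simp add: powr_diff[symmetric] algebra_simps)
      also have "K powr (a * real k) = (K powr a) ^ k"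
        using K x by (simp add: powr_powr[symmetric] powr_realpow)
      finally show ?thesis using K by (simp add: C_def exp_minus field_simps)
    qed
    ultimately have "(2 * x + 1) ^ k / C \<le> Gamma (a * real k + a)" by simp
    moreover have "0 < (2 * x + 1) ^ k / C" using x K by (auto simp: C_def)
    ultimately have "x ^ k / Gamma (a * real k + a) \<le> x ^ k / ((2 * x + 1) ^ k / C)"
      using x by (intro divide_left_mono mult_pos_pos) auto
    then show "norm (x ^ k / Gamma (a * real k + a)) \<le> C * (x / (2 * x + 1)) ^ k"
      using x y Gamma_real_pos[of "a * real k + a"] by (simp add: power_divide mult.commute)
  qed
qed

text \<open>
  The variable \<open>A\<^bsup>-a\<^esup>\<close> has moments \<open>k! / \<Gamma>(a k + 1)\<close>, so expanding the exponential and integrating term by term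
  produces the Mittag-Leffler series.  The nonnegativity recorded here is needed to recover the value from its
  image in the extended nonnegative reals.
\<close>

lemma mittag_leffler_stable:
  assumes M: "positive_stable a M" and a: "0 < a" and x: "0 \<le> x"
  shows "(\<integral>\<^sup>+A. ennreal (a * A powr (- a) * exp (- (x * A powr (- a)))) \<partial>M) =
      ennreal (mittag_leffler a a (- x)) \<and> 0 \<le> mittag_leffler a a (- x)"
proof -
  interpret M: prob_space M using M by (simp add: positive_stable_def)
  have [measurable_cong]: "sets M = sets borel" using M by (simp add: positive_stable_def)
  have pos: "AE x in M. 0 < x" using M by (simp add: positive_stable_def)
  define f where "f k A = a * A powr (- a) * ((- (x * A powr (- a))) ^ k /\<^sub>R fact k)" for k :: nat and A :: real
  have [measurable]: "f k \<in> borel_measurable borel" for k unfolding f_def by measurable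
  have mom: "has_bochner_integral M (\<lambda>A. A powr (- a * (real k + 1))) (fact (Suc k) / (Gamma (a * real k + a) * (a * (real k + 1))))" for k
  proof (rule has_bochner_integral_nn_integral)
    have pos': "0 < a * (real k + 1)" using a by simp
    have "(\<integral>\<^sup>+A. ennreal (A powr (- a * (real k + 1))) \<partial>M) =
        ennreal (Gamma (a * (real k + 1) / a + 1) / Gamma (a * (real k + 1) + 1))"
      using positive_stable_moment[OF M a pos'] by simp
    also have "Gamma (a * (real k + 1) / a + 1) = fact (Suc k)"
      using a Gamma_fact[of "Suc k", where 'a=real] by (simp add: add_ac)
    also have "Gamma (a * (real k + 1) + 1) = (a * (real k + 1)) * Gamma (a * (real k + 1))"
      using pos' by (intro Gamma_plus1) (auto elim!: nonpos_Ints_cases)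
    finally show "(\<integral>\<^sup>+A. ennreal (A powr (- a * (real k + 1))) \<partial>M) =
        ennreal (fact (Suc k) / (Gamma (a * real k + a) * (a * (real k + 1))))"
      by (simp add: algebra_simps)
    show "0 \<le> fact (Suc k) / (Gamma (a * real k + a) * (a * (real k + 1)))"
      using a by (intro divide_nonneg_nonneg mult_nonneg_nonneg) (auto intro!: less_imp_le[OF Gamma_real_pos] add_nonneg_pos)
  qed auto
  have fk: "has_bochner_integral M (f k) ((- x) ^ k / Gamma (a * real k + a))"
    "has_bochner_integral M (\<lambda>A. norm (f k A)) (x ^ k / Gamma (a * real k + a))" for k
  proof -
    have G: "Gamma (a * real k + a) > 0" using a by (intro Gamma_real_pos add_nonneg_pos) auto
    have pw: "A powr (- a * (real k + 1)) = A powr (- a) * (A powr (- a)) ^ k" if "0 < A" for A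
      using that by (simp add: powr_realpow[symmetric] powr_powr powr_add[symmetric] algebra_simps)
    have 1: "has_bochner_integral M (\<lambda>A. a * z ^ k / fact k * A powr (- a * (real k + 1))) (z ^ k / Gamma (a * real k + a))" for z :: real
    proof -
      have "a * z ^ k / fact k * (fact (Suc k) / (Gamma (a * real k + a) * (a * (real k + 1)))) =
          z ^ k / Gamma (a * real k + a)"
        using a G by (simp add: divide_simps)
      then show ?thesis
        using has_bochner_integral_mult_right[OF mom[of k], of "a * z ^ k / fact k"] by simp
    qed
    have fkA: "f k A = a * (- x) ^ k / fact k * A powr (- a * (real k + 1))" if "0 < A" for A
    proof -
      have "- (x * A powr (- a)) = (- x) * A powr (- a)" by simp
      then show ?thesis
        unfolding f_def pw[OF that] by (simp only: power_mult_distrib scaleR_conv_of_real) (simp add: field_simps)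
    qed
    show "has_bochner_integral M (f k) ((- x) ^ k / Gamma (a * real k + a))"
    proof (rule has_bochner_integralI_AE[OF 1[of "- x"]])
      show "AE A in M. a * (- x) ^ k / fact k * A powr (- a * (real k + 1)) = f k A"
        using pos by eventually_elim (simp only: fkA)
    qed measurable
    show "has_bochner_integral M (\<lambda>A. norm (f k A)) (x ^ k / Gamma (a * real k + a))"
    proof (rule has_bochner_integralI_AE[OF 1[of x]])
      show "AE A in M. a * x ^ k / fact k * A powr (- a * (real k + 1)) = norm (f k A)"
        using pos by eventually_elim (use a x in \<open>simp add: fkA abs_mult power_abs\<close>)
    qed measurable
  qed
  have exps: "(\<lambda>k. f k A) sums (a * A powr (- a) * exp (- (x * A powr (- a))))" for A
    unfolding f_def by (intro sums_mult exp_converges)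
  have abs: "summable (\<lambda>k. norm (f k A))" for A
    using summable_mult[OF summable_norm_exp[of "- (x * A powr (- a))"], of "\<bar>a * A powr (- a)\<bar>"]
    by (simp add: f_def abs_mult)
  have eq: "(\<Sum>k. f k A) = a * A powr (- a) * exp (- (x * A powr (- a)))" for A
    using exps sums_unique by metis
  have sm: "summable (\<lambda>k. \<integral>A. norm (f k A) \<partial>M)"
    unfolding has_bochner_integral_integral_eq[OF fk(2)] by (rule summable_mittag_leffler[OF a x])
  have "integrable M (\<lambda>A. \<Sum>k. f k A)"
    by (rule integrable_suminf[OF _ _ sm]) (use fk abs in \<open>auto simp: has_bochner_integral_iff\<close>)
  moreover have "(\<integral>A. (\<Sum>k. f k A) \<partial>M) = (\<Sum>k. integral\<^sup>L M (f k))"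
    by (rule integral_suminf[OF _ _ sm]) (use fk abs in \<open>auto simp: has_bochner_integral_iff\<close>)
  moreover have "(\<Sum>k. integral\<^sup>L M (f k)) = mittag_leffler a a (- x)"
    by (simp add: mittag_leffler_def has_bochner_integral_integral_eq[OF fk(1)])
  moreover have "0 \<le> (\<integral>A. a * A powr (- a) * exp (- (x * A powr (- a))) \<partial>M)"
    using a by (intro integral_nonneg_AE) auto
  ultimately show ?thesis
    unfolding eq using a by (simp add: nn_integral_eq_integral)
qed

text \<open>
  The last clause is the integrability near \<open>0\<close> that makes \<open>L\<^sup>p\<close> norms of the Gaussian mixture finite in
  the subcritical range.
\<close>

definition mixing_measure :: "real \<Rightarrow> real \<Rightarrow> real measure \<Rightarrow> bool" where
  "mixing_measure a b \<mu> \<longleftrightarrow> finite_measure \<mu> \<and> sets \<mu> = sets borel \<and> (AE r in \<mu>. 0 < r) \<and>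
     emeasure \<mu> UNIV \<noteq> 0 \<and>
     (\<forall>s\<ge>0. (\<integral>\<^sup>+r. ennreal (exp (- (s * r))) \<partial>\<mu>) = ennreal (mittag_leffler a a (- (s powr b))) \<and>
        0 \<le> mittag_leffler a a (- (s powr b))) \<and>
     (\<forall>k. 0 \<le> k \<longrightarrow> k < 1 \<longrightarrow> (\<integral>\<^sup>+r. ennreal (r powr (- (k * b))) \<partial>\<mu>) < \<infinity>)"

lemma mixing_measure_exists:
  assumes a: "0 < a" "a \<le> 1" and b: "0 < b" "b \<le> 1"
  shows "\<exists>\<mu>. mixing_measure a b \<mu>"
proof -
  obtain MA where MA: "positive_stable a MA" using positive_stable_exists[OF a] by auto
  obtain MB where MB: "positive_stable b MB" using positive_stable_exists[OF b] by auto
  interpret A: prob_space MA using MA by (simp add: positive_stable_def)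
  interpret B: prob_space MB using MB by (simp add: positive_stable_def)
  interpret P: pair_sigma_finite MA MB ..
  have sets [measurable_cong]: "sets MA = sets borel" "sets MB = sets borel"
    using MA MB by (simp_all add: positive_stable_def)
  have posA: "AE x in MA. 0 < x" and posB: "AE x in MB. 0 < x"
    using MA MB by (simp_all add: positive_stable_def)
  define D where "D = density (MA \<Otimes>\<^sub>M MB) (\<lambda>(A, B). ennreal (a * A powr (- a)))"
  define \<mu> where "\<mu> = distr D borel (\<lambda>(A, B). A powr (- (a / b)) * B)"
  have setsD [measurable_cong]: "sets D = sets (MA \<Otimes>\<^sub>M MB)" by (simp add: D_def)
  have int: "(\<integral>\<^sup>+r. h r \<partial>\<mu>) =
      (\<integral>\<^sup>+A. \<integral>\<^sup>+B. ennreal (a * A powr (- a)) * h (A powr (- (a / b)) * B) \<partial>MB \<partial>MA)"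
    if [measurable]: "h \<in> borel_measurable borel" for h :: "real \<Rightarrow> ennreal"
  proof -
    have "(\<integral>\<^sup>+r. h r \<partial>\<mu>) = (\<integral>\<^sup>+z. h (fst z powr (- (a / b)) * snd z) \<partial>D)"
      unfolding \<mu>_def by (subst nn_integral_distr) (auto simp: case_prod_unfold)
    also have "\<dots> = (\<integral>\<^sup>+z. ennreal (a * fst z powr (- a)) * h (fst z powr (- (a / b)) * snd z) \<partial>(MA \<Otimes>\<^sub>M MB))"
      unfolding D_def case_prod_unfold by (subst nn_integral_density) auto
    also have "\<dots> = (\<integral>\<^sup>+A. \<integral>\<^sup>+B. ennreal (a * A powr (- a)) * h (A powr (- (a / b)) * B) \<partial>MB \<partial>MA)"
      by (subst B.nn_integral_fst[symmetric]) auto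
    finally show ?thesis .
  qed
  have mA: "(\<integral>\<^sup>+A. ennreal (a * A powr (- a)) \<partial>MA) = ennreal (mittag_leffler a a 0)"
    using mittag_leffler_stable[OF MA a(1), of 0] by simp
  have lap: "(\<integral>\<^sup>+r. ennreal (exp (- (s * r))) \<partial>\<mu>) = ennreal (mittag_leffler a a (- (s powr b)))" if s: "s \<ge> 0" for s
  proof -
    have "(\<integral>\<^sup>+r. ennreal (exp (- (s * r))) \<partial>\<mu>) =
        (\<integral>\<^sup>+A. \<integral>\<^sup>+B. ennreal (a * A powr (- a)) * ennreal (exp (- (s * (A powr (- (a / b)) * B)))) \<partial>MB \<partial>MA)"
      by (rule int) measurable
    also have "\<dots> = (\<integral>\<^sup>+A. ennreal (a * A powr (- a) * exp (- (s powr b * A powr (- a)))) \<partial>MA)"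
    proof (rule nn_integral_cong_AE, use posA in eventually_elim)
      fix A :: real assume A: "0 < A"
      show "(\<integral>\<^sup>+B. ennreal (a * A powr (- a)) * ennreal (exp (- (s * (A powr (- (a / b)) * B)))) \<partial>MB) =
          ennreal (a * A powr (- a) * exp (- (s powr b * A powr (- a))))"
      proof (cases "s = 0")
        case True
        then show ?thesis using B.emeasure_space_1 by simp
      next
        case False
        then have l: "0 < s * A powr (- (a / b))" using s A by auto
        have "(\<integral>\<^sup>+B. ennreal (exp (- (s * A powr (- (a / b)) * B))) \<partial>MB) = ennreal (exp (- ((s * A powr (- (a / b))) powr b)))"
          using MB l unfolding positive_stable_def by blast
        also have "(s * A powr (- (a / b))) powr b = s powr b * A powr (- a)"
          using s b by (simp add: powr_mult powr_powr)
        finally show ?thesis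
          using a by (simp add: nn_integral_cmult ennreal_mult mult.assoc)
      qed
    qed
    also have "\<dots> = ennreal (mittag_leffler a a (- (s powr b)))"
      using mittag_leffler_stable[OF MA a(1), of "s powr b"] by simp
    finally show ?thesis .
  qed
  have Ga: "Gamma a > 0" using a by (intro Gamma_real_pos) auto
  have "a \<notin> \<int>\<^sub>\<le>\<^sub>0" using a by (auto elim!: nonpos_Ints_cases)
  then have Ga1: "Gamma (a + 1) = a * Gamma a" by (rule Gamma_plus1)
  have total: "emeasure \<mu> UNIV = ennreal (1 / Gamma a)"
  proof -
    have "emeasure \<mu> UNIV = (\<integral>\<^sup>+r. 1 \<partial>\<mu>)" by (simp add: \<mu>_def)
    also have "\<dots> = (\<integral>\<^sup>+A. \<integral>\<^sup>+B. ennreal (a * A powr (- a)) * 1 \<partial>MB \<partial>MA)"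
      by (rule int) measurable
    also have "\<dots> = ennreal a * (\<integral>\<^sup>+A. ennreal (A powr (- a)) \<partial>MA)"
      using a B.emeasure_space_1 by (simp add: ennreal_mult nn_integral_cmult)
    also have "\<dots> = ennreal a * ennreal (Gamma (a / a + 1) / Gamma (a + 1))"
      by (subst positive_stable_moment[OF MA a(1) a(1)]) simp
    also have "\<dots> = ennreal (a * (Gamma (a / a + 1) / Gamma (a + 1)))"
      using a by (intro ennreal_mult'[symmetric]) auto
    also have "a * (Gamma (a / a + 1) / Gamma (a + 1)) = 1 / Gamma a"
      unfolding Ga1 using a Ga Gamma_fact[of 1, where 'a=real] by simp
    finally show ?thesis .
  qed
  have mom: "(\<integral>\<^sup>+r. ennreal (r powr (- (k * b))) \<partial>\<mu>) < \<infinity>" if k: "0 \<le> k" "k < 1" for k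
  proof -
    have finB: "(\<integral>\<^sup>+B. ennreal (B powr (- (k * b))) \<partial>MB) < \<infinity>"
    proof (cases "k = 0")
      case True
      have "(\<integral>\<^sup>+B. ennreal (B powr (- (k * b))) \<partial>MB) \<le> (\<integral>\<^sup>+B. 1 \<partial>MB)"
        by (intro nn_integral_mono) (auto simp: True)
      then show ?thesis using B.emeasure_space_1 by (simp add: less_top[symmetric] top_unique) (metis ennreal_one_neq_top neq_top_trans)
    next
      case False
      then show ?thesis using k b by (subst positive_stable_moment[OF MB b(1)]) auto
    qed
    have pa: "0 < a * (1 - k)" using a k by simp
    have "(\<integral>\<^sup>+r. ennreal (r powr (- (k * b))) \<partial>\<mu>) =
        (\<integral>\<^sup>+A. \<integral>\<^sup>+B. ennreal (a * A powr (- a)) * ennreal ((A powr (- (a / b)) * B) powr (- (k * b))) \<partial>MB \<partial>MA)"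
      by (rule int) measurable
    also have "\<dots> = (\<integral>\<^sup>+A. ennreal (a * A powr (- (a * (1 - k)))) * (\<integral>\<^sup>+B. ennreal (B powr (- (k * b))) \<partial>MB) \<partial>MA)"
    proof (rule nn_integral_cong)
      fix A :: real
      have "(\<integral>\<^sup>+B. ennreal (a * A powr (- a)) * ennreal ((A powr (- (a / b)) * B) powr (- (k * b))) \<partial>MB) =
          (\<integral>\<^sup>+B. ennreal (a * A powr (- (a * (1 - k)))) * ennreal (B powr (- (k * b))) \<partial>MB)"
      proof (rule nn_integral_cong_AE, use posB in eventually_elim)
        fix B :: real assume "0 < B"
        have "A powr (- a) * (A powr (- (a / b)) * B) powr (- (k * b)) = A powr (- (a * (1 - k))) * B powr (- (k * b))"
        proof -
          have "(A powr (- (a / b)) * B) powr (- (k * b)) = A powr (a * k) * B powr (- (k * b))"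
            using \<open>0 < B\<close> b by (simp add: powr_mult powr_powr)
          moreover have "A powr (- a) * A powr (a * k) = A powr (- (a * (1 - k)))"
            by (simp add: powr_add[symmetric] algebra_simps)
          ultimately show ?thesis by (simp add: mult.assoc[symmetric])
        qed
        then have "a * A powr (- a) * (A powr (- (a / b)) * B) powr (- (k * b)) = a * A powr (- (a * (1 - k))) * B powr (- (k * b))"
          by (simp add: mult.assoc)
        then show "ennreal (a * A powr (- a)) * ennreal ((A powr (- (a / b)) * B) powr (- (k * b))) =
            ennreal (a * A powr (- (a * (1 - k)))) * ennreal (B powr (- (k * b)))"
          using a by (simp add: ennreal_mult'[symmetric])
      qed
      also have "\<dots> = ennreal (a * A powr (- (a * (1 - k)))) * (\<integral>\<^sup>+B. ennreal (B powr (- (k * b))) \<partial>MB)"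
        by (rule nn_integral_cmult) measurable
      finally show "(\<integral>\<^sup>+B. ennreal (a * A powr (- a)) * ennreal ((A powr (- (a / b)) * B) powr (- (k * b))) \<partial>MB) = \<dots>" .
    qed
    also have "\<dots> = ennreal a * (\<integral>\<^sup>+A. ennreal (A powr (- (a * (1 - k)))) \<partial>MA) * (\<integral>\<^sup>+B. ennreal (B powr (- (k * b))) \<partial>MB)"
      using a by (simp add: nn_integral_multc ennreal_mult nn_integral_cmult)
    also have "\<dots> < \<infinity>"
      using finB unfolding positive_stable_moment[OF MA a(1) pa] by (auto simp: ennreal_mult_less_top)
    finally show ?thesis .
  qed
  have pos: "AE r in \<mu>. 0 < r"
  proof -
    have "AE z in MA \<Otimes>\<^sub>M MB. 0 < fst z powr (- (a / b)) * snd z"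
    proof (rule P.AE_pair_measure)
      show "AE x in MA. AE y in MB. 0 < fst (x, y) powr (- (a / b)) * snd (x, y)"
        using posA by eventually_elim (use posB in eventually_elim, auto)
    qed measurable
    then have "AE z in D. 0 < fst z powr (- (a / b)) * snd z"
      unfolding D_def case_prod_unfold by (subst AE_density) auto
    then show ?thesis unfolding \<mu>_def by (subst AE_distr_iff) (auto simp: case_prod_unfold)
  qed
  have "mixing_measure a b \<mu>"
    unfolding mixing_measure_def
  proof (intro conjI allI impI)
    show "finite_measure \<mu>" by (rule finite_measureI) (use total in \<open>simp add: \<mu>_def\<close>)
    show "emeasure \<mu> UNIV \<noteq> 0" using total Ga by simp
    show "0 \<le> mittag_leffler a a (- (s powr b))" for s
      using mittag_leffler_stable[OF MA a(1), of "s powr b"] by simp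
  qed (use pos lap mom in \<open>simp_all add: \<mu>_def\<close>)
  then show ?thesis by blast
qed

section \<open>Gaussian kernels and uniqueness of Fourier transforms\<close>

text \<open>
  The complex-valued counterpart of \<open>nn_integral_lborel_prod\<close>; it reduces the Fourier transform of a Gaussian
  to dimension one.
\<close>

lemma lborel_integral_prod:
  fixes f :: "'a::euclidean_space \<Rightarrow> real \<Rightarrow> complex"
  assumes f: "\<And>b. b \<in> Basis \<Longrightarrow> integrable lborel (f b)"
  shows "(\<integral>x. (\<Prod>b\<in>Basis. f b (x \<bullet> b)) \<partial>lborel) = (\<Prod>b\<in>Basis. (\<integral>x. f b x \<partial>lborel))"
proof -
  interpret product_sigma_finite "\<lambda>_::'a. lborel :: real measure" ..
  have [measurable]: "\<And>b. b \<in> Basis \<Longrightarrow> f b \<in> borel_measurable borel"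
    using f by (auto dest: borel_measurable_integrable)
  have "(\<integral>x. (\<Prod>b\<in>Basis. f b (x \<bullet> b)) \<partial>lborel) =
      (\<integral>x. (\<Prod>b\<in>Basis. f b ((\<Sum>c\<in>Basis. x c *\<^sub>R c) \<bullet> b)) \<partial>(\<Pi>\<^sub>M b\<in>(Basis::'a set). lborel))"
    by (subst lborel_eq) (subst integral_distr, auto)
  also have "\<dots> = (\<integral>x. (\<Prod>b\<in>Basis. f b (x b)) \<partial>(\<Pi>\<^sub>M b\<in>(Basis::'a set). lborel))"
    by (intro Bochner_Integration.integral_cong refl prod.cong)
      (simp add: inner_sum_left inner_Basis if_distrib[of "\<lambda>x. _ * x"] cong: if_cong)
  also have "\<dots> = (\<Prod>b\<in>Basis. (\<integral>x. f b x \<partial>lborel))"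
    by (rule product_integral_prod) (use f in auto)
  finally show ?thesis .
qed

lemma normal_density_fourier:
  assumes s: "0 < s"
  shows "(\<integral>x. iexp (t * x) * complex_of_real (normal_density 0 s x) \<partial>lborel) = exp (- (s * t)\<^sup>2 / 2)"
proof -
  have "(\<integral>x. iexp (t * x) * complex_of_real (normal_density 0 s x) \<partial>lborel) =
      s *\<^sub>R (\<integral>x. iexp (t * (0 + s * x)) * complex_of_real (normal_density 0 s (0 + s * x)) \<partial>lborel)"
    using s lborel_integral_real_affine[of s "\<lambda>x. iexp (t * x) * complex_of_real (normal_density 0 s x)" 0] by simp
  also have "\<dots> = (\<integral>x. s *\<^sub>R (iexp (t * (0 + s * x)) * complex_of_real (normal_density 0 s (0 + s * x))) \<partial>lborel)"
    by (rule integral_scaleR_right[symmetric])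
  also have "\<dots> = (\<integral>x. std_normal_density x *\<^sub>R iexp ((s * t) * x) \<partial>lborel)"
  proof (rule Bochner_Integration.integral_cong[OF refl])
    fix x :: real
    have "s * normal_density 0 s (s * x) = std_normal_density x"
      using s by (simp add: normal_density_def power_mult_distrib real_sqrt_mult)
    then show "s *\<^sub>R (iexp (t * (0 + s * x)) * complex_of_real (normal_density 0 s (0 + s * x))) =
        std_normal_density x *\<^sub>R iexp ((s * t) * x)"
      by (simp add: scaleR_conv_of_real mult_ac flip: of_real_mult)
  qed
  also have "\<dots> = char std_normal_distribution (s * t)"
    unfolding char_def by (subst integral_density) (auto simp: normal_density_nonneg)
  finally show ?thesis by (simp add: char_std_normal_distribution)
qed

text \<open>
  The Gaussian density whose coordinates have variance \<open>2 r\<close>, that is, the heat kernel at time \<open>r\<close>.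
\<close>

definition heat_kernel :: "real \<Rightarrow> 'a::euclidean_space \<Rightarrow> real" where
  "heat_kernel r x = exp (- (norm x)\<^sup>2 / (4 * r)) / (4 * pi * r) powr (real DIM('a) / 2)"

lemma heat_kernel_measurable [measurable]:
  assumes [measurable]: "f \<in> borel_measurable M" "g \<in> borel_measurable M"
  shows "(\<lambda>z. heat_kernel (f z) (g z :: 'a::euclidean_space)) \<in> borel_measurable M"
  unfolding heat_kernel_def by measurable

lemma heat_kernel_nonneg: "0 \<le> heat_kernel r x"
  by (simp add: heat_kernel_def)

lemma heat_kernel_pos: "0 < r \<Longrightarrow> 0 < heat_kernel r x"
  by (simp add: heat_kernel_def)

lemma power2_norm_eq_sum: "(norm (x::'a::euclidean_space))\<^sup>2 = (\<Sum>b\<in>Basis. (x \<bullet> b)\<^sup>2)"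
  by (subst power2_norm_eq_inner, subst euclidean_inner) (simp add: power2_eq_square)

lemma heat_kernel_prod:
  fixes x :: "'a::euclidean_space"
  assumes r: "0 < r"
  shows "heat_kernel r x = (\<Prod>b\<in>Basis. normal_density 0 (sqrt (2 * r)) (x \<bullet> b))"
proof -
  have "normal_density 0 (sqrt (2 * r)) (x \<bullet> b) = exp (- (x \<bullet> b)\<^sup>2 / (4 * r)) / sqrt (4 * pi * r)" for b
    using r by (simp add: normal_density_def mult_ac)
  then have "(\<Prod>b\<in>Basis. normal_density 0 (sqrt (2 * r)) (x \<bullet> b)) =
      exp (\<Sum>b\<in>Basis. - (x \<bullet> b)\<^sup>2 / (4 * r)) / sqrt (4 * pi * r) ^ DIM('a)"
    by (simp add: prod_dividef exp_sum)
  also have "(\<Sum>b\<in>Basis. - (x \<bullet> b)\<^sup>2 / (4 * r)) = - (norm x)\<^sup>2 / (4 * r)"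
    unfolding power2_norm_eq_sum by (simp add: sum_negf sum_divide_distrib)
  also have "sqrt (4 * pi * r) ^ DIM('a) = (4 * pi * r) powr (real DIM('a) / 2)"
    using r by (simp add: powr_half_sqrt[symmetric] powr_powr powr_realpow[symmetric])
  finally show ?thesis by (simp add: heat_kernel_def)
qed

lemma nn_integral_heat_kernel:
  assumes r: "0 < r"
  shows "(\<integral>\<^sup>+x. ennreal (heat_kernel r (x::'a::euclidean_space)) \<partial>lborel) = 1"
proof -
  have "(\<integral>\<^sup>+x. ennreal (heat_kernel r (x::'a)) \<partial>lborel) =
      (\<integral>\<^sup>+x. (\<Prod>b\<in>Basis. ennreal (normal_density 0 (sqrt (2 * r)) (x \<bullet> b))) \<partial>(lborel :: 'a measure))"
    using r by (simp add: heat_kernel_prod prod_ennreal)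
  also have "\<dots> = (\<Prod>b\<in>(Basis :: 'a set). (\<integral>\<^sup>+x. ennreal (normal_density 0 (sqrt (2 * r)) x) \<partial>lborel))"
    by (rule nn_integral_lborel_prod) auto
  also have "\<dots> = 1"
    using r by (subst nn_integral_eq_integral) auto
  finally show ?thesis .
qed

lemma integrable_heat_kernel:
  assumes r: "0 < r"
  shows "integrable lborel (heat_kernel r :: 'a::euclidean_space \<Rightarrow> real)"
proof (rule integrableI_bounded)
  show "(\<integral>\<^sup>+x. ennreal (norm (heat_kernel r (x::'a))) \<partial>lborel) < \<infinity>"
    using nn_integral_heat_kernel[OF r, where 'a='a] by (simp add: heat_kernel_nonneg)
qed simp

lemma heat_kernel_fourier:
  fixes \<xi> :: "'a::euclidean_space"
  assumes r: "0 < r"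
  shows "(\<integral>x. exp (- (\<i> * complex_of_real (x \<bullet> \<xi>))) * complex_of_real (heat_kernel r x) \<partial>lborel) =
    complex_of_real (exp (- (r * (norm \<xi>)\<^sup>2)))"
proof -
  let ?n = "normal_density 0 (sqrt (2 * r))"
  have ex: "exp (- (\<i> * complex_of_real (x \<bullet> \<xi>))) = (\<Prod>b\<in>Basis. iexp (- (\<xi> \<bullet> b) * (x \<bullet> b)))" for x :: 'a
    by (subst euclidean_inner) (simp add: exp_sum[symmetric] sum_distrib_left sum_negf mult_ac)
  have "(\<integral>x. exp (- (\<i> * complex_of_real (x \<bullet> \<xi>))) * complex_of_real (heat_kernel r x) \<partial>lborel) =
      (\<integral>x. (\<Prod>b\<in>Basis. iexp (- (\<xi> \<bullet> b) * (x \<bullet> b)) * complex_of_real (?n (x \<bullet> b))) \<partial>(lborel :: 'a measure))"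
    unfolding ex heat_kernel_prod[OF r] by (simp add: prod.distrib)
  also have "\<dots> = (\<Prod>b\<in>(Basis::'a set). \<integral>x. iexp (- (\<xi> \<bullet> b) * x) * complex_of_real (?n x) \<partial>lborel)"
  proof (rule lborel_integral_prod)
    fix b :: 'a
    have "integrable lborel (\<lambda>x. norm (complex_of_real (?n x)))" using r by (simp add: normal_density_nonneg)
    then show "integrable lborel (\<lambda>x. iexp (- (\<xi> \<bullet> b) * x) * complex_of_real (?n x))"
      by (rule Bochner_Integration.integrable_bound) (auto simp: norm_mult)
  qed
  also have "\<dots> = (\<Prod>b\<in>(Basis::'a set). complex_of_real (exp (- (sqrt (2 * r) * - (\<xi> \<bullet> b))\<^sup>2 / 2)))"
    using r by (subst normal_density_fourier) auto
  also have "\<dots> = complex_of_real (exp (\<Sum>b\<in>(Basis::'a set). - (r * (\<xi> \<bullet> b)\<^sup>2)))"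
    using r by (simp add: exp_sum power_mult_distrib)
  also have "(\<Sum>b\<in>(Basis::'a set). - (r * (\<xi> \<bullet> b)\<^sup>2)) = - (r * (norm \<xi>)\<^sup>2)"
    unfolding power2_norm_eq_sum by (simp add: sum_negf sum_distrib_left)
  finally show ?thesis .
qed

text \<open>
  A power of a Gaussian is a multiple of a narrower Gaussian, so that its \<open>L\<^sup>p\<close> norm needs no new integral.
\<close>

lemma heat_kernel_powr:
  fixes x :: "'a::euclidean_space"
  assumes r: "0 < r" and p: "0 < p"
  shows "heat_kernel r x powr p =
    (4 * pi * (r / p)) powr (real DIM('a) / 2) / (4 * pi * r) powr (real DIM('a) / 2 * p) * heat_kernel (r / p) x"
  using assms unfolding heat_kernel_def
  by (simp add: powr_divide powr_powr exp_powr_real field_simps)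

text \<open>
  With \<open>q = |x|\<^sup>2 / (4 r)\<close> and \<open>m = N / 2\<close>, the product of the kernel and \<open>|x|\<^sup>N\<close> is \<open>(q / \<pi>)\<^bsup>m\<^esup> exp(-q)\<close>, which is
  bounded in \<open>q\<close>.
\<close>

lemma heat_kernel_le_norm:
  "\<exists>C>0. \<forall>r>0. \<forall>x::'a::euclidean_space. x \<noteq> 0 \<longrightarrow> heat_kernel r x \<le> C * norm x powr (- real DIM('a))"
proof -
  define m where "m = real DIM('a) / 2"
  have m: "0 < m" by (simp add: m_def)
  have "heat_kernel r x \<le> (m / pi) powr m * norm x powr (- real DIM('a))" if r: "r > 0" and x: "x \<noteq> 0" for r and x :: 'a
  proof -
    define q where "q = (norm x)\<^sup>2 / (4 * r)"
    have q: "0 < q" using r x by (simp add: q_def)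
    have "q / m \<le> exp (q / m)" using exp_ge_add_one_self[of "q / m"] by linarith
    then have "q \<le> m * exp (q / m)" using m by (simp add: field_simps)
    then have "q powr m \<le> (m * exp (q / m)) powr m" using q m by (intro powr_mono2) auto
    also have "\<dots> = m powr m * exp q" using m by (simp add: powr_mult exp_powr_real)
    finally have qm: "q powr m * exp (- q) \<le> m powr m" by (simp add: exp_minus field_simps)
    have "norm x powr real DIM('a) = ((norm x)\<^sup>2) powr m"
      using x by (simp add: m_def powr_powr flip: powr_numeral)
    also have "(norm x)\<^sup>2 = q * (4 * r)" using r by (simp add: q_def)
    finally have nx: "norm x powr real DIM('a) = q powr m * (4 * r) powr m" using q r by (simp add: powr_mult)
    have "heat_kernel r x * norm x powr real DIM('a) = q powr m * exp (- q) / pi powr m"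
      unfolding nx heat_kernel_def using r q
      by (simp add: powr_mult q_def[symmetric] m_def[symmetric])
    also have "\<dots> \<le> m powr m / pi powr m" using qm by (intro divide_right_mono) auto
    also have "\<dots> = (m / pi) powr m" using m by (simp add: powr_divide)
    finally show ?thesis using x by (simp add: powr_minus field_simps)
  qed
  moreover have "(m / pi) powr m > 0" using m by simp
  ultimately show ?thesis by blast
qed

lemma heat_kernel_mono:
  fixes x y :: "'a::euclidean_space"
  assumes "0 < r" "norm x \<le> norm y"
  shows "heat_kernel r y \<le> heat_kernel r x"
  using assms by (auto simp: heat_kernel_def intro!: divide_right_mono power_mono)

lemma nn_integral_lborel_affine:
  fixes f :: "'a::euclidean_space \<Rightarrow> ennreal" and t :: 'a
  assumes [measurable]: "f \<in> borel_measurable borel" and c: "c \<noteq> 0"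
  shows "(\<integral>\<^sup>+x. f x \<partial>lborel) = ennreal (\<bar>c\<bar> ^ DIM('a)) * (\<integral>\<^sup>+x. f (t + c *\<^sub>R x) \<partial>lborel)"
  by (subst lborel_affine[OF c, of t])
    (simp add: nn_integral_density nn_integral_distr nn_integral_cmult)

lemma lborel_integral_affine:
  fixes f :: "'a::euclidean_space \<Rightarrow> real" and t :: 'a
  assumes [measurable]: "f \<in> borel_measurable borel" and c: "c \<noteq> 0"
  shows "(\<integral>x. f x \<partial>lborel) = \<bar>c\<bar> ^ DIM('a) * (\<integral>x. f (t + c *\<^sub>R x) \<partial>lborel)"
  by (subst lborel_affine[OF c, of t])
    (simp add: integral_density integral_distr)

lemma heat_kernel_scale:
  fixes z :: "'a::euclidean_space"
  assumes r: "0 < r"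
  shows "sqrt r ^ DIM('a) * heat_kernel r (sqrt r *\<^sub>R z) = heat_kernel 1 z"
proof -
  have "sqrt r ^ DIM('a) = r powr (real DIM('a) / 2)"
    using r by (simp add: powr_half_sqrt[symmetric] powr_powr powr_realpow[symmetric])
  then show ?thesis
    using r by (simp add: heat_kernel_def power_mult_distrib powr_mult)
qed

lemma integrable_lborel_translate_heat:
  fixes h :: "'a::euclidean_space \<Rightarrow> real"
  assumes h: "integrable lborel h" and r: "0 < r"
  shows "integrable (lborel \<Otimes>\<^sub>M lborel) (\<lambda>(x, y). h y * heat_kernel r (x - y))"
proof (rule integrableI_bounded)
  have [measurable]: "h \<in> borel_measurable borel" using h by (auto dest: borel_measurable_integrable)
  show "(\<lambda>(x, y). h y * heat_kernel r (x - y)) \<in> borel_measurable (lborel \<Otimes>\<^sub>M lborel)"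
    by measurable
  have "(\<integral>\<^sup>+z. ennreal (norm (case z of (x, y) \<Rightarrow> h y * heat_kernel r (x - y))) \<partial>(lborel \<Otimes>\<^sub>M lborel)) =
      (\<integral>\<^sup>+y. \<integral>\<^sup>+x. ennreal \<bar>h y\<bar> * ennreal (heat_kernel r (x - y)) \<partial>lborel \<partial>lborel)"
    by (subst lborel_pair.nn_integral_snd[symmetric])
      (auto simp: abs_mult heat_kernel_nonneg ennreal_mult)
  also have "\<dots> = (\<integral>\<^sup>+y. ennreal \<bar>h y\<bar> * 1 \<partial>lborel)"
  proof (rule nn_integral_cong)
    fix y :: 'a
    have "(\<integral>\<^sup>+x. ennreal (heat_kernel r (x - y)) \<partial>lborel) = 1"
      using nn_integral_lborel_affine[of "\<lambda>x. ennreal (heat_kernel r (x - y))" 1 y] nn_integral_heat_kernel[OF r, where 'a='a]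
      by simp
    then show "(\<integral>\<^sup>+x. ennreal \<bar>h y\<bar> * ennreal (heat_kernel r (x - y)) \<partial>lborel) = ennreal \<bar>h y\<bar> * 1"
      by (simp add: nn_integral_cmult)
  qed
  also have "\<dots> < \<infinity>"
    using h by (simp add: integrable_iff_bounded)
  finally show "(\<integral>\<^sup>+z. ennreal (norm (case z of (x, y) \<Rightarrow> h y * heat_kernel r (x - y))) \<partial>(lborel \<Otimes>\<^sub>M lborel)) < \<infinity>" .
qed

lemma integrable_lborel_product:
  fixes f :: "'a::euclidean_space \<Rightarrow> real" and g :: "'b::euclidean_space \<Rightarrow> real"
  assumes f: "integrable lborel f" and g: "integrable lborel g"
  shows "integrable (lborel \<Otimes>\<^sub>M lborel) (\<lambda>(x, y). f x * g y)"
proof (rule integrableI_bounded)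
  have [measurable]: "f \<in> borel_measurable borel" "g \<in> borel_measurable borel"
    using f g by (auto dest: borel_measurable_integrable)
  show "(\<lambda>(x, y). f x * g y) \<in> borel_measurable (lborel \<Otimes>\<^sub>M lborel)" by measurable
  have "(\<integral>\<^sup>+z. ennreal (norm (case z of (x, y) \<Rightarrow> f x * g y)) \<partial>(lborel \<Otimes>\<^sub>M lborel)) =
      (\<integral>\<^sup>+x. \<integral>\<^sup>+y. ennreal \<bar>f x\<bar> * ennreal \<bar>g y\<bar> \<partial>lborel \<partial>lborel)"
    by (subst lborel.nn_integral_fst[symmetric]) (auto simp: abs_mult ennreal_mult)
  also have "\<dots> = (\<integral>\<^sup>+x. ennreal \<bar>f x\<bar> \<partial>lborel) * (\<integral>\<^sup>+y. ennreal \<bar>g y\<bar> \<partial>lborel)"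
    by (simp add: nn_integral_cmult nn_integral_multc)
  also have "\<dots> < \<infinity>"
    using f g by (simp add: integrable_iff_bounded ennreal_mult_less_top)
  finally show "(\<integral>\<^sup>+z. ennreal (norm (case z of (x, y) \<Rightarrow> f x * g y)) \<partial>(lborel \<Otimes>\<^sub>M lborel)) < \<infinity>" .
qed

text \<open>
  A Gaussian is itself the Fourier transform of a Gaussian.  Inserting this into the convolution and exchanging
  the integrals makes the Fourier transform of \<open>h\<close> appear as a factor.
\<close>

lemma fourier_zero_imp_heat_convolution_zero:
  fixes h :: "'a::euclidean_space \<Rightarrow> real"
  assumes h: "integrable lborel h"
    and zero: "\<And>\<xi>. (\<integral>x. exp (- (\<i> * complex_of_real (x \<bullet> \<xi>))) * complex_of_real (h x) \<partial>lborel) = 0"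
    and r: "0 < r"
  shows "(\<integral>y. h y * heat_kernel r (x - y) \<partial>lborel) = 0"
proof -
  \<comment> \<open>The Gaussian of parameter \<open>s\<close> has a Fourier transform proportional to the one of parameter \<open>r\<close>.\<close>
  define s where "s = 1 / (4 * r)"
  have s: "0 < s" using r by (simp add: s_def)
  define c where "c = (4 * pi * r) powr (real DIM('a) / 2)"
  have c: "c > 0" using r by (simp add: c_def)
  define g :: "'a \<Rightarrow> 'a \<Rightarrow> complex" where
    "g \<xi> y = complex_of_real (h y) * (exp (- (\<i> * complex_of_real (\<xi> \<bullet> (x - y)))) * complex_of_real (heat_kernel s \<xi>))" for \<xi> y
  have [measurable]: "h \<in> borel_measurable borel" using h by (auto dest: borel_measurable_integrable)
  have intg: "integrable (lborel \<Otimes>\<^sub>M lborel) (case_prod g)"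
  proof (rule integrableI_bounded)
    show "case_prod g \<in> borel_measurable (lborel \<Otimes>\<^sub>M lborel)" unfolding g_def by measurable
    have "(\<integral>\<^sup>+z. ennreal (norm (case_prod g z)) \<partial>(lborel \<Otimes>\<^sub>M lborel)) =
        (\<integral>\<^sup>+\<xi>. \<integral>\<^sup>+y. ennreal (norm (g \<xi> y)) \<partial>lborel \<partial>lborel)"
      unfolding g_def by (subst lborel.nn_integral_fst[symmetric]) auto
    also have "\<dots> = (\<integral>\<^sup>+\<xi>. \<integral>\<^sup>+y. ennreal (heat_kernel s \<xi>) * ennreal \<bar>h y\<bar> \<partial>lborel \<partial>(lborel :: 'a measure))"
      by (simp add: g_def norm_mult heat_kernel_nonneg ennreal_mult mult.commute)
    also have "\<dots> = (\<integral>\<^sup>+\<xi>. ennreal (heat_kernel s (\<xi> :: 'a)) \<partial>lborel) * (\<integral>\<^sup>+y. ennreal \<bar>h y\<bar> \<partial>lborel)"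
      by (simp add: nn_integral_cmult nn_integral_multc)
    also have "\<dots> < \<infinity>"
      using h nn_integral_heat_kernel[OF s, where 'a='a] by (simp add: integrable_iff_bounded)
    finally show "(\<integral>\<^sup>+z. ennreal (norm (case_prod g z)) \<partial>(lborel \<Otimes>\<^sub>M lborel)) < \<infinity>" .
  qed
  have "complex_of_real (c * (\<integral>y. h y * heat_kernel r (x - y) \<partial>lborel)) =
      (\<integral>y. complex_of_real (c * (h y * heat_kernel r (x - y))) \<partial>lborel)"
    by (subst integral_complex_of_real) simp
  also have "\<dots> = (\<integral>y. (\<integral>\<xi>. g \<xi> y \<partial>lborel) \<partial>lborel)"
  proof (rule Bochner_Integration.integral_cong[OF refl])
    fix y :: 'a
    have "(\<integral>\<xi>. g \<xi> y \<partial>lborel) = complex_of_real (h y) * complex_of_real (exp (- (s * (norm (x - y))\<^sup>2)))"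
      unfolding g_def by (simp only: integral_mult_right_zero heat_kernel_fourier[OF s])
    also have "exp (- (s * (norm (x - y))\<^sup>2)) = c * heat_kernel r (x - y)"
      using r c by (simp add: s_def heat_kernel_def c_def)
    finally show "complex_of_real (c * (h y * heat_kernel r (x - y))) = (\<integral>\<xi>. g \<xi> y \<partial>lborel)" by simp
  qed
  also have "\<dots> = (\<integral>\<xi>. (\<integral>y. g \<xi> y \<partial>lborel) \<partial>lborel)"
    by (rule lborel_pair.Fubini_integral[OF intg])
  also have "\<dots> = 0"
  proof (rule integral_eq_zero_AE, rule AE_I2)
    fix \<xi> :: 'a
    have "g \<xi> y = (exp (- (\<i> * complex_of_real (\<xi> \<bullet> x))) * complex_of_real (heat_kernel s \<xi>)) *
        (exp (- (\<i> * complex_of_real (y \<bullet> (- \<xi>)))) * complex_of_real (h y))" for y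
      by (simp add: g_def inner_diff_right algebra_simps exp_add exp_diff inner_commute[of y])
        (simp add: divide_inverse exp_minus)
    then show "(\<integral>y. g \<xi> y \<partial>lborel) = 0"
      using zero[of "- \<xi>"] by (simp only: integral_mult_right_zero mult_zero_right)
  qed
  finally show ?thesis using c by simp
qed

text \<open>
  Integrate the convolution against a bounded continuous function \<open>\<psi>\<close> and let \<open>r\<close> tend to \<open>0\<close>: the Gaussian
  averages of \<open>\<psi>\<close> converge to \<open>\<psi>\<close>, so the integral of \<open>h \<psi>\<close> vanishes.  Indicators of closed sets are limits of
  such \<open>\<psi>\<close>, and closed sets are stable under intersection and generate the Borel sets.  Hence the positive and the
  negative part of \<open>h\<close> are densities of the same finite measure.
\<close>

lemma heat_convolution_zero_imp_AE_zero:
  fixes h :: "'a::euclidean_space \<Rightarrow> real"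
  assumes h: "integrable lborel h"
    and zero: "\<And>r x. 0 < r \<Longrightarrow> (\<integral>y. h y * heat_kernel r (x - y) \<partial>lborel) = 0"
  shows "AE x in lborel. h x = 0"
proof -
  have hm [measurable]: "h \<in> borel_measurable borel" using h by (auto dest: borel_measurable_integrable)
  have test: "(\<integral>y. h y * \<psi> y \<partial>lborel) = 0"
    if \<psi>: "continuous_on UNIV \<psi>" "\<And>x. \<bar>\<psi> x\<bar> \<le> 1" for \<psi> :: "'a \<Rightarrow> real"
  proof -
    have \<psi>m [measurable]: "\<psi> \<in> borel_measurable borel" by (rule borel_measurable_continuous_onI[OF \<psi>(1)])
    have \<psi>le: "\<bar>\<psi> x * c\<bar> \<le> \<bar>c\<bar>" for x c
      using \<psi>(2)[of x] by (simp add: abs_mult mult_left_le_one_le)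
    have \<psi>le': "\<bar>a * b * \<psi> x\<bar> \<le> \<bar>b * a\<bar>" "\<bar>a * b * \<psi> x\<bar> \<le> \<bar>a\<bar> * \<bar>b\<bar>"
        "\<bar>a * b * \<psi> x\<bar> \<le> \<bar>b\<bar> * \<bar>a\<bar>" for x a b
      using \<psi>le[of x "a * b"] by (simp_all add: abs_mult mult_ac)
    have zero': "(\<integral>z. (\<integral>y. h y * heat_kernel 1 z * \<psi> (y + sqrt r *\<^sub>R z) \<partial>lborel) \<partial>lborel) = 0" if r: "0 < r" for r
    proof -
      have i1: "integrable (lborel \<Otimes>\<^sub>M lborel) (\<lambda>(x, y). \<psi> x * (h y * heat_kernel r (x - y)))"
        by (rule Bochner_Integration.integrable_bound[OF integrable_lborel_translate_heat[OF h r]])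
          (auto intro!: AE_I2 \<psi>le)
      have i2: "integrable (lborel \<Otimes>\<^sub>M lborel) (\<lambda>(z, y). h y * heat_kernel 1 z * \<psi> (y + sqrt r *\<^sub>R z))"
      proof (rule Bochner_Integration.integrable_bound)
        show "integrable (lborel \<Otimes>\<^sub>M lborel) (\<lambda>(z :: 'a, y). heat_kernel 1 z * h y)"
          using integrable_heat_kernel[of 1, where 'a='a] h by (intro integrable_lborel_product) auto
      qed (auto intro!: AE_I2 \<psi>le'(1))
      have "0 = (\<integral>x. (\<integral>y. \<psi> x * (h y * heat_kernel r (x - y)) \<partial>lborel) \<partial>lborel)"
        by (simp add: zero[OF r])
      also have "\<dots> = (\<integral>y. (\<integral>x. \<psi> x * (h y * heat_kernel r (x - y)) \<partial>lborel) \<partial>lborel)"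
        by (rule lborel_pair.Fubini_integral[symmetric]) (use i1 in \<open>simp add: case_prod_unfold\<close>)
      also have "\<dots> = (\<integral>y. (\<integral>z. h y * heat_kernel 1 z * \<psi> (y + sqrt r *\<^sub>R z) \<partial>lborel) \<partial>lborel)"
      proof (rule Bochner_Integration.integral_cong[OF refl])
        fix y
        have "(\<integral>x. \<psi> x * (h y * heat_kernel r (x - y)) \<partial>lborel) =
            \<bar>sqrt r\<bar> ^ DIM('a) * (\<integral>z. \<psi> (y + sqrt r *\<^sub>R z) * (h y * heat_kernel r (y + sqrt r *\<^sub>R z - y)) \<partial>lborel)"
          using r by (intro lborel_integral_affine) auto
        also have "\<dots> = (\<integral>z. h y * (sqrt r ^ DIM('a) * heat_kernel r (sqrt r *\<^sub>R z)) * \<psi> (y + sqrt r *\<^sub>R z) \<partial>lborel)"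
          using r by (simp add: mult_ac flip: integral_mult_right_zero)
        finally show "(\<integral>x. \<psi> x * (h y * heat_kernel r (x - y)) \<partial>lborel) =
            (\<integral>z. h y * heat_kernel 1 z * \<psi> (y + sqrt r *\<^sub>R z) \<partial>lborel)"
          by (simp only: heat_kernel_scale[OF r])
      qed
      also have "\<dots> = (\<integral>z. (\<integral>y. h y * heat_kernel 1 z * \<psi> (y + sqrt r *\<^sub>R z) \<partial>lborel) \<partial>lborel)"
        by (rule lborel_pair.Fubini_integral) (use i2 in \<open>simp add: case_prod_unfold\<close>)
      finally show ?thesis by simp
    qed
    \<comment> \<open>After the substitution \<open>x = y + sqrt r z\<close> the Gaussian weight does not depend on \<open>r = 1 / (n + 1)\<close>.\<close>
    define F where "F n z = (\<integral>y. h y * heat_kernel 1 z * \<psi> (y + sqrt (1 / real (Suc n)) *\<^sub>R z) \<partial>lborel)" for n and z :: 'a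
    define H where "H = (\<integral>y. \<bar>h y\<bar> \<partial>lborel)"
    have Fm [measurable]: "F n \<in> borel_measurable borel" for n unfolding F_def by measurable
    have lim0: "(\<lambda>n. sqrt (1 / real (Suc n))) \<longlonglongrightarrow> 0"
      using tendsto_real_sqrt[OF LIMSEQ_Suc[OF lim_1_over_n]] by simp
    have Flim: "(\<lambda>n. F n z) \<longlonglongrightarrow> heat_kernel 1 z * (\<integral>y. h y * \<psi> y \<partial>lborel)" for z
    proof -
      have "(\<lambda>n. F n z) \<longlonglongrightarrow> (\<integral>y. h y * heat_kernel 1 z * \<psi> y \<partial>lborel)"
        unfolding F_def
      proof (rule integral_dominated_convergence[where w="\<lambda>y. \<bar>h y\<bar> * heat_kernel 1 z"])
        show "AE y in lborel. (\<lambda>n. h y * heat_kernel 1 z * \<psi> (y + sqrt (1 / real (Suc n)) *\<^sub>R z)) \<longlonglongrightarrow> h y * heat_kernel 1 z * \<psi> y"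
        proof (rule AE_I2)
          fix y
          have "(\<lambda>n. y + sqrt (1 / real (Suc n)) *\<^sub>R z) \<longlonglongrightarrow> y + 0 *\<^sub>R z"
            by (intro tendsto_intros lim0)
          then have "(\<lambda>n. \<psi> (y + sqrt (1 / real (Suc n)) *\<^sub>R z)) \<longlonglongrightarrow> \<psi> y"
            using \<psi>(1) by (intro continuous_on_tendsto_compose[OF \<psi>(1)]) auto
          then show "(\<lambda>n. h y * heat_kernel 1 z * \<psi> (y + sqrt (1 / real (Suc n)) *\<^sub>R z)) \<longlonglongrightarrow> h y * heat_kernel 1 z * \<psi> y"
            by (intro tendsto_intros)
        qed
        show "integrable lborel (\<lambda>y. \<bar>h y\<bar> * heat_kernel 1 z)" using h by auto
      qed (use \<psi>le'(2)[of "h _" "heat_kernel 1 z"] in \<open>auto intro!: AE_I2 simp: abs_of_nonneg[OF heat_kernel_nonneg]\<close>)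
      moreover have "(\<integral>y. h y * heat_kernel 1 z * \<psi> y \<partial>lborel) = heat_kernel 1 z * (\<integral>y. h y * \<psi> y \<partial>lborel)"
        by (simp add: mult_ac flip: integral_mult_right_zero)
      ultimately show ?thesis by simp
    qed
    have "(\<lambda>n. \<integral>z. F n z \<partial>lborel) \<longlonglongrightarrow> (\<integral>z. heat_kernel 1 (z::'a) * (\<integral>y. h y * \<psi> y \<partial>lborel) \<partial>lborel)"
    proof (rule integral_dominated_convergence[where w="\<lambda>z::'a. heat_kernel 1 z * H"])
      show "integrable lborel (\<lambda>z::'a. heat_kernel 1 z * H)"
        using integrable_heat_kernel[of 1, where 'a='a] by auto
      show "AE z in lborel. norm (F n z) \<le> heat_kernel 1 z * H" for n
      proof (rule AE_I2)
        fix z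
        have "norm (F n z) \<le> (\<integral>y. norm (h y * heat_kernel 1 z * \<psi> (y + sqrt (1 / real (Suc n)) *\<^sub>R z)) \<partial>lborel)"
          unfolding F_def by (rule integral_norm_bound)
        also have "\<dots> \<le> (\<integral>y. heat_kernel 1 z * \<bar>h y\<bar> \<partial>lborel)"
        proof (rule integral_mono')
          show "integrable lborel (\<lambda>y. heat_kernel 1 z * \<bar>h y\<bar>)" using h by auto
        qed (use \<psi>le'(3)[of "h _" "heat_kernel 1 z"] in \<open>auto simp: abs_of_nonneg[OF heat_kernel_nonneg] intro!: mult_nonneg_nonneg heat_kernel_nonneg\<close>)
        finally show "norm (F n z) \<le> heat_kernel 1 z * H" by (simp add: H_def)
      qed
    qed (use Flim in auto)
    moreover have "(\<integral>z. F n z \<partial>lborel) = 0" for n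
      unfolding F_def by (rule zero') simp
    ultimately have "(\<integral>z. heat_kernel 1 (z::'a) * (\<integral>y. h y * \<psi> y \<partial>lborel) \<partial>lborel) = 0"
      by (simp add: LIMSEQ_const_iff)
    moreover have "(\<integral>z. heat_kernel 1 (z::'a) \<partial>lborel) = 1"
      using nn_integral_heat_kernel[of 1, where 'a='a] by (subst integral_eq_nn_integral) (auto simp: heat_kernel_nonneg)
    ultimately show ?thesis by simp
  qed
  have closed: "(\<integral>y. h y * indicator A y \<partial>lborel) = 0" if A: "closed A" for A :: "'a set"
  proof (cases "A = {}")
    case False
    define \<psi> where "\<psi> n x = max 0 (1 - real n * infdist x A)" for n :: nat and x :: 'a
    have c\<psi>: "continuous_on UNIV (\<psi> n)" for n unfolding \<psi>_def by (intro continuous_intros)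
    have [measurable]: "\<psi> n \<in> borel_measurable borel" for n
      by (rule borel_measurable_continuous_onI[OF c\<psi>])
    have b\<psi>: "0 \<le> \<psi> n x" "\<psi> n x \<le> 1" for n x by (auto simp: \<psi>_def infdist_nonneg)
    have [measurable]: "A \<in> sets borel" using A by auto
    have "(\<lambda>n. \<integral>y. h y * \<psi> n y \<partial>lborel) \<longlonglongrightarrow> (\<integral>y. h y * indicator A y \<partial>lborel)"
    proof (rule integral_dominated_convergence[where w="\<lambda>y. \<bar>h y\<bar>"])
      show "AE y in lborel. (\<lambda>n. h y * \<psi> n y) \<longlonglongrightarrow> h y * indicator A y"
      proof (rule AE_I2, intro tendsto_mult tendsto_const)
        fix y
        show "(\<lambda>n. \<psi> n y) \<longlonglongrightarrow> indicator A y"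
        proof (cases "y \<in> A")
          case True
          then show ?thesis by (simp add: \<psi>_def)
        next
          case False
          then have d: "0 < infdist y A"
            using in_closed_iff_infdist_zero[OF A \<open>A \<noteq> {}\<close>] infdist_nonneg[of y A] by (auto simp: less_le)
          obtain n0 where n0: "1 / infdist y A \<le> real n0" using real_arch_simple by blast
          have "\<psi> n y = 0" if "n0 \<le> n" for n
          proof -
            have "1 / infdist y A \<le> real n" using n0 that by linarith
            then show ?thesis using d by (simp add: \<psi>_def field_simps)
          qed
          then have "eventually (\<lambda>n. \<psi> n y = 0) sequentially" by (auto simp: eventually_sequentially)
          then show ?thesis using False by (simp add: tendsto_eventually)
        qed
      qed
    qed (use h b\<psi> in \<open>auto simp: abs_mult intro!: mult_right_le_one_le\<close>)
    moreover have "(\<integral>y. h y * \<psi> n y \<partial>lborel) = 0" for n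
      by (rule test[OF c\<psi>]) (use b\<psi>[of n] in auto)
    ultimately show ?thesis by (simp add: LIMSEQ_const_iff)
  qed simp
  define P where "P = density lborel (\<lambda>x. ennreal (h x))"
  define Q where "Q = density lborel (\<lambda>x. ennreal (- h x))"
  have fin: "(\<integral>\<^sup>+x. ennreal (h x) \<partial>lborel) < \<infinity>" "(\<integral>\<^sup>+x. ennreal (- h x) \<partial>lborel) < \<infinity>"
    using h by (auto simp: real_integrable_def less_top)
  have "P = Q"
  proof (rule measure_eqI_generator_eq[where E="Collect closed" and \<Omega>=UNIV and A="\<lambda>_. UNIV"])
    show "Int_stable (Collect closed :: 'a set set)" by (auto simp: Int_stable_def)
    show "emeasure P X = emeasure Q X" if "X \<in> Collect closed" for X
    proof -
      have cl: "closed X" using that by simp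
      have [measurable]: "X \<in> sets borel" using cl by auto
      have i: "integrable lborel (\<lambda>y. h y * indicator X y)" using integrable_mult_indicator[OF _ h, of X] by (simp add: mult.commute)
      have e: "emeasure P X = (\<integral>\<^sup>+x. ennreal (h x * indicator X x) \<partial>lborel)"
        "emeasure Q X = (\<integral>\<^sup>+x. ennreal (- (h x * indicator X x)) \<partial>lborel)"
        unfolding P_def Q_def by (auto simp: emeasure_density intro!: nn_integral_cong split: split_indicator)
      have "enn2real (emeasure P X) - enn2real (emeasure Q X) = 0"
        unfolding e using closed[OF cl] real_lebesgue_integral_def[OF i] by simp
      moreover have "emeasure P X < \<infinity>" "emeasure Q X < \<infinity>"
        unfolding e using i by (auto simp: real_integrable_def less_top)
      ultimately show ?thesis
        by (metis diff_eq_diff_eq diff_self ennreal_enn2real eq_iff_diff_eq_0 infinity_ennreal_def)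
    qed
    show "sets P = sigma_sets UNIV (Collect closed)" "sets Q = sigma_sets UNIV (Collect closed)"
      by (simp_all add: P_def Q_def borel_eq_closed)
    show "emeasure P UNIV \<noteq> \<infinity>" using fin by (simp add: P_def emeasure_density less_top)
  qed auto
  then have "AE x in lborel. ennreal (h x) = ennreal (- h x)"
    unfolding P_def Q_def by (intro sigma_finite_measure.density_unique[OF sigma_finite_lborel]) auto
  then show ?thesis
  proof eventually_elim
    case (elim x)
    then show ?case by (cases "0 \<le> h x") (auto simp: ennreal_neg)
  qed
qed

lemma fourier_unique_AE:
  fixes g h :: "'a::euclidean_space \<Rightarrow> real"
  assumes g: "integrable lborel g" and h: "integrable lborel h"
    and eq: "\<And>\<xi>. (\<integral>x. exp (- (\<i> * complex_of_real (x \<bullet> \<xi>))) * complex_of_real (g x) \<partial>lborel) =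
      (\<integral>x. exp (- (\<i> * complex_of_real (x \<bullet> \<xi>))) * complex_of_real (h x) \<partial>lborel)"
  shows "AE x in lborel. g x = h x"
proof -
  have int: "integrable lborel (\<lambda>x. exp (- (\<i> * complex_of_real (x \<bullet> \<xi>))) * complex_of_real (f x))"
    if f: "integrable lborel f" for f :: "'a \<Rightarrow> real" and \<xi>
  proof (rule Bochner_Integration.integrable_bound[OF f])
    have [measurable]: "f \<in> borel_measurable borel" using f by (auto dest: borel_measurable_integrable)
    show "(\<lambda>x. exp (- (\<i> * complex_of_real (x \<bullet> \<xi>))) * complex_of_real (f x)) \<in> borel_measurable lborel"
      by measurable
  qed (auto simp: norm_mult)
  have "AE x in lborel. g x - h x = 0"
  proof (rule heat_convolution_zero_imp_AE_zero)
    show gh: "integrable lborel (\<lambda>x. g x - h x)" using g h by auto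
    show "(\<integral>y. (g y - h y) * heat_kernel r (x - y) \<partial>lborel) = 0" if "0 < r" for r x
    proof (rule fourier_zero_imp_heat_convolution_zero[OF gh _ that])
      fix \<xi> :: 'a
      show "(\<integral>x. exp (- (\<i> * complex_of_real (x \<bullet> \<xi>))) * complex_of_real (g x - h x) \<partial>lborel) = 0"
        using eq[of \<xi>] int[OF g] int[OF h] by (simp add: right_diff_distrib)
    qed
  qed
  then show ?thesis by eventually_elim simp
qed

section \<open>The kernel as a mixture of Gaussians\<close>

text \<open>
  The convex function \<open>y\<^bsup>p\<^esup>\<close> lies above its tangent at \<open>c\<close>.
\<close>

lemma powr_tangent_le:
  fixes c y p :: real
  assumes p: "1 \<le> p" and c: "0 < c" and y: "0 \<le> y"
  shows "p * c powr (p - 1) * y \<le> y powr p + (p - 1) * c powr p"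
proof (cases "p = 1")
  case True
  then show ?thesis using y c by simp
next
  case False
  then have p: "1 < p" using p by simp
  define q where "q = p / (p - 1)"
  have q: "1 < q" "1 / p + 1 / q = 1" using p by (simp_all add: q_def field_simps)
  have "y * c powr (p - 1) \<le> y powr p / p + (c powr (p - 1)) powr q / q"
    using p q y by (intro Youngs_inequality) auto
  also have "(c powr (p - 1)) powr q = c powr p"
    using p by (simp add: powr_powr q_def)
  finally have "p * (y * c powr (p - 1)) \<le> p * (y powr p / p + c powr p / q)"
    using p by (intro mult_left_mono) auto
  also have "\<dots> = y powr p + (p - 1) * c powr p"
    using p by (simp add: q_def field_simps)
  finally show ?thesis by (simp add: mult_ac)
qed

text \<open>
  Minkowski's inequality for \<open>u(x) = \<integral> g(w) K(x,w) dN(w)\<close>, in the form: if \<open>\<parallel>K(\<cdot>,w)\<parallel>\<^sub>p \<le> k(w)\<close> then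
  \<open>\<parallel>u\<parallel>\<^sub>p \<le> \<integral> g k dN\<close>.  It is Jensen's inequality for the measure \<open>g k dN\<close> applied to \<open>K / k\<close>, which yields
  \<open>u\<^bsup>p\<^esup> \<le> A\<^bsup>p-1\<^esup> \<integral> g k\<^bsup>1-p\<^esup> K\<^bsup>p\<^esup> dN\<close> pointwise, followed by integration over \<open>x\<close>.  The weight \<open>g\<close> is kept apart
  from \<open>K\<close> because \<open>k\<close> has to be positive, and it can only be so where \<open>g\<close> is nonzero.
\<close>

lemma minkowski_integral_le:
  fixes K :: "'a \<Rightarrow> 'b \<Rightarrow> real" and g k :: "'b \<Rightarrow> real" and u :: "'a \<Rightarrow> real"
  assumes M: "sigma_finite_measure M" and N: "sigma_finite_measure N"
    and p: "1 \<le> p"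
    and Km: "(\<lambda>(x, w). K x w) \<in> borel_measurable (M \<Otimes>\<^sub>M N)"
    and [measurable]: "g \<in> borel_measurable N" "k \<in> borel_measurable N"
    and K0: "\<And>x w. 0 \<le> K x w" and g0: "\<And>w. 0 \<le> g w" and u0: "\<And>x. 0 \<le> u x"
    and kpos: "AE w in N. g w \<noteq> 0 \<longrightarrow> 0 < k w \<and> (\<integral>\<^sup>+x. ennreal (K x w powr p) \<partial>M) \<le> ennreal (k w powr p)"
    and A: "0 < A" "(\<integral>\<^sup>+w. ennreal (g w * k w) \<partial>N) \<le> ennreal A"
    and u: "AE x in M. ennreal (u x) \<le> (\<integral>\<^sup>+w. ennreal (g w * K x w) \<partial>N)"
  shows "(\<integral>\<^sup>+x. ennreal (u x powr p) \<partial>M) \<le> ennreal (A powr p)"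
proof -
  interpret M: sigma_finite_measure M by fact
  interpret N: sigma_finite_measure N by fact
  interpret P: pair_sigma_finite M N ..
  have [measurable]: "(\<lambda>z. K (fst z) (snd z)) \<in> borel_measurable (M \<Otimes>\<^sub>M N)"
    using Km by (simp add: case_prod_unfold)
  let ?I = "\<lambda>x. \<integral>\<^sup>+w. ennreal (g w * (k w powr (1 - p) * K x w powr p)) \<partial>N"
  have [measurable]: "?I \<in> borel_measurable M" by measurable
  have ptw: "ennreal (u x powr p) \<le> ennreal (A powr (p - 1)) * ?I x"
    if xM: "x \<in> space M" and ux: "ennreal (u x) \<le> (\<integral>\<^sup>+w. ennreal (g w * K x w) \<partial>N)" for x
  proof (cases "u x = 0")
    case True
    then show ?thesis by simp
  next
    case False
    then have up: "0 < u x" using u0[of x] by simp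
    \<comment> \<open>The tangent is taken at the mean of \<open>K / k\<close> for the measure \<open>g k dN\<close>.\<close>
    define c where "c = u x / A"
    have c: "0 < c" using up A by (simp add: c_def)
    have [measurable]: "K x \<in> borel_measurable N" using measurable_Pair2[OF Km xM] by simp
    have "ennreal (p * c powr (p - 1) * u x) = ennreal (p * c powr (p - 1)) * ennreal (u x)"
      using p by (intro ennreal_mult) (auto simp: u0)
    also have "\<dots> \<le> ennreal (p * c powr (p - 1)) * (\<integral>\<^sup>+w. ennreal (g w * K x w) \<partial>N)"
      by (rule mult_left_mono[OF ux]) simp
    also have "\<dots> = (\<integral>\<^sup>+w. ennreal (g w * (p * c powr (p - 1) * K x w)) \<partial>N)"
      using p by (subst nn_integral_cmult[symmetric])
        (auto simp: ennreal_mult[symmetric] K0 g0 mult_ac intro!: nn_integral_cong)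
    also have "\<dots> \<le> (\<integral>\<^sup>+w. ennreal (g w * (k w powr (1 - p) * K x w powr p)) +
        ennreal ((p - 1) * c powr p) * ennreal (g w * k w) \<partial>N)"
    proof (rule nn_integral_mono_AE, use kpos in eventually_elim)
      fix w assume *: "g w \<noteq> 0 \<longrightarrow> 0 < k w \<and> (\<integral>\<^sup>+x. ennreal (K x w powr p) \<partial>M) \<le> ennreal (k w powr p)"
      show "ennreal (g w * (p * c powr (p - 1) * K x w)) \<le>
          ennreal (g w * (k w powr (1 - p) * K x w powr p)) + ennreal ((p - 1) * c powr p) * ennreal (g w * k w)"
      proof (cases "g w = 0")
        case False
        then have k: "0 < k w" using * by simp
        have "p * c powr (p - 1) * (K x w / k w) \<le> (K x w / k w) powr p + (p - 1) * c powr p"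
          using k K0 by (intro powr_tangent_le p c) auto
        then have "k w * (p * c powr (p - 1) * (K x w / k w)) \<le> k w * ((K x w / k w) powr p + (p - 1) * c powr p)"
          using k by (intro mult_left_mono) auto
        also have "\<dots> = k w powr (1 - p) * K x w powr p + (p - 1) * c powr p * k w"
          using k K0[of x w] by (simp add: powr_divide powr_diff field_simps)
        finally have "p * c powr (p - 1) * K x w \<le> k w powr (1 - p) * K x w powr p + (p - 1) * c powr p * k w"
          using k by simp
        then have "g w * (p * c powr (p - 1) * K x w) \<le> g w * (k w powr (1 - p) * K x w powr p + (p - 1) * c powr p * k w)"
          by (intro mult_left_mono g0)
        then have "ennreal (g w * (p * c powr (p - 1) * K x w)) \<le>
            ennreal (g w * (k w powr (1 - p) * K x w powr p) + (p - 1) * c powr p * (g w * k w))"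
          by (intro ennreal_leI) (simp add: algebra_simps)
        also have "\<dots> = ennreal (g w * (k w powr (1 - p) * K x w powr p)) + ennreal ((p - 1) * c powr p) * ennreal (g w * k w)"
          using p g0[of w] k by (subst ennreal_plus) (auto simp: ennreal_mult)
        finally show ?thesis .
      qed simp
    qed
    also have "\<dots> = ?I x + ennreal ((p - 1) * c powr p) * (\<integral>\<^sup>+w. ennreal (g w * k w) \<partial>N)"
      by (subst nn_integral_add) (auto simp: nn_integral_cmult)
    also have "\<dots> \<le> ?I x + ennreal ((p - 1) * c powr p) * ennreal A"
      by (intro add_left_mono mult_left_mono A) simp
    also have "\<dots> = ?I x + ennreal ((p - 1) * c powr p * A)"
      using p A by (simp add: ennreal_mult)
    finally have main: "ennreal (p * c powr (p - 1) * u x) \<le> ?I x + ennreal ((p - 1) * c powr p * A)" .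
    show ?thesis
    proof (cases "?I x = \<top>")
      case True
      then show ?thesis using A by (simp add: ennreal_mult_top)
    next
      case False
      then obtain i where i: "?I x = ennreal i" "0 \<le> i" by (cases "?I x") auto
      have "ennreal (p * c powr (p - 1) * u x) \<le> ennreal (i + (p - 1) * c powr p * A)"
        using main i p A by simp
      then have "p * c powr (p - 1) * u x \<le> i + (p - 1) * c powr p * A"
        using i p A by (subst (asm) ennreal_le_iff) auto
      moreover have "c powr (p - 1) * u x = u x powr p / A powr (p - 1)"
        using up A by (simp add: c_def powr_divide powr_diff)
      moreover have "c powr p * A = u x powr p / A powr (p - 1)"
        using up A by (simp add: c_def powr_divide powr_diff)
      ultimately have "u x powr p / A powr (p - 1) \<le> i" by (simp add: mult.assoc left_diff_distrib)
      then have "u x powr p \<le> A powr (p - 1) * i" using A by (simp add: field_simps)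
      then show ?thesis unfolding i using i by (simp add: ennreal_mult[symmetric] ennreal_leI)
    qed
  qed
  have "(\<integral>\<^sup>+x. ennreal (u x powr p) \<partial>M) \<le> (\<integral>\<^sup>+x. ennreal (A powr (p - 1)) * ?I x \<partial>M)"
    by (rule nn_integral_mono_AE) (use u AE_space in eventually_elim, rule ptw)
  also have "\<dots> = ennreal (A powr (p - 1)) * (\<integral>\<^sup>+x. ?I x \<partial>M)"
    by (rule nn_integral_cmult) measurable
  also have "(\<integral>\<^sup>+x. ?I x \<partial>M) = (\<integral>\<^sup>+w. (\<integral>\<^sup>+x. ennreal (g w * (k w powr (1 - p) * K x w powr p)) \<partial>M) \<partial>N)"
    by (rule P.Fubini'[symmetric]) measurable
  also have "\<dots> \<le> (\<integral>\<^sup>+w. ennreal (g w * k w) \<partial>N)"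
  proof (rule nn_integral_mono_AE, use kpos AE_space in eventually_elim)
    fix w assume *: "g w \<noteq> 0 \<longrightarrow> 0 < k w \<and> (\<integral>\<^sup>+x. ennreal (K x w powr p) \<partial>M) \<le> ennreal (k w powr p)"
      and wN: "w \<in> space N"
    have [measurable]: "(\<lambda>x. K x w) \<in> borel_measurable M"
      using measurable_Pair1[OF Km wN] by simp
    have "(\<integral>\<^sup>+x. ennreal (g w * (k w powr (1 - p) * K x w powr p)) \<partial>M) =
        ennreal (g w * k w powr (1 - p)) * (\<integral>\<^sup>+x. ennreal (K x w powr p) \<partial>M)"
      by (subst nn_integral_cmult[symmetric]) (auto simp: ennreal_mult[symmetric] g0 mult_ac)
    also have "\<dots> \<le> ennreal (g w * k w)"
    proof (cases "g w = 0")
      case False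
      then have "ennreal (g w * k w powr (1 - p)) * (\<integral>\<^sup>+x. ennreal (K x w powr p) \<partial>M) \<le>
          ennreal (g w * k w powr (1 - p)) * ennreal (k w powr p)"
        using * by (intro mult_left_mono) auto
      also have "\<dots> = ennreal (g w * k w)"
        using False * g0[of w] by (simp add: ennreal_mult[symmetric] powr_diff)
      finally show ?thesis .
    qed simp
    finally show "(\<integral>\<^sup>+x. ennreal (g w * (k w powr (1 - p) * K x w powr p)) \<partial>M) \<le> ennreal (g w * k w)" .
  qed
  also have "\<dots> \<le> ennreal A" by (rule A)
  also have "ennreal (A powr (p - 1)) * ennreal A = ennreal (A powr p)"
    using A by (simp add: ennreal_mult[symmetric] powr_diff)
  finally show ?thesis by (simp add: mult_left_mono)
qed

text \<open>
  The kernel is constructed from a fixed mixing measure, so that all of its properties can be stated without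
  repeating how that measure arises.
\<close>

locale subordinated =
  fixes a b :: real and \<mu> :: "real measure"
  assumes a: "0 < a" "a < 1" and b: "0 < b" and mixing: "mixing_measure a b \<mu>"
begin

sublocale finite_measure \<mu> using mixing by (simp add: mixing_measure_def)

lemma sets_mu [measurable_cong]: "sets \<mu> = sets borel"
  using mixing by (simp add: mixing_measure_def)

lemma space_mu: "space \<mu> = UNIV"
  using sets_eq_imp_space_eq[OF sets_mu] by simp

lemma AE_mu_pos: "AE r in \<mu>. 0 < r"
  using mixing by (simp add: mixing_measure_def)

definition mass :: real where "mass = measure \<mu> UNIV"

lemma emeasure_mu: "emeasure \<mu> UNIV = ennreal mass"
  by (simp add: mass_def emeasure_eq_measure)

lemma mass_pos: "0 < mass"
proof -
  have "emeasure \<mu> UNIV \<noteq> 0" using mixing by (simp add: mixing_measure_def)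
  then show ?thesis by (simp add: emeasure_mu ennreal_eq_0_iff)
qed

definition Y :: "'a::euclidean_space \<Rightarrow> real \<Rightarrow> real" where
  "Y x t = t powr (a - 1) * (\<integral>r. heat_kernel (r * t powr (a / b)) x \<partial>\<mu>)"

lemma Y_nonneg: "0 \<le> Y x t"
  unfolding Y_def by (intro mult_nonneg_nonneg integral_nonneg_AE) (auto simp: heat_kernel_nonneg)

lemma Y_zero: "Y x 0 = 0"
  by (simp add: Y_def)

lemma Y_measurable [measurable]:
  assumes [measurable]: "f \<in> borel_measurable M" "g \<in> borel_measurable M"
  shows "(\<lambda>z. Y (f z :: 'a::euclidean_space) (g z)) \<in> borel_measurable M"
  unfolding Y_def by measurable

lemma nn_integral_mu_le:
  assumes "\<And>r. 0 < r \<Longrightarrow> f r \<le> c" "0 \<le> c"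
  shows "(\<integral>\<^sup>+r. ennreal (f r) \<partial>\<mu>) \<le> ennreal (c * mass)"
proof -
  have "(\<integral>\<^sup>+r. ennreal (f r) \<partial>\<mu>) \<le> (\<integral>\<^sup>+r. ennreal c \<partial>\<mu>)"
    by (rule nn_integral_mono_AE) (use AE_mu_pos in eventually_elim, intro ennreal_leI assms)
  also have "\<dots> = ennreal (c * mass)"
    using assms mass_pos by (simp add: space_mu emeasure_mu ennreal_mult)
  finally show ?thesis .
qed

lemma mixture_le:
  assumes f: "\<And>r. 0 < r \<Longrightarrow> f r \<le> c" "0 \<le> c" "\<And>r. 0 \<le> f r" and [measurable]: "f \<in> borel_measurable borel"
  shows "integrable \<mu> f" "(\<integral>r. f r \<partial>\<mu>) \<le> c * mass"
proof -
  have le: "(\<integral>\<^sup>+r. ennreal (f r) \<partial>\<mu>) \<le> ennreal (c * mass)" by (rule nn_integral_mu_le[OF f(1,2)])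
  then show i: "integrable \<mu> f"
    using f(3) by (intro integrableI_bounded) (auto simp: less_top[symmetric] top_unique)
  have "ennreal (\<integral>r. f r \<partial>\<mu>) \<le> ennreal (c * mass)"
    using le f(3) by (subst nn_integral_eq_integral[OF i, symmetric]) auto
  then show "(\<integral>r. f r \<partial>\<mu>) \<le> c * mass"
    using f(2) mass_pos by (subst (asm) ennreal_le_iff) auto
qed

text \<open>
  The Gaussian bound \<open>C |x|\<^bsup>-N\<^esup>\<close> does not depend on \<open>r\<close>, so integrating over the mixing measure only multiplies it
  with the total mass.
\<close>

lemma Y_le:
  "\<exists>C>0. \<forall>t>0. \<forall>x::'a::euclidean_space. x \<noteq> 0 \<longrightarrow> Y x t \<le> C * t powr (a - 1) * norm x powr (- real DIM('a))"
proof -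
  obtain C where C: "C > 0" "\<And>r (x::'a). 0 < r \<Longrightarrow> x \<noteq> 0 \<Longrightarrow> heat_kernel r x \<le> C * norm x powr (- real DIM('a))"
    using heat_kernel_le_norm by blast
  have "Y x t \<le> (C * mass) * t powr (a - 1) * norm x powr (- real DIM('a))" if t: "0 < t" and x: "x \<noteq> 0" for t and x :: 'a
  proof -
    have "(\<integral>r. heat_kernel (r * t powr (a / b)) x \<partial>\<mu>) \<le> (C * norm x powr (- real DIM('a))) * mass"
      using C x t by (intro mixture_le) (auto simp: heat_kernel_nonneg)
    then have "Y x t \<le> t powr (a - 1) * ((C * norm x powr (- real DIM('a))) * mass)"
      unfolding Y_def by (intro mult_left_mono) auto
    then show ?thesis by (simp add: mult_ac)
  qed
  moreover have "0 < C * mass" using C mass_pos by simp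
  ultimately show ?thesis by blast
qed

lemma ennreal_Y:
  fixes x :: "'a::euclidean_space"
  assumes t: "0 < t" and x: "x \<noteq> 0"
  shows "ennreal (Y x t) = ennreal (t powr (a - 1)) * (\<integral>\<^sup>+r. ennreal (heat_kernel (r * t powr (a / b)) x) \<partial>\<mu>)"
proof -
  obtain C where C: "C > 0" "\<And>r (x::'a). 0 < r \<Longrightarrow> x \<noteq> 0 \<Longrightarrow> heat_kernel r x \<le> C * norm x powr (- real DIM('a))"
    using heat_kernel_le_norm by blast
  have "integrable \<mu> (\<lambda>r. heat_kernel (r * t powr (a / b)) x)"
    using C x t by (intro mixture_le(1)[where c="C * norm x powr (- real DIM('a))"]) (auto simp: heat_kernel_nonneg)
  then show ?thesis
    unfolding Y_def by (subst nn_integral_eq_integral) (auto simp: heat_kernel_nonneg ennreal_mult')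
qed

lemma nn_integral_mixture:
  assumes t: "0 < t"
  shows "(\<integral>\<^sup>+r. (\<integral>\<^sup>+x. ennreal (heat_kernel (r * t powr (a / b)) (x::'a::euclidean_space)) \<partial>lborel) \<partial>\<mu>) = ennreal mass"
proof -
  have "(\<integral>\<^sup>+r. (\<integral>\<^sup>+x. ennreal (heat_kernel (r * t powr (a / b)) (x::'a)) \<partial>lborel) \<partial>\<mu>) = (\<integral>\<^sup>+r. 1 \<partial>\<mu>)"
    by (rule nn_integral_cong_AE) (use AE_mu_pos in eventually_elim, use t in \<open>simp add: nn_integral_heat_kernel\<close>)
  then show ?thesis by (simp add: space_mu emeasure_mu)
qed

lemma nn_integral_Y:
  assumes t: "0 < t"
  shows "(\<integral>\<^sup>+x. ennreal (Y (x::'a::euclidean_space) t) \<partial>lborel) = ennreal (t powr (a - 1) * mass)"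
proof -
  interpret P: pair_sigma_finite \<mu> "lborel :: 'a measure" ..
  have "(\<integral>\<^sup>+x. ennreal (Y (x::'a) t) \<partial>lborel) =
      (\<integral>\<^sup>+x. ennreal (t powr (a - 1)) * (\<integral>\<^sup>+r. ennreal (heat_kernel (r * t powr (a / b)) (x::'a)) \<partial>\<mu>) \<partial>lborel)"
    by (rule nn_integral_cong_AE) (use AE_lborel_singleton[of 0] in eventually_elim, rule ennreal_Y[OF t])
  also have "\<dots> = ennreal (t powr (a - 1)) * (\<integral>\<^sup>+x. (\<integral>\<^sup>+r. ennreal (heat_kernel (r * t powr (a / b)) (x::'a)) \<partial>\<mu>) \<partial>lborel)"
    by (rule nn_integral_cmult) measurable
  also have "(\<integral>\<^sup>+x. (\<integral>\<^sup>+r. ennreal (heat_kernel (r * t powr (a / b)) (x::'a)) \<partial>\<mu>) \<partial>lborel) = ennreal mass"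
    unfolding nn_integral_mixture[OF t, where 'a='a, symmetric] by (rule P.Fubini') measurable
  finally show ?thesis using mass_pos by (simp add: ennreal_mult)
qed

lemma integrable_Y:
  assumes t: "0 \<le> t"
  shows "integrable lborel (\<lambda>x::'a::euclidean_space. Y x t)"
proof (cases "t = 0")
  case True
  then show ?thesis by (simp add: Y_zero)
next
  case False
  then show ?thesis
    using t nn_integral_Y[of t, where 'a='a] by (intro integrableI_bounded) (auto simp: Y_nonneg)
qed

text \<open>
  After exchanging the integrals, the Fourier transform is the Laplace transform of the mixing measure at
  \<open>t\<^bsup>a/b\<^esup> |\<xi>|\<^sup>2\<close>, and its \<open>b\<close>-th power is \<open>|\<xi>|\<^bsup>2b\<^esup> t\<^bsup>a\<^esup>\<close>.
\<close>

lemma Y_fourier: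
  fixes \<xi> :: "'a::euclidean_space"
  assumes t: "0 < t"
  shows "(\<integral>x. exp (- (\<i> * complex_of_real (x \<bullet> \<xi>))) * complex_of_real (Y x t) \<partial>lborel) =
    complex_of_real (t powr (a - 1) * mittag_leffler a a (- (norm \<xi> powr (2 * b) * t powr a)))"
proof -
  interpret P: pair_sigma_finite \<mu> "lborel :: 'a measure" ..
  define c where "c = t powr (a / b)"
  have c: "0 < c" using t by (simp add: c_def)
  define G where "G r x = exp (- (\<i> * complex_of_real (x \<bullet> \<xi>))) * complex_of_real (heat_kernel (r * c) x)" for r and x :: 'a
  have int: "integrable (\<mu> \<Otimes>\<^sub>M lborel) (case_prod G)"
  proof (rule integrableI_bounded)
    show "case_prod G \<in> borel_measurable (\<mu> \<Otimes>\<^sub>M lborel)" unfolding G_def by measurable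
    have "(\<integral>\<^sup>+z. ennreal (norm (case_prod G z)) \<partial>(\<mu> \<Otimes>\<^sub>M lborel)) = (\<integral>\<^sup>+r. \<integral>\<^sup>+x. ennreal (norm (G r x)) \<partial>lborel \<partial>\<mu>)"
      unfolding G_def by (subst lborel.nn_integral_fst[symmetric]) auto
    also have "\<dots> = ennreal mass"
      unfolding G_def using nn_integral_mixture[OF t, where 'a='a] by (simp add: norm_mult heat_kernel_nonneg c_def)
    finally show "(\<integral>\<^sup>+z. ennreal (norm (case_prod G z)) \<partial>(\<mu> \<Otimes>\<^sub>M lborel)) < \<infinity>" by simp
  qed
  have "(\<integral>x. exp (- (\<i> * complex_of_real (x \<bullet> \<xi>))) * complex_of_real (Y x t) \<partial>lborel) =
      (\<integral>x. complex_of_real (t powr (a - 1)) * (\<integral>r. G r x \<partial>\<mu>) \<partial>lborel)"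
  proof (rule Bochner_Integration.integral_cong[OF refl])
    fix x :: 'a
    have "(\<integral>r. G r x \<partial>\<mu>) = exp (- (\<i> * complex_of_real (x \<bullet> \<xi>))) * complex_of_real (\<integral>r. heat_kernel (r * c) x \<partial>\<mu>)"
      unfolding G_def by simp
    then show "exp (- (\<i> * complex_of_real (x \<bullet> \<xi>))) * complex_of_real (Y x t) =
        complex_of_real (t powr (a - 1)) * (\<integral>r. G r x \<partial>\<mu>)"
      by (simp add: Y_def c_def)
  qed
  also have "\<dots> = complex_of_real (t powr (a - 1)) * (\<integral>x. (\<integral>r. G r x \<partial>\<mu>) \<partial>lborel)"
    by simp
  also have "(\<integral>x. (\<integral>r. G r x \<partial>\<mu>) \<partial>lborel) = (\<integral>r. (\<integral>x. G r x \<partial>lborel) \<partial>\<mu>)"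
    by (rule P.Fubini_integral[OF int])
  also have "\<dots> = (\<integral>r. complex_of_real (exp (- (c * (norm \<xi>)\<^sup>2 * r))) \<partial>\<mu>)"
  proof (rule integral_cong_AE)
    show "AE r in \<mu>. (\<integral>x. G r x \<partial>lborel) = complex_of_real (exp (- (c * (norm \<xi>)\<^sup>2 * r)))"
    proof (use AE_mu_pos in eventually_elim)
      fix r :: real assume "0 < r"
      then have "0 < r * c" using c by simp
      from heat_kernel_fourier[OF this, of \<xi>]
      have "(\<integral>x. G r x \<partial>lborel) = complex_of_real (exp (- (r * c * (norm \<xi>)\<^sup>2)))" by (simp only: G_def)
      also have "r * c * (norm \<xi>)\<^sup>2 = c * (norm \<xi>)\<^sup>2 * r" by (simp add: mult_ac)
      finally show "(\<integral>x. G r x \<partial>lborel) = complex_of_real (exp (- (c * (norm \<xi>)\<^sup>2 * r)))" .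
    qed
    show "(\<lambda>r. \<integral>x. G r x \<partial>lborel) \<in> borel_measurable \<mu>" unfolding G_def by measurable
  qed measurable
  also have "\<dots> = complex_of_real (\<integral>r. exp (- (c * (norm \<xi>)\<^sup>2 * r)) \<partial>\<mu>)"
    by (rule integral_complex_of_real)
  also have "(\<integral>r. exp (- (c * (norm \<xi>)\<^sup>2 * r)) \<partial>\<mu>) = mittag_leffler a a (- ((c * (norm \<xi>)\<^sup>2) powr b))"
  proof -
    have "(\<integral>r. exp (- (c * (norm \<xi>)\<^sup>2 * r)) \<partial>\<mu>) = enn2real (\<integral>\<^sup>+r. ennreal (exp (- (c * (norm \<xi>)\<^sup>2 * r))) \<partial>\<mu>)"
      by (intro integral_eq_nn_integral) auto
    also have "\<dots> = mittag_leffler a a (- ((c * (norm \<xi>)\<^sup>2) powr b))"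
      using mixing c unfolding mixing_measure_def by simp
    finally show ?thesis .
  qed
  also have "(c * (norm \<xi>)\<^sup>2) powr b = norm \<xi> powr (2 * b) * t powr a"
  proof (cases "\<xi> = 0")
    case True
    then show ?thesis using b by simp
  next
    case False
    have "(norm \<xi>)\<^sup>2 powr b = norm \<xi> powr (2 * b)"
      using False by (simp add: powr_powr flip: powr_numeral)
    then show ?thesis using b c by (simp add: powr_mult c_def powr_powr)
  qed
  finally show ?thesis by simp
qed

lemma Y_slice:
  assumes t: "0 \<le> t"
  shows "is_kernel_slice a b t (\<lambda>x::real^'n::finite. Y x t)"
proof (cases "t = 0")
  case True
  then show ?thesis by (simp add: is_kernel_slice_def Y_zero)
next
  case False
  then show ?thesis
    using t by (simp add: is_kernel_slice_def integrable_Y Y_fourier del: of_real_mult)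
qed

text \<open>
  A slice exists, so the one selected by the choice operator has the prescribed Fourier transform, and Fourier
  transforms determine integrable functions almost everywhere.
\<close>

lemma kernel_Y_AE:
  assumes t: "0 \<le> t"
  shows "AE x in lborel. kernel_Y a b (x::real^'n::finite) t = Y x t"
    and "(\<lambda>x::real^'n::finite. kernel_Y a b x t) \<in> borel_measurable borel"
proof -
  have s: "is_kernel_slice a b t (\<lambda>x::real^'n. kernel_Y a b x t)"
    unfolding kernel_Y_def by (rule someI[of "is_kernel_slice a b t", OF Y_slice[OF t]])
  show "AE x in lborel. kernel_Y a b (x::real^'n) t = Y x t"
    by (rule fourier_unique_AE) (use s Y_slice[OF t, where 'n='n] in \<open>auto simp: is_kernel_slice_def\<close>)
  show "(\<lambda>x::real^'n. kernel_Y a b x t) \<in> borel_measurable borel"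
    using s by (auto simp: is_kernel_slice_def dest: borel_measurable_integrable)
qed

text \<open>
  The \<open>L\<^sup>p\<close> norm of a Gaussian with parameter \<open>s\<close> is a multiple of \<open>s\<^bsup>-e\<^esup>\<close> with \<open>e = (N/2)(1 - 1/p)\<close>.  By Minkowski's
  inequality, the norm of the mixture is finite if \<open>r\<^bsup>-e\<^esup>\<close> is integrable for the mixing measure, which holds for
  \<open>e < b\<close>; this is the condition that \<open>p\<close> is subcritical.
\<close>

lemma Y_Lp:
  fixes p :: real
  assumes p: "1 \<le> p" and crit: "real DIM('a::euclidean_space) * (1 - 1 / p) < 2 * b"
  shows "\<exists>K>0. \<forall>t>0. (\<integral>\<^sup>+x. ennreal (Y (x::'a) t powr p) \<partial>lborel) \<le>
    ennreal ((K * t powr (a - 1 - a * real DIM('a) / (2 * b) * (1 - 1 / p))) powr p)"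
proof -
  define N where "N = real DIM('a)"
  define e where "e = N / 2 * (1 - 1 / p)"
  define \<kappa> where "\<kappa> = (4 * pi / p) powr (N / (2 * p)) / (4 * pi) powr (N / 2)"
  have \<kappa>: "0 < \<kappa>" using p by (simp add: \<kappa>_def)
  have e0: "0 \<le> e" using p by (simp add: e_def N_def)
  have "0 \<le> e / b" "e / b < 1" using e0 crit b by (auto simp: e_def N_def field_simps)
  then have "(\<integral>\<^sup>+r. ennreal (r powr (- (e / b * b))) \<partial>\<mu>) < \<infinity>"
    using mixing unfolding mixing_measure_def by blast
  then have "(\<integral>\<^sup>+r. ennreal (r powr (- e)) \<partial>\<mu>) < \<infinity>" using b by simp
  then obtain J0 where J0: "(\<integral>\<^sup>+r. ennreal (r powr (- e)) \<partial>\<mu>) = ennreal J0" "0 \<le> J0"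
    by (cases "\<integral>\<^sup>+r. ennreal (r powr (- e)) \<partial>\<mu>") auto
  \<comment> \<open>Adding \<open>1\<close> makes the constant positive.\<close>
  define J where "J = J0 + 1"
  have J: "0 < J" "(\<integral>\<^sup>+r. ennreal (r powr (- e)) \<partial>\<mu>) \<le> ennreal J" using J0 by (auto simp: J_def intro!: ennreal_leI)
  have norm: "(\<integral>\<^sup>+x. ennreal (heat_kernel s (x::'a) powr p) \<partial>lborel) = ennreal ((\<kappa> * s powr (- e)) powr p)" if s: "0 < s" for s
  proof -
    have "(\<integral>\<^sup>+x. ennreal (heat_kernel s (x::'a) powr p) \<partial>lborel) =
      ennreal ((4 * pi * (s / p)) powr (N / 2) / (4 * pi * s) powr (N / 2 * p))"
    proof -
      define k where "k = (4 * pi * (s / p)) powr (N / 2) / (4 * pi * s) powr (N / 2 * p)"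
      have "0 \<le> k" by (simp add: k_def)
      moreover have "heat_kernel s (x::'a) powr p = k * heat_kernel (s / p) x" for x
        using s p by (simp add: heat_kernel_powr N_def[symmetric] k_def)
      ultimately have "(\<integral>\<^sup>+x. ennreal (heat_kernel s (x::'a) powr p) \<partial>lborel) = ennreal k"
        using s p nn_integral_heat_kernel[of "s / p", where 'a='a]
        by (simp add: ennreal_mult nn_integral_cmult heat_kernel_nonneg)
      then show ?thesis by (simp only: k_def)
    qed
    also have "(4 * pi * (s / p)) powr (N / 2) / (4 * pi * s) powr (N / 2 * p) = (\<kappa> * s powr (- e)) powr p"
    proof -
      have "- e * p = N / 2 - N / 2 * p" using p by (simp add: e_def field_simps)
      then have "(\<kappa> * s powr (- e)) powr p = (4 * pi / p) powr (N / 2) / (4 * pi) powr (N / 2 * p) * (s powr (N / 2) / s powr (N / 2 * p))"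
        using p s unfolding \<kappa>_def by (simp add: powr_mult powr_divide powr_powr powr_diff)
      moreover have "(4 * pi * (s / p)) powr (N / 2) = (4 * pi / p) powr (N / 2) * s powr (N / 2)"
        using p s by (simp add: powr_mult[symmetric])
      moreover have "(4 * pi * s) powr (N / 2 * p) = (4 * pi) powr (N / 2 * p) * s powr (N / 2 * p)"
        using s by (simp add: powr_mult)
      ultimately show ?thesis by simp
    qed
    finally show ?thesis .
  qed
  have main: "(\<integral>\<^sup>+x. ennreal (Y (x::'a) t powr p) \<partial>lborel) \<le>
      ennreal ((\<kappa> * J * t powr (a - 1 - a * N / (2 * b) * (1 - 1 / p))) powr p)" if t: "0 < t" for t
  proof -
    define c where "c = t powr (a / b)"
    have c: "0 < c" using t by (simp add: c_def)
    define u where "u x = (\<integral>r. heat_kernel (r * c) x \<partial>\<mu>)" for x :: 'a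
    have u0: "0 \<le> u x" for x unfolding u_def by (intro integral_nonneg_AE) (auto simp: heat_kernel_nonneg)
    have "(\<integral>\<^sup>+x. ennreal (u x powr p) \<partial>lborel) \<le> ennreal ((\<kappa> * c powr (- e) * J) powr p)"
    proof (rule minkowski_integral_le[where M=lborel and N=\<mu> and g="\<lambda>_. 1" and k="\<lambda>r. \<kappa> * (r * c) powr (- e)" and K="\<lambda>x r. heat_kernel (r * c) x"])
      show "AE w in \<mu>. (1::real) \<noteq> 0 \<longrightarrow> 0 < \<kappa> * (w * c) powr (- e) \<and>
          (\<integral>\<^sup>+x. ennreal (heat_kernel (w * c) (x::'a) powr p) \<partial>lborel) \<le> ennreal ((\<kappa> * (w * c) powr (- e)) powr p)"
        using AE_mu_pos by eventually_elim (use c \<kappa> in \<open>simp add: norm\<close>)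
      have "(\<integral>\<^sup>+w. ennreal (1 * (\<kappa> * (w * c) powr (- e))) \<partial>\<mu>) = (\<integral>\<^sup>+w. ennreal (\<kappa> * c powr (- e)) * ennreal (w powr (- e)) \<partial>\<mu>)"
        by (rule nn_integral_cong_AE) (use AE_mu_pos in eventually_elim, use c \<kappa> in \<open>simp add: powr_mult ennreal_mult[symmetric] mult_ac\<close>)
      also have "\<dots> = ennreal (\<kappa> * c powr (- e)) * (\<integral>\<^sup>+w. ennreal (w powr (- e)) \<partial>\<mu>)"
        by (rule nn_integral_cmult) measurable
      also have "\<dots> \<le> ennreal (\<kappa> * c powr (- e)) * ennreal J" by (intro mult_left_mono J) simp
      also have "\<dots> = ennreal (\<kappa> * c powr (- e) * J)" using \<kappa> J by (simp add: ennreal_mult)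
      finally show "(\<integral>\<^sup>+w. ennreal (1 * (\<kappa> * (w * c) powr (- e))) \<partial>\<mu>) \<le> ennreal (\<kappa> * c powr (- e) * J)" .
      show "AE x in lborel. ennreal (u x) \<le> (\<integral>\<^sup>+w. ennreal (1 * heat_kernel (w * c) x) \<partial>\<mu>)"
      proof (rule AE_I2)
        fix x
        have "ennreal (u x) = ennreal (enn2real (\<integral>\<^sup>+w. ennreal (heat_kernel (w * c) x) \<partial>\<mu>))"
          unfolding u_def by (subst integral_eq_nn_integral) (auto simp: heat_kernel_nonneg)
        also have "\<dots> \<le> (\<integral>\<^sup>+w. ennreal (heat_kernel (w * c) x) \<partial>\<mu>)"
          by (cases "\<integral>\<^sup>+w. ennreal (heat_kernel (w * c) x) \<partial>\<mu>") auto
        finally show "ennreal (u x) \<le> (\<integral>\<^sup>+w. ennreal (1 * heat_kernel (w * c) x) \<partial>\<mu>)" by simp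
      qed
    qed (use p \<kappa> J c u0 in \<open>auto simp: heat_kernel_nonneg sigma_finite_lborel intro: sigma_finite_measure_axioms\<close>)
    then have "ennreal ((t powr (a - 1)) powr p) * (\<integral>\<^sup>+x. ennreal (u x powr p) \<partial>lborel) \<le>
        ennreal ((t powr (a - 1)) powr p) * ennreal ((\<kappa> * c powr (- e) * J) powr p)"
      by (intro mult_left_mono) auto
    also have "\<dots> = ennreal ((\<kappa> * J * (t powr (a - 1) * c powr (- e))) powr p)"
      using \<kappa> J c t by (simp add: ennreal_mult[symmetric] powr_mult mult_ac)
    also have "t powr (a - 1) * c powr (- e) = t powr (a - 1 - a * N / (2 * b) * (1 - 1 / p))"
      using b by (simp add: c_def e_def powr_powr powr_add[symmetric] mult.commute[of 2 b] mult.assoc)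
    also have "ennreal ((t powr (a - 1)) powr p) * (\<integral>\<^sup>+x. ennreal (u x powr p) \<partial>lborel) = (\<integral>\<^sup>+x. ennreal (Y (x::'a) t powr p) \<partial>lborel)"
      unfolding Y_def u_def c_def
      by (subst nn_integral_cmult[symmetric]) (auto simp: powr_mult ennreal_mult)
    finally show ?thesis .
  qed
  show ?thesis
    by (rule exI[of _ "\<kappa> * J"]) (use main \<kappa> J in \<open>auto simp: N_def\<close>)
qed

text \<open>
  Gaussians decrease with \<open>|x|\<close>, so the minimum over the ball is attained on its boundary.  There, scaling
  reduces the mixture to a single constant, which is positive as the integral of a positive function.
\<close>

lemma Y_lower:
  assumes M: "0 < M"
  shows "\<exists>c>0. \<forall>t>0. \<forall>x::'a::euclidean_space. x \<noteq> 0 \<longrightarrow> norm x \<le> M * t powr (a / (2 * b)) \<longrightarrow>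
    c * t powr (a - 1 - a * real DIM('a) / (2 * b)) \<le> Y x t"
proof -
  obtain B :: 'a where B: "B \<in> Basis" using nonempty_Basis by blast
  define y where "y = M *\<^sub>R B"
  have y: "y \<noteq> 0" "norm y = M" using M B by (auto simp: y_def)
  obtain C where C: "C > 0" "\<And>r (x::'a). 0 < r \<Longrightarrow> x \<noteq> 0 \<Longrightarrow> heat_kernel r x \<le> C * norm x powr (- real DIM('a))"
    using heat_kernel_le_norm by blast
  have int: "integrable \<mu> (\<lambda>r. heat_kernel (r * c) x)" if "0 < c" "x \<noteq> 0" for c and x :: 'a
    using C that by (intro mixture_le(1)[where c="C * norm x powr (- real DIM('a))"]) (auto simp: heat_kernel_nonneg)
  define c0 where "c0 = (\<integral>r. heat_kernel (r * 1) y \<partial>\<mu>)"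
  have c0: "0 < c0"
  proof -
    have "0 \<le> c0" unfolding c0_def by (intro integral_nonneg_AE) (auto simp: heat_kernel_nonneg)
    moreover have "c0 \<noteq> 0"
    proof
      assume "c0 = 0"
      then have "AE r in \<mu>. heat_kernel (r * 1) y = 0"
        unfolding c0_def using int[of 1 y] y
        by (subst (asm) integral_nonneg_eq_0_iff_AE) (auto simp: heat_kernel_nonneg)
      then have "AE r in \<mu>. False"
        using AE_mu_pos
      proof eventually_elim
        case (elim r)
        then show ?case using heat_kernel_pos[of r y] by simp
      qed
      then have "emeasure \<mu> UNIV = 0"
        by (simp add: trivial_limit_def[symmetric] ae_filter_eq_bot_iff space_mu)
      then show False using mixing by (simp add: mixing_measure_def)
    qed
    ultimately show ?thesis by simp
  qed
  have "c0 * t powr (a - 1 - a * real DIM('a) / (2 * b)) \<le> Y x t"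
    if t: "0 < t" and x: "x \<noteq> 0" "norm x \<le> M * t powr (a / (2 * b))" for t and x :: 'a
  proof -
    define c where "c = t powr (a / b)"
    have c: "0 < c" using t by (simp add: c_def)
    have sc: "sqrt c = t powr (a / (2 * b))"
      using t by (simp add: c_def powr_half_sqrt[symmetric] powr_powr mult.commute)
    define \<theta> where "\<theta> = c powr (- (real DIM('a) / 2))"
    have "\<theta> * c0 = (\<integral>r. \<theta> * heat_kernel (r * 1) y \<partial>\<mu>)"
      unfolding c0_def by simp
    also have "\<dots> \<le> (\<integral>r. heat_kernel (r * c) x \<partial>\<mu>)"
    proof (rule integral_mono_AE)
      show "integrable \<mu> (\<lambda>r. \<theta> * heat_kernel (r * 1) y)" using int[of 1 y] y by simp
      show "integrable \<mu> (\<lambda>r. heat_kernel (r * c) x)" using int c x by simp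
      show "AE r in \<mu>. \<theta> * heat_kernel (r * 1) y \<le> heat_kernel (r * c) x"
      proof (use AE_mu_pos in eventually_elim)
        fix r :: real assume r: "0 < r"
        have "\<theta> * heat_kernel (r * 1) y = heat_kernel (r * c) (sqrt c *\<^sub>R y)"
          using r c by (simp add: heat_kernel_def \<theta>_def power_mult_distrib powr_mult powr_minus field_simps)
        also have "\<dots> \<le> heat_kernel (r * c) x"
          using r c x y sc M by (intro heat_kernel_mono) (auto simp: mult.commute)
        finally show "\<theta> * heat_kernel (r * 1) y \<le> heat_kernel (r * c) x" .
      qed
    qed
    finally have "t powr (a - 1) * (\<theta> * c0) \<le> Y x t"
      unfolding Y_def c_def by (intro mult_left_mono) auto
    moreover have "t powr (a - 1) * \<theta> = t powr (a - 1 - a * real DIM('a) / (2 * b))"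
      using b by (simp add: \<theta>_def c_def powr_powr powr_add[symmetric] mult.commute[of 2 b])
    ultimately show ?thesis by (simp add: mult.assoc[symmetric] mult.commute[of c0])
  qed
  then show ?thesis using c0 by blast
qed

end

section \<open>Integrals in time\<close>

text \<open>
  The growth of \<open>\<integral>\<^sub>0\<^sup>t (1+s)\<^bsup>-\<gamma>\<^esup> ds\<close>, up to constants.
\<close>

definition time_growth :: "real \<Rightarrow> real \<Rightarrow> real" where
  "time_growth \<gamma> t = (if \<gamma> < 1 then t powr (1 - \<gamma>) else if \<gamma> = 1 then ln t else 1)"

abbreviation weight_integral :: "real \<Rightarrow> real \<Rightarrow> ennreal" where
  "weight_integral \<gamma> T \<equiv> (\<integral>\<^sup>+s. ennreal ((1 + s) powr (- \<gamma>)) * indicator {0..T} s \<partial>lborel)"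

abbreviation singular_integral :: "real \<Rightarrow> real \<Rightarrow> real \<Rightarrow> ennreal" where
  "singular_integral e \<gamma> t \<equiv> (\<integral>\<^sup>+s. ennreal ((t - s) powr (e - 1) * (1 + s) powr (- \<gamma>)) * indicator {0..t} s \<partial>lborel)"

lemma time_growth_nonneg: "1 \<le> t \<Longrightarrow> 0 \<le> time_growth \<gamma> t"
  by (simp add: time_growth_def)

lemma powr_le_time_growth:
  assumes t: "2 \<le> t"
  shows "t powr (1 - \<gamma>) \<le> 2 * time_growth \<gamma> t"
proof -
  consider "\<gamma> < 1" | "\<gamma> = 1" | "1 < \<gamma>" by linarith
  then show ?thesis
  proof cases
    case 2
    have "exp 1 \<le> (t\<^sup>2 :: real)"
      using power_mono[OF t, of 2] exp_le by simp
    then have "1 \<le> ln (t\<^sup>2)" using t by (subst ln_ge_iff) auto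
    then show ?thesis using 2 t by (simp add: time_growth_def ln_realpow)
  next
    case 3
    then have "t powr (1 - \<gamma>) \<le> t powr 0" using t by (intro powr_mono) auto
    then show ?thesis using 3 t by (simp add: time_growth_def)
  qed (simp add: time_growth_def)
qed

lemma powr_bounds_near_one:
  fixes x \<gamma> :: real
  assumes "1 / 4 \<le> x" "x \<le> 4"
  shows "4 powr (- \<bar>\<gamma>\<bar>) \<le> x powr (- \<gamma>)" "x powr (- \<gamma>) \<le> 4 powr \<bar>\<gamma>\<bar>"
proof -
  have q: "(1 / 4 :: real) powr z = 4 powr (- z)" for z by (simp add: powr_divide powr_minus_divide)
  show "4 powr (- \<bar>\<gamma>\<bar>) \<le> x powr (- \<gamma>)" "x powr (- \<gamma>) \<le> 4 powr \<bar>\<gamma>\<bar>"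
    using powr_mono2[of "- \<gamma>" "1/4" x] powr_mono2[of "- \<gamma>" x 4]
      powr_mono2'[of "- \<gamma>" "1/4" x] powr_mono2'[of "- \<gamma>" x 4] assms q[of "- \<gamma>"]
    by (cases "0 \<le> \<gamma>"; simp)+
qed

lemma nn_integral_weight:
  assumes t: "0 \<le> t"
  shows "weight_integral \<gamma> t =
    ennreal (if \<gamma> = 1 then ln (1 + t) else ((1 + t) powr (1 - \<gamma>) - 1) / (1 - \<gamma>))"
proof -
  define F where "F s = (if \<gamma> = 1 then ln (1 + s) else (1 + s) powr (1 - \<gamma>) / (1 - \<gamma>))" for s :: real
  have "weight_integral \<gamma> t = ennreal (F t - F 0)"
  proof (rule nn_integral_FTC_Icc)
    fix s assume s: "s \<in> {0..t}"
    show "(F has_real_derivative (1 + s) powr (- \<gamma>)) (at s)"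
    proof (cases "\<gamma> = 1")
      case True
      then show ?thesis using s unfolding F_def
        by (auto intro!: derivative_eq_intros simp: powr_minus_divide)
    next
      case False
      have "((\<lambda>s. (1 + s) powr (1 - \<gamma>)) has_real_derivative (1 - \<gamma>) * (1 + s) powr (1 - \<gamma> - 1) * 1) (at s)"
        by (rule DERIV_chain2[where f="\<lambda>x. x powr (1 - \<gamma>)" and g="\<lambda>s. 1 + s", OF has_real_derivative_powr])
          (use s in \<open>auto intro!: derivative_eq_intros\<close>)
      from DERIV_cdivide[OF this, of "1 - \<gamma>"] show ?thesis using False by (simp add: F_def[abs_def])
    qed
  qed (use t in auto)
  then show ?thesis by (simp add: F_def diff_divide_distrib)
qed

lemma weight_integral_le:
  "\<exists>C>0. \<forall>t\<ge>2. weight_integral \<gamma> t \<le> ennreal (C * time_growth \<gamma> t)"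
proof -
  consider "\<gamma> < 1" | "\<gamma> = 1" | "1 < \<gamma>" by linarith
  then show ?thesis
  proof cases
    case 1
    have "((1 + t) powr (1 - \<gamma>) - 1) / (1 - \<gamma>) \<le> 2 powr (1 - \<gamma>) / (1 - \<gamma>) * time_growth \<gamma> t" if "2 \<le> t" for t
    proof -
      have "(1 + t) powr (1 - \<gamma>) \<le> (2 * t) powr (1 - \<gamma>)" using that 1 by (intro powr_mono2) auto
      then have "(1 + t) powr (1 - \<gamma>) - 1 \<le> 2 powr (1 - \<gamma>) * t powr (1 - \<gamma>)" using that by (simp add: powr_mult)
      then show ?thesis using 1 by (simp add: time_growth_def divide_right_mono)
    qed
    then show ?thesis using 1
      by (intro exI[of _ "2 powr (1 - \<gamma>) / (1 - \<gamma>)"]) (auto simp: nn_integral_weight intro!: ennreal_leI)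
  next
    case 2
    have "ln (1 + t) \<le> 2 * time_growth \<gamma> t" if t: "2 \<le> t" for t
    proof -
      have "2 * t \<le> t * t" using t by (intro mult_right_mono) auto
      then have "1 + t \<le> t\<^sup>2" using t unfolding power2_eq_square by linarith
      then have "ln (1 + t) \<le> ln (t\<^sup>2)" using t by (subst ln_le_cancel_iff) auto
      then show ?thesis using t 2 by (simp add: time_growth_def ln_realpow)
    qed
    then have "weight_integral \<gamma> t \<le> ennreal (2 * time_growth \<gamma> t)" if "2 \<le> t" for t
      using that by (subst nn_integral_weight) (simp_all add: 2 ennreal_leI)
    then show ?thesis by (intro exI[of _ 2]) simp
  next
    case 3
    have "((1 + t) powr (1 - \<gamma>) - 1) / (1 - \<gamma>) \<le> 1 / (\<gamma> - 1) * time_growth \<gamma> t" if t: "2 \<le> t" for t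
    proof -
      have "((1 + t) powr (1 - \<gamma>) - 1) / (1 - \<gamma>) = (1 - (1 + t) powr (1 - \<gamma>)) / (\<gamma> - 1)"
        using 3 by (simp add: field_simps)
      also have "\<dots> \<le> 1 / (\<gamma> - 1)" using 3 by (intro divide_right_mono) auto
      finally show ?thesis using 3 by (simp add: time_growth_def)
    qed
    then show ?thesis using 3 by (intro exI[of _ "1 / (\<gamma> - 1)"]) (auto simp: nn_integral_weight intro!: ennreal_leI)
  qed
qed

text \<open>
  For \<open>\<gamma> < 1\<close> the integrand is comparable with \<open>t\<^bsup>-\<gamma>\<^esup>\<close> on \<open>[t/4, t/2]\<close>, which already gives the right order; for
  \<open>\<gamma> > 1\<close> the unit interval suffices.
\<close>

lemma weight_integral_ge:
  "\<exists>c>0. \<forall>t\<ge>2. ennreal (c * time_growth \<gamma> t) \<le> weight_integral \<gamma> (t / 2)"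
proof -
  consider "\<gamma> < 1" | "\<gamma> = 1" | "1 < \<gamma>" by linarith
  then show ?thesis
  proof cases
    case 1
    define c where "c = 4 powr (- \<bar>\<gamma>\<bar>)"
    have "ennreal (c / 4 * time_growth \<gamma> t) \<le> weight_integral \<gamma> (t / 2)" if t: "2 \<le> t" for t
    proof -
      have "c / 4 * time_growth \<gamma> t = c * t powr (- \<gamma>) * (t / 2 - t / 4)"
        using 1 t by (simp add: time_growth_def powr_diff powr_minus_divide)
      then have "ennreal (c / 4 * time_growth \<gamma> t) = (\<integral>\<^sup>+s. ennreal (c * t powr (- \<gamma>)) * indicator {t/4..t/2} s \<partial>lborel)"
        using t by (simp add: nn_integral_cmult ennreal_mult[symmetric] c_def)
      also have "\<dots> \<le> weight_integral \<gamma> (t / 2)"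
      proof (rule nn_integral_mono)
        fix s :: real
        show "ennreal (c * t powr (- \<gamma>)) * indicator {t/4..t/2} s \<le> ennreal ((1 + s) powr (- \<gamma>)) * indicator {0..t/2} s"
        proof (cases "s \<in> {t/4..t/2}")
          case True
          have "c \<le> ((1 + s) / t) powr (- \<gamma>)"
            unfolding c_def using True t by (intro powr_bounds_near_one) (auto simp: field_simps)
          also have "\<dots> = (1 + s) powr (- \<gamma>) / t powr (- \<gamma>)" using True t by (simp add: powr_divide)
          finally have "c * t powr (- \<gamma>) \<le> (1 + s) powr (- \<gamma>)" using t by (simp add: field_simps)
          then show ?thesis using True t by (auto intro: ennreal_leI)
        qed auto
      qed
      finally show ?thesis .
    qed
    then show ?thesis by (intro exI[of _ "c / 4"]) (auto simp: c_def)
  next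
    case 2
    have "1 / 2 * time_growth \<gamma> t \<le> ln (1 + t / 2)" if t: "2 \<le> t" for t
    proof -
      have "t \<le> (1 + t / 2)\<^sup>2" by (simp add: power2_eq_square algebra_simps)
      then have "ln t \<le> ln ((1 + t / 2)\<^sup>2)" using t by (subst ln_le_cancel_iff) simp_all
      then show ?thesis using t 2 by (simp add: time_growth_def ln_realpow)
    qed
    then have "ennreal (1 / 2 * time_growth \<gamma> t) \<le> weight_integral \<gamma> (t / 2)" if "2 \<le> t" for t
      using that by (subst nn_integral_weight) (simp, auto simp only: 2 if_True refl intro!: ennreal_leI)
    then show ?thesis by (intro exI[of _ "1 / 2"]) simp
  next
    case 3
    have "ennreal (2 powr (- \<gamma>) * time_growth \<gamma> t) \<le> weight_integral \<gamma> (t / 2)" if t: "2 \<le> t" for t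
    proof -
      have "ennreal (2 powr (- \<gamma>) * time_growth \<gamma> t) = (\<integral>\<^sup>+s. ennreal (2 powr (- \<gamma>)) * indicator {0..1} (s::real) \<partial>lborel)"
        using 3 by (simp add: time_growth_def nn_integral_cmult)
      also have "\<dots> \<le> weight_integral \<gamma> (t / 2)"
      proof (rule nn_integral_mono)
        fix s :: real
        show "ennreal (2 powr (- \<gamma>)) * indicator {0..1} s \<le> ennreal ((1 + s) powr (- \<gamma>)) * indicator {0..t/2} s"
        proof (cases "s \<in> {0..1}")
          case True
          then have "2 powr (- \<gamma>) \<le> (1 + s) powr (- \<gamma>)" using 3 by (intro powr_mono2') auto
          then show ?thesis using True t by (auto intro: ennreal_leI)
        qed auto
      qed
      finally show ?thesis .
    qed
    then show ?thesis by (intro exI[of _ "2 powr (- \<gamma>)"]) auto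
  qed
qed

text \<open>
  Split at \<open>s = t/2\<close>.  Before, \<open>(t - s)\<^bsup>e-1\<^esup>\<close> is comparable with \<open>t\<^bsup>e-1\<^esup>\<close>; after, \<open>(1 + s)\<^bsup>-\<gamma>\<^esup>\<close> is comparable with
  \<open>t\<^bsup>-\<gamma>\<^esup>\<close> and the remaining singular integral contributes \<open>t\<^bsup>e\<^esup> / e\<close>.
\<close>

lemma singular_weight_integral_le:
  assumes e: "0 < e" "e \<le> 1"
  shows "\<exists>C>0. \<forall>t\<ge>2. singular_integral e \<gamma> t
    \<le> ennreal (C * (t powr (e - 1) * time_growth \<gamma> t))"
proof -
  obtain C where C: "0 < C" "\<And>t. 2 \<le> t \<Longrightarrow>
      weight_integral \<gamma> t \<le> ennreal (C * time_growth \<gamma> t)"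
    using weight_integral_le by blast
  define K where "K = 2 powr (1 - e)"
  define G where "G = 4 powr \<bar>\<gamma>\<bar>"
  have KG: "0 < K" "0 < G" by (simp_all add: K_def G_def)
  have "singular_integral e \<gamma> t
    \<le> ennreal ((K * C + G * 2 / e) * (t powr (e - 1) * time_growth \<gamma> t))" if t: "2 \<le> t" for t
  proof -
    have L0: "0 \<le> time_growth \<gamma> t" using t by (intro time_growth_nonneg) auto
    have "singular_integral e \<gamma> t \<le>
        (\<integral>\<^sup>+s. ennreal (K * t powr (e - 1)) * (ennreal ((1 + s) powr (- \<gamma>)) * indicator {0..t} s) +
          ennreal (G * t powr (- \<gamma>)) * ennreal (indicator {0..t} (t - s) * (t - s) powr (e - 1)) \<partial>lborel)"
    proof (rule nn_integral_mono)
      fix s :: real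
      show "ennreal ((t - s) powr (e - 1) * (1 + s) powr (- \<gamma>)) * indicator {0..t} s \<le>
        ennreal (K * t powr (e - 1)) * (ennreal ((1 + s) powr (- \<gamma>)) * indicator {0..t} s) +
          ennreal (G * t powr (- \<gamma>)) * ennreal (indicator {0..t} (t - s) * (t - s) powr (e - 1))"
      proof (cases "s \<in> {0..t}")
        case True
        have "(t - s) powr (e - 1) * (1 + s) powr (- \<gamma>) \<le>
            K * t powr (e - 1) * (1 + s) powr (- \<gamma>) + G * t powr (- \<gamma>) * (t - s) powr (e - 1)"
        proof (cases "s \<le> t / 2")
          case le: True
          have "(t - s) powr (e - 1) \<le> (t / 2) powr (e - 1)" using le t e by (intro powr_mono2') auto
          also have "\<dots> = K * t powr (e - 1)" using t by (simp add: K_def powr_divide powr_diff)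
          finally have "(t - s) powr (e - 1) * (1 + s) powr (- \<gamma>) \<le> K * t powr (e - 1) * (1 + s) powr (- \<gamma>)"
            by (intro mult_right_mono) auto
          moreover have "0 \<le> G * t powr (- \<gamma>) * (t - s) powr (e - 1)" using KG by simp
          ultimately show ?thesis by linarith
        next
          case gt: False
          have "((1 + s) / t) powr (- \<gamma>) \<le> G"
            unfolding G_def using True gt t by (intro powr_bounds_near_one) (auto simp: field_simps)
          then have "(1 + s) powr (- \<gamma>) \<le> G * t powr (- \<gamma>)" using True t by (simp add: powr_divide field_simps)
          then have "(t - s) powr (e - 1) * (1 + s) powr (- \<gamma>) \<le> (t - s) powr (e - 1) * (G * t powr (- \<gamma>))"
            by (intro mult_left_mono) auto
          moreover have "0 \<le> K * t powr (e - 1) * (1 + s) powr (- \<gamma>)" using KG by simp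
          ultimately show ?thesis by (simp add: mult_ac)
        qed
        then have "ennreal ((t - s) powr (e - 1) * (1 + s) powr (- \<gamma>)) \<le>
            ennreal (K * t powr (e - 1) * (1 + s) powr (- \<gamma>) + G * t powr (- \<gamma>) * (t - s) powr (e - 1))"
          by (rule ennreal_leI)
        also have "\<dots> = ennreal (K * t powr (e - 1)) * ennreal ((1 + s) powr (- \<gamma>)) + ennreal (G * t powr (- \<gamma>)) * ennreal ((t - s) powr (e - 1))"
          using KG by (simp add: ennreal_mult)
        finally show ?thesis using True by simp
      qed auto
    qed
    also have "\<dots> = ennreal (K * t powr (e - 1)) * weight_integral \<gamma> t +
        ennreal (G * t powr (- \<gamma>)) * (\<integral>\<^sup>+s. ennreal (indicator {0..t} (t - s) * (t - s) powr (e - 1)) \<partial>lborel)"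
      by (subst nn_integral_add) (auto simp: nn_integral_cmult)
    also have "(\<integral>\<^sup>+s. ennreal (indicator {0..t} (t - s) * (t - s) powr (e - 1)) \<partial>lborel) = ennreal (t powr e / e)"
      using nn_integral_real_affine[of "\<lambda>s. ennreal (indicator {0..t} s * s powr (e - 1))" "-1" t]
        nn_integral_powr_Icc[of e t] e t by simp
    also have "ennreal (K * t powr (e - 1)) * weight_integral \<gamma> t +
        ennreal (G * t powr (- \<gamma>)) * ennreal (t powr e / e) \<le>
        ennreal (K * t powr (e - 1)) * ennreal (C * time_growth \<gamma> t) + ennreal (G * t powr (- \<gamma>)) * ennreal (t powr e / e)"
      by (intro add_right_mono mult_left_mono C t) simp
    also have "\<dots> = ennreal (K * t powr (e - 1) * (C * time_growth \<gamma> t) + G * t powr (- \<gamma>) * (t powr e / e))"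
      using KG C(1) L0 e by (simp add: ennreal_mult[symmetric] ennreal_plus[symmetric] del: ennreal_plus)
    also have "\<dots> \<le> ennreal ((K * C + G * 2 / e) * (t powr (e - 1) * time_growth \<gamma> t))"
    proof (rule ennreal_leI)
      have "t powr (- \<gamma>) * t powr e = t powr (e - 1) * t powr (1 - \<gamma>)"
        by (simp add: powr_add[symmetric])
      also have "\<dots> \<le> t powr (e - 1) * (2 * time_growth \<gamma> t)"
        using powr_le_time_growth[OF t] by (intro mult_left_mono) auto
      finally have "G / e * (t powr (- \<gamma>) * t powr e) \<le> G / e * (t powr (e - 1) * (2 * time_growth \<gamma> t))"
        using KG e by (intro mult_left_mono) auto
      then show "K * t powr (e - 1) * (C * time_growth \<gamma> t) + G * t powr (- \<gamma>) * (t powr e / e) \<le>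
          (K * C + G * 2 / e) * (t powr (e - 1) * time_growth \<gamma> t)"
        by (simp add: algebra_simps)
    qed
    finally show ?thesis .
  qed
  moreover have "0 < K * C + G * 2 / e" using KG C e by (intro add_pos_pos) auto
  ultimately show ?thesis by blast
qed

section \<open>Mild solutions with Lebesgue measurable sources\<close>

text \<open>
  Lebesgue measure is complete, so a function that agrees almost everywhere with a Borel function is itself
  measurable.  This gives access to the inner integral of a mild solution, whose measurability in \<open>s\<close> is not clear
  from its definition.
\<close>

lemma lebesgue_integral_cong_AE:
  fixes f g :: "'a::euclidean_space \<Rightarrow> real"
  assumes g: "g \<in> borel_measurable borel" and ae: "AE x in lborel. f x = g x"
  shows "(LINT x|lebesgue. f x) = (LINT x|lborel. g x)"
proof -
  have g': "g \<in> borel_measurable lebesgue" using g by (simp add: measurable_completion)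
  have ae': "AE x in lebesgue. f x = g x" using ae by (rule AE_completion)
  have f': "f \<in> borel_measurable lebesgue"
  proof (rule measurableI)
    fix A :: "real set" assume A: "A \<in> sets borel"
    have 1: "g -` A \<inter> space lebesgue \<in> sets lebesgue" using g' A by (rule measurable_sets)
    have 2: "AE x in lebesgue. x \<in> g -` A \<inter> space lebesgue \<longleftrightarrow> x \<in> f -` A \<inter> space lebesgue"
      using ae' by eventually_elim auto
    show "f -` A \<inter> space lebesgue \<in> sets lebesgue"
      by (rule completion.in_sets_AE[OF 2 1]) simp
  qed auto
  have "(LINT x|lebesgue. f x) = (LINT x|lebesgue. g x)"
    by (rule integral_cong_AE[OF f' g' ae'])
  also have "\<dots> = (LINT x|lborel. g x)" using g by (intro integral_completion) simp
  finally show ?thesis .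
qed

lemma AE_lborel_reflect:
  fixes x :: "'a::euclidean_space"
  assumes "AE z in lborel. P z"
  shows "AE y in lborel. P (x - y)"
proof -
  obtain N where N: "{z \<in> space lborel. \<not> P z} \<subseteq> N" "emeasure lborel N = 0" "N \<in> sets lborel"
    using assms by (auto simp: eventually_ae_filter null_sets_def)
  have [measurable]: "N \<in> sets borel" using N by simp
  have "(\<integral>\<^sup>+y. indicator N (x - y) \<partial>lborel) = (\<integral>\<^sup>+z. indicator N z \<partial>lborel)"
    using nn_integral_lborel_affine[of "indicator N" "-1" x] by simp
  also have "\<dots> = 0" using N by simp
  finally have "AE y in lborel. indicator N (x - y) = (0::ennreal)"
    by (subst (asm) nn_integral_0_iff_AE) auto
  then show ?thesis
  proof eventually_elim
    case (elim y)
    then have "x - y \<notin> N" by (simp add: indicator_def split: if_splits)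
    then have "x - y \<notin> {z \<in> space lborel. \<not> P z}" using N(1) by blast
    then show ?case by simp
  qed
qed

lemma nn_integral_lborel_reflect:
  fixes x :: "'a::euclidean_space"
  assumes [measurable]: "f \<in> borel_measurable borel"
  shows "(\<integral>\<^sup>+y. f (x - y) \<partial>lborel) = (\<integral>\<^sup>+z. f z \<partial>(lborel :: 'a measure))"
  using nn_integral_lborel_affine[of f "-1" x] by simp

lemma nn_integral_lborel_translate:
  fixes y :: "'a::euclidean_space"
  assumes [measurable]: "f \<in> borel_measurable borel"
  shows "(\<integral>\<^sup>+x. f (x - y) \<partial>lborel) = (\<integral>\<^sup>+z. f z \<partial>(lborel :: 'a measure))"
  using nn_integral_lborel_affine[of "\<lambda>x. f (x - y)" 1 y] by simp

lemma ennreal_integral_le: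
  fixes f :: "'a \<Rightarrow> real"
  shows "ennreal \<bar>integral\<^sup>L M f\<bar> \<le> (\<integral>\<^sup>+x. ennreal \<bar>f x\<bar> \<partial>M)"
proof (cases "integrable M f")
  case True
  then show ?thesis using integral_norm_bound_ennreal[of M f] by simp
qed (simp add: not_integrable_integral_eq)

lemma Lp_norm_1: "Lp_norm 1 M g = (\<integral>\<^sup>+x. ennreal \<bar>g x\<bar> \<partial>M)"
proof -
  have "Lp_norm 1 M g = (if (\<integral>\<^sup>+x. ennreal \<bar>g x\<bar> \<partial>M) = \<top> then \<top> else ennreal (enn2real (\<integral>\<^sup>+x. ennreal \<bar>g x\<bar> \<partial>M)))"
    by (simp add: Lp_norm_def Let_def)
  then show ?thesis by (simp add: less_top)
qed

text \<open>
  A jointly Lebesgue measurable source agrees with a Borel function outside a null set of space-time.  By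
  Fubini's theorem, almost every time slice of that null set is null, so that the Borel function may replace the
  source in every mild solution.
\<close>

lemma source_representative:
  fixes f :: "real ^ 'n::finite \<Rightarrow> real \<Rightarrow> real"
  assumes f: "source_measurable f"
  obtains f0 :: "(real ^ 'n) \<times> real \<Rightarrow> real" where "f0 \<in> borel_measurable borel"
    and "AE s in lborel. 0 \<le> s \<longrightarrow> (AE y in lborel. f y s = f0 (y, s))"
proof -
  define D where "D = (UNIV :: (real ^ 'n) set) \<times> {0::real..}"
  have D: "D \<in> sets borel"
    unfolding D_def by (intro borel_closed closed_Times) auto
  then have "D \<in> sets lebesgue" by (simp add: sets_completionI_sets)
  then have "(\<lambda>z. indicator D z *\<^sub>R (case z of (x, t) \<Rightarrow> f x t)) \<in> borel_measurable lebesgue"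
    using f unfolding source_measurable_def D_def[symmetric]
    by (subst (asm) borel_measurable_restrict_space_iff) auto
  from completion_ex_borel_measurable_real[OF this]
  obtain f0 where f0: "f0 \<in> borel_measurable lborel"
    and ae: "AE z in lborel. indicator D z *\<^sub>R (case z of (x, t) \<Rightarrow> f x t) = f0 z" by blast
  obtain N where N: "{z \<in> space lborel. \<not> indicator D z *\<^sub>R (case z of (x, t) \<Rightarrow> f x t) = f0 z} \<subseteq> N"
      "emeasure lborel N = 0" "N \<in> sets lborel"
    using ae by (auto simp: eventually_ae_filter null_sets_def)
  have [measurable]: "N \<in> sets (borel \<Otimes>\<^sub>M borel)" unfolding borel_prod using N by simp
  have "AE z in lborel \<Otimes>\<^sub>M lborel. z \<notin> N"
    unfolding lborel_prod by (rule AE_not_in) (use N in \<open>simp add: null_sets_def\<close>)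
  then have "AE y in lborel. AE s in lborel. (y, s) \<notin> N"
    by (rule lborel_pair.AE_pair)
  then have "AE s in lborel. AE y in lborel. (y, s) \<notin> N"
    by (subst (asm) lborel_pair.AE_commute) measurable
  then have "AE s in lborel. 0 \<le> s \<longrightarrow> (AE y in lborel. f y s = f0 (y, s))"
  proof eventually_elim
    case (elim s)
    show ?case
    proof
      assume s: "0 \<le> s"
      show "AE y in lborel. f y s = f0 (y, s)"
      proof (use elim in eventually_elim)
        fix y assume "(y, s) \<notin> N"
        then have "(y, s) \<notin> {z \<in> space lborel. \<not> indicator D z *\<^sub>R (case z of (x, t) \<Rightarrow> f x t) = f0 z}"
          using N(1) by blast
        then have "indicat_real D (y, s) *\<^sub>R f y s = f0 (y, s)" by simp
        then show "f y s = f0 (y, s)" using s by (simp add: D_def)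
      qed
    qed
  qed
  then show ?thesis using that f0 by simp
qed

lemma source_representative_L1:
  fixes f :: "real ^ 'n::finite \<Rightarrow> real \<Rightarrow> real"
  assumes L1: "source_L1_bound \<gamma> f"
    and ae: "AE s in lborel. 0 \<le> s \<longrightarrow> (AE y in lborel. f y s = f0 (y, s))"
  shows "\<exists>C>0. AE s in lborel. 0 \<le> s \<longrightarrow> (\<integral>\<^sup>+y. ennreal \<bar>f0 (y, s)\<bar> \<partial>lborel) \<le> ennreal (C * (1 + s) powr (- \<gamma>))"
proof -
  obtain C where C: "0 < C" "\<And>t. 0 \<le> t \<Longrightarrow> Lp_norm 1 lebesgue (\<lambda>x. f x t) \<le> ennreal (C / (1 + t) powr \<gamma>)"
    using L1 unfolding source_L1_bound_def by auto
  have "AE s in lborel. 0 \<le> s \<longrightarrow> (\<integral>\<^sup>+y. ennreal \<bar>f0 (y, s)\<bar> \<partial>lborel) \<le> ennreal (C * (1 + s) powr (- \<gamma>))"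
    using ae
  proof eventually_elim
    case (elim s)
    show ?case
    proof
      assume s: "0 \<le> s"
      with elim have "AE y in lborel. f y s = f0 (y, s)" by simp
      then have "(\<integral>\<^sup>+y. ennreal \<bar>f0 (y, s)\<bar> \<partial>lborel) = (\<integral>\<^sup>+y. ennreal \<bar>f y s\<bar> \<partial>lborel)"
        by (rule nn_integral_cong_AE[OF eventually_mono]) simp
      also have "\<dots> = Lp_norm 1 lebesgue (\<lambda>x. f x s)" by (simp add: Lp_norm_1 nn_integral_completion)
      also have "\<dots> \<le> ennreal (C * (1 + s) powr (- \<gamma>))" using C(2)[OF s] by (simp add: powr_minus divide_inverse)
      finally show "(\<integral>\<^sup>+y. ennreal \<bar>f0 (y, s)\<bar> \<partial>lborel) \<le> ennreal (C * (1 + s) powr (- \<gamma>))" .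
    qed
  qed
  then show ?thesis using C(1) by blast
qed

context subordinated
begin

lemma mild_solution_eq:
  fixes f :: "real ^ 'n::finite \<Rightarrow> real \<Rightarrow> real"
  assumes f0: "f0 \<in> borel_measurable borel"
    and ae: "AE s in lborel. 0 \<le> s \<longrightarrow> (AE y in lborel. f y s = f0 (y, s))"
  shows "mild_solution a b f x t =
    (LINT s|lborel. indicator {0..t} s * (LINT y|lborel. Y (x - y) (t - s) * f0 (y, s)))"
proof -
  have f0' [measurable]: "f0 \<in> borel_measurable (borel \<Otimes>\<^sub>M borel)" unfolding borel_prod by (rule f0)
  show ?thesis
    unfolding mild_solution_def set_lebesgue_integral_def
  proof (rule lebesgue_integral_cong_AE)
    show "(\<lambda>s. indicator {0..t} s * (LINT y|lborel. Y (x - y) (t - s) * f0 (y, s))) \<in> borel_measurable borel"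
      by measurable
    show "AE s in lborel. indicat_real {0..t} s *\<^sub>R (LINT y|lebesgue. kernel_Y a b (x - y) (t - s) * f y s) =
        indicat_real {0..t} s * (LINT y|lborel. Y (x - y) (t - s) * f0 (y, s))"
      using ae
    proof eventually_elim
      case (elim s)
      show ?case
      proof (cases "s \<in> {0..t}")
        case True
        then have "AE y in lborel. f y s = f0 (y, s)" using elim by simp
        moreover have "AE y in lborel. kernel_Y a b (x - y) (t - s) = Y (x - y) (t - s)"
          using True by (intro AE_lborel_reflect kernel_Y_AE) simp
        ultimately have "AE y in lborel. kernel_Y a b (x - y) (t - s) * f y s = Y (x - y) (t - s) * f0 (y, s)"
          by eventually_elim simp
        then have "(LINT y|lebesgue. kernel_Y a b (x - y) (t - s) * f y s) = (LINT y|lborel. Y (x - y) (t - s) * f0 (y, s))"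
          by (rule lebesgue_integral_cong_AE[rotated]) measurable
        then show ?thesis by simp
      qed simp
    qed
  qed
qed

lemma mild_solution_measurable:
  fixes f :: "real ^ 'n::finite \<Rightarrow> real \<Rightarrow> real"
  assumes f: "source_measurable f"
  shows "(\<lambda>x. mild_solution a b f x t) \<in> borel_measurable borel"
proof -
  obtain f0 :: "(real ^ 'n) \<times> real \<Rightarrow> real" where f0: "f0 \<in> borel_measurable borel"
    and ae: "AE s in lborel. 0 \<le> s \<longrightarrow> (AE y in lborel. f y s = f0 (y, s))"
    by (rule source_representative[OF f])
  have f0' [measurable]: "f0 \<in> borel_measurable (borel \<Otimes>\<^sub>M borel)" unfolding borel_prod by (rule f0)
  have 1: "(\<lambda>z. LINT y|lborel. Y (fst z - y) (t - snd z) * f0 (y, snd z)) \<in> borel_measurable (borel \<Otimes>\<^sub>M (borel :: real measure))"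
    by (rule lborel.borel_measurable_lebesgue_integral) measurable
  have "(\<lambda>x. LINT s|lborel. indicator {0..t} s * (LINT y|lborel. Y (x - y) (t - s) * f0 (y, s))) \<in> borel_measurable borel"
    by (rule lborel.borel_measurable_lebesgue_integral) (use 1 in \<open>simp add: case_prod_unfold\<close>)
  then show ?thesis by (simp only: mild_solution_eq[OF f0 ae])
qed

text \<open>
  The time \<open>s = t\<close> is left out because the estimates of the kernel hold at positive times only.
\<close>

lemma mild_solution_bound:
  fixes f :: "real ^ 'n::finite \<Rightarrow> real \<Rightarrow> real"
  assumes f0: "f0 \<in> borel_measurable borel"
    and ae: "AE s in lborel. 0 \<le> s \<longrightarrow> (AE y in lborel. f y s = f0 (y, s))"
  shows "ennreal \<bar>mild_solution a b f x t\<bar> \<le>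
    (\<integral>\<^sup>+s. (\<integral>\<^sup>+y. ennreal (indicator {0..<t} s * \<bar>f0 (y, s)\<bar> * Y (x - y) (t - s)) \<partial>lborel) \<partial>lborel)"
proof -
  have f0' [measurable]: "f0 \<in> borel_measurable (borel \<Otimes>\<^sub>M borel)" unfolding borel_prod by (rule f0)
  have "ennreal \<bar>mild_solution a b f x t\<bar> \<le>
      (\<integral>\<^sup>+s. ennreal \<bar>indicator {0..t} s * (LINT y|lborel. Y (x - y) (t - s) * f0 (y, s))\<bar> \<partial>lborel)"
    unfolding mild_solution_eq[OF f0 ae] by (rule ennreal_integral_le)
  also have "\<dots> \<le> (\<integral>\<^sup>+s. (\<integral>\<^sup>+y. ennreal (indicator {0..<t} s * \<bar>f0 (y, s)\<bar> * Y (x - y) (t - s)) \<partial>lborel) \<partial>lborel)"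
  proof (rule nn_integral_mono)
    fix s
    show "ennreal \<bar>indicator {0..t} s * (LINT y|lborel. Y (x - y) (t - s) * f0 (y, s))\<bar> \<le>
        (\<integral>\<^sup>+y. ennreal (indicator {0..<t} s * \<bar>f0 (y, s)\<bar> * Y (x - y) (t - s)) \<partial>lborel)"
    proof (cases "s \<in> {0..<t}")
      case True
      have "ennreal \<bar>LINT y|lborel. Y (x - y) (t - s) * f0 (y, s)\<bar> \<le>
          (\<integral>\<^sup>+y. ennreal \<bar>Y (x - y) (t - s) * f0 (y, s)\<bar> \<partial>lborel)"
        by (rule ennreal_integral_le)
      then show ?thesis using True by (simp add: abs_mult Y_nonneg mult.commute)
    next
      case False
      then show ?thesis by (cases "s = t") (auto simp: Y_zero)
    qed
  qed
  finally show ?thesis .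
qed

text \<open>
  Minkowski's inequality over space-time with weight \<open>|f(y,s)|\<close>: by translation invariance the norm of
  \<open>Y(\<cdot> - y, t - s)\<close> does not depend on \<open>y\<close>, and the integral over \<open>y\<close> leaves the \<open>L\<^sup>1\<close> norm of the source at
  time \<open>s\<close>.
\<close>

lemma mild_solution_Lp_subcritical:
  fixes f :: "real ^ 'n::finite \<Rightarrow> real \<Rightarrow> real" and p :: real
  assumes f: "source_measurable f" and L1: "source_L1_bound \<gamma> f"
    and p: "1 \<le> p" and crit: "real CARD('n) * (1 - 1 / p) < 2 * b"
  shows "\<exists>C>0. \<forall>t\<ge>2. (\<integral>\<^sup>+x. ennreal (\<bar>mild_solution a b f x t\<bar> powr p) \<partial>lborel) \<le>
    ennreal ((C * (t powr (a - 1 - a * real CARD('n) / (2 * b) * (1 - 1 / p)) * time_growth \<gamma> t)) powr p)"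
proof -
  obtain f0 :: "(real ^ 'n) \<times> real \<Rightarrow> real" where f0: "f0 \<in> borel_measurable borel"
    and ae: "AE s in lborel. 0 \<le> s \<longrightarrow> (AE y in lborel. f y s = f0 (y, s))"
    by (rule source_representative[OF f])
  have f0' [measurable]: "f0 \<in> borel_measurable (borel \<Otimes>\<^sub>M borel)" unfolding borel_prod by (rule f0)
  obtain C0 where C0: "0 < C0"
    "AE s in lborel. 0 \<le> s \<longrightarrow> (\<integral>\<^sup>+y. ennreal \<bar>f0 (y, s)\<bar> \<partial>lborel) \<le> ennreal (C0 * (1 + s) powr (- \<gamma>))"
    using source_representative_L1[OF L1 ae] by blast
  define \<sigma> where "\<sigma> = a * real CARD('n) / (2 * b) * (1 - 1 / p)"
  define e where "e = a - \<sigma>"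
  define q where "q = real CARD('n) * (1 - 1 / p) / (2 * b)"
  have "\<sigma> = a * q" by (simp add: \<sigma>_def q_def)
  moreover have "0 \<le> q" unfolding q_def using p b by simp
  moreover have "q < 1" unfolding q_def using crit b by simp
  ultimately have \<sigma>: "0 \<le> \<sigma>" "\<sigma> < a" using a by simp_all
  have e: "0 < e" "e \<le> 1" using \<sigma> a by (auto simp: e_def)
  obtain K where K: "0 < K" "\<And>t. 0 < t \<Longrightarrow> (\<integral>\<^sup>+x. ennreal (Y (x::real^'n) t powr p) \<partial>lborel) \<le> ennreal ((K * t powr (e - 1)) powr p)"
    using Y_Lp[where 'a="real^'n", OF p] crit by (auto simp: e_def \<sigma>_def algebra_simps)
  obtain C where C: "0 < C" "\<And>t. 2 \<le> t \<Longrightarrow> singular_integral e \<gamma> t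
    \<le> ennreal (C * (t powr (e - 1) * time_growth \<gamma> t))"
    using singular_weight_integral_le[OF e] by blast
  have "(\<integral>\<^sup>+x. ennreal (\<bar>mild_solution a b f x t\<bar> powr p) \<partial>lborel) \<le>
      ennreal ((K * C0 * C * (t powr (e - 1) * time_growth \<gamma> t)) powr p)" if t: "2 \<le> t" for t
  proof (rule minkowski_integral_le[where M="lborel :: (real^'n) measure" and N="lborel \<Otimes>\<^sub>M (lborel :: (real^'n) measure)"
        and g="\<lambda>(s, y). indicator {0..<t} s * \<bar>f0 (y, s)\<bar>" and k="\<lambda>(s, y). K * (t - s) powr (e - 1)"
        and K="\<lambda>x (s, y). Y (x - y) (t - s)"])
    show "sigma_finite_measure (lborel :: (real^'n) measure)" by (rule sigma_finite_lborel)
    show "sigma_finite_measure ((lborel :: real measure) \<Otimes>\<^sub>M (lborel :: (real^'n) measure))"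
      unfolding lborel_prod by (rule sigma_finite_lborel)
    show "(\<lambda>(x, w). case w of (s, y) \<Rightarrow> Y (x - y) (t - s)) \<in> borel_measurable ((lborel :: (real^'n) measure) \<Otimes>\<^sub>M (lborel \<Otimes>\<^sub>M lborel))"
      by measurable
    show "AE w in lborel \<Otimes>\<^sub>M lborel. (case w of (s, y) \<Rightarrow> indicator {0..<t} s * \<bar>f0 (y, s)\<bar>) \<noteq> 0 \<longrightarrow>
        0 < (case w of (s, y) \<Rightarrow> K * (t - s) powr (e - 1)) \<and>
        (\<integral>\<^sup>+x. ennreal ((case w of (s, y) \<Rightarrow> Y (x - y) (t - s)) powr p) \<partial>lborel)
          \<le> ennreal ((case w of (s, y) \<Rightarrow> K * (t - s) powr (e - 1)) powr p)"
    proof (rule AE_I2, safe)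
      fix s and y :: "real^'n"
      assume "indicat_real {0..<t} s * \<bar>f0 (y, s)\<bar> \<noteq> 0"
      then have ts: "0 < t - s" by (auto simp: indicator_def split: if_splits)
      then show "0 < K * (t - s) powr (e - 1)" using K by simp
      have "(\<integral>\<^sup>+x. ennreal (Y (x - y) (t - s) powr p) \<partial>lborel) = (\<integral>\<^sup>+x. ennreal (Y (x::real^'n) (t - s) powr p) \<partial>lborel)"
        by (rule nn_integral_lborel_translate[of "\<lambda>x. ennreal (Y x (t - s) powr p)"]) measurable
      then show "(\<integral>\<^sup>+x. ennreal (Y (x - y) (t - s) powr p) \<partial>lborel) \<le> ennreal ((K * (t - s) powr (e - 1)) powr p)"
        using K(2)[OF ts] by simp
    qed
    show "0 < K * C0 * C * (t powr (e - 1) * time_growth \<gamma> t)"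
      using K C0 C t by (auto simp: time_growth_def)
    have "(\<integral>\<^sup>+w. ennreal ((case w of (s, y) \<Rightarrow> indicator {0..<t} s * \<bar>f0 (y, s)\<bar>) * (case w of (s, y) \<Rightarrow> K * (t - s) powr (e - 1))) \<partial>(lborel \<Otimes>\<^sub>M lborel)) =
        (\<integral>\<^sup>+s. (\<integral>\<^sup>+y. ennreal (indicator {0..<t} s * K * (t - s) powr (e - 1)) * ennreal \<bar>f0 (y, s)\<bar> \<partial>lborel) \<partial>lborel)"
      using K by (subst lborel.nn_integral_fst[symmetric]) (auto simp: ennreal_mult[symmetric] mult_ac)
    also have "\<dots> = (\<integral>\<^sup>+s. ennreal (indicator {0..<t} s * K * (t - s) powr (e - 1)) * (\<integral>\<^sup>+y. ennreal \<bar>f0 (y, s)\<bar> \<partial>lborel) \<partial>lborel)"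
      by (intro nn_integral_cong nn_integral_cmult) measurable
    also have "\<dots> \<le> (\<integral>\<^sup>+s. ennreal (K * C0) * (ennreal ((t - s) powr (e - 1) * (1 + s) powr (- \<gamma>)) * indicator {0..t} s) \<partial>lborel)"
    proof (rule nn_integral_mono_AE, use C0(2) in eventually_elim)
      fix s assume *: "0 \<le> s \<longrightarrow> (\<integral>\<^sup>+y. ennreal \<bar>f0 (y, s)\<bar> \<partial>lborel) \<le> ennreal (C0 * (1 + s) powr (- \<gamma>))"
      show "ennreal (indicator {0..<t} s * K * (t - s) powr (e - 1)) * (\<integral>\<^sup>+y. ennreal \<bar>f0 (y, s)\<bar> \<partial>lborel) \<le>
          ennreal (K * C0) * (ennreal ((t - s) powr (e - 1) * (1 + s) powr (- \<gamma>)) * indicator {0..t} s)"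
      proof (cases "s \<in> {0..<t}")
        case True
        then have "ennreal (K * (t - s) powr (e - 1)) * (\<integral>\<^sup>+y. ennreal \<bar>f0 (y, s)\<bar> \<partial>lborel) \<le>
            ennreal (K * (t - s) powr (e - 1)) * ennreal (C0 * (1 + s) powr (- \<gamma>))"
          using * by (intro mult_left_mono) auto
        also have "\<dots> = ennreal (K * C0) * ennreal ((t - s) powr (e - 1) * (1 + s) powr (- \<gamma>))"
          using K C0 by (simp add: ennreal_mult[symmetric] mult_ac)
        finally show ?thesis using True by simp
      qed simp
    qed
    also have "\<dots> = ennreal (K * C0) * singular_integral e \<gamma> t"
      by (rule nn_integral_cmult) measurable
    also have "\<dots> \<le> ennreal (K * C0) * ennreal (C * (t powr (e - 1) * time_growth \<gamma> t))"
      by (intro mult_left_mono C t) simp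
    also have "\<dots> = ennreal (K * C0 * C * (t powr (e - 1) * time_growth \<gamma> t))"
      using K C0 C t time_growth_nonneg[of t \<gamma>] by (simp add: ennreal_mult[symmetric] mult.assoc)
    finally show "(\<integral>\<^sup>+w. ennreal ((case w of (s, y) \<Rightarrow> indicator {0..<t} s * \<bar>f0 (y, s)\<bar>) * (case w of (s, y) \<Rightarrow> K * (t - s) powr (e - 1))) \<partial>(lborel \<Otimes>\<^sub>M lborel))
        \<le> ennreal (K * C0 * C * (t powr (e - 1) * time_growth \<gamma> t))" .
    show "AE x in lborel. ennreal \<bar>mild_solution a b f x t\<bar> \<le>
        (\<integral>\<^sup>+w. ennreal ((case w of (s, y) \<Rightarrow> indicator {0..<t} s * \<bar>f0 (y, s)\<bar>) * (case w of (s, y) \<Rightarrow> Y (x - y) (t - s))) \<partial>(lborel \<Otimes>\<^sub>M lborel))"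
    proof (rule AE_I2)
      fix x :: "real^'n"
      show "ennreal \<bar>mild_solution a b f x t\<bar> \<le>
        (\<integral>\<^sup>+w. ennreal ((case w of (s, y) \<Rightarrow> indicator {0..<t} s * \<bar>f0 (y, s)\<bar>) * (case w of (s, y) \<Rightarrow> Y (x - y) (t - s))) \<partial>(lborel \<Otimes>\<^sub>M lborel))"
        using mild_solution_bound[OF f0 ae, of x t]
        by (subst lborel.nn_integral_fst[symmetric]) auto
    qed
  qed (use p in \<open>auto simp: Y_nonneg\<close>)
  moreover have "0 < K * C0 * C" using K C0 C by simp
  moreover have "e - 1 = a - 1 - a * real CARD('n) / (2 * b) * (1 - 1 / p)" by (simp add: e_def \<sigma>_def)
  ultimately show ?thesis by metis
qed

end

section \<open>Pointwise decay in the exterior region\<close>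

text \<open>
  By scaling it is enough to take \<open>R = 1\<close>.  There the integrand is bounded by \<open>2\<^bsup>-kq\<^esup>\<close> on the ball of radius
  \<open>2\<^bsup>k+1\<^esup>\<close>, for the \<open>k\<close> of the dyadic shell containing \<open>x\<close>, and the sum of the bounds is geometric with ratio
  \<open>2\<^bsup>N-q\<^esup>\<close>.
\<close>

lemma nn_integral_norm_powr_tail:
  assumes q: "real DIM('a::euclidean_space) < q"
  shows "\<exists>C>0. \<forall>R>0. (\<integral>\<^sup>+x. ennreal (norm (x::'a) powr (- q)) * indicator {x. R \<le> norm x} x \<partial>lborel)
    \<le> ennreal (C * R powr (real DIM('a) - q))"
proof -
  let ?N = "real DIM('a)"
  let ?I = "\<lambda>R. \<integral>\<^sup>+x. ennreal (norm (x::'a) powr (- q)) * indicator {x. R \<le> norm x} x \<partial>lborel"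
  define v where "v = unit_ball_vol ?N"
  have v: "0 < v" unfolding v_def by simp
  define \<rho> where "\<rho> = 2 powr (?N - q)"
  have \<rho>: "0 < \<rho>" "\<rho> < 1" using q powr_less_mono[of "?N - q" 0 2] by (auto simp: \<rho>_def)
  define C where "C = v * 2 ^ DIM('a) * (1 / (1 - \<rho>))"
  have C: "0 < C" using v \<rho> by (simp add: C_def)
  have one: "?I 1 \<le> ennreal C"
  proof -
    define F where "F k x = ennreal ((2 ^ k) powr (- q)) * indicator (cball 0 (2 ^ (k + 1))) x" for k :: nat and x :: 'a
    have [measurable]: "F k \<in> borel_measurable borel" for k
      unfolding F_def by (intro borel_measurable_times_ennreal borel_measurable_indicator) auto
    have "?I 1 \<le> (\<integral>\<^sup>+x. (\<Sum>k. F k x) \<partial>lborel)"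
    proof (rule nn_integral_mono)
      fix x :: 'a
      show "ennreal (norm x powr (- q)) * indicator {x. 1 \<le> norm x} x \<le> (\<Sum>k. F k x)"
      proof (cases "1 \<le> norm x")
        case True
        obtain n where "norm x < 2 ^ n" using real_arch_pow[of 2 "norm x"] by auto
        then have ex: "norm x < 2 ^ (n + 1)" by (rule less_le_trans) simp
        define m where "m = (LEAST m. norm x < 2 ^ (m + 1))"
        have m: "norm x < 2 ^ (m + 1)" unfolding m_def by (rule LeastI[of "\<lambda>m. norm x < 2 ^ (m + 1)", OF ex])
        have m2: "2 ^ m \<le> norm x"
        proof (cases m)
          case 0
          then show ?thesis using True by simp
        next
          case (Suc j)
          then have "\<not> norm x < 2 ^ (j + 1)" using not_less_Least[of j "\<lambda>m. norm x < 2 ^ (m + 1)"] by (simp add: m_def)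
          then show ?thesis using Suc by simp
        qed
        have q0: "0 \<le> q" using q of_nat_0_le_iff[of "DIM('a)", where 'a=real] by linarith
        have "norm x powr (- q) \<le> (2 ^ m) powr (- q)" using m2 q0 by (intro powr_mono2') auto
        then have "ennreal (norm x powr (- q)) * indicator {x. 1 \<le> norm x} x \<le> F m x"
          unfolding F_def using True m by (auto intro: ennreal_leI)
        also have "F m x = (\<Sum>k\<in>{m}. F k x)" by simp
        also have "\<dots> \<le> (\<Sum>k. F k x)" by (rule sum_le_suminf) auto
        finally show ?thesis .
      qed simp
    qed
    also have "\<dots> = (\<Sum>k. \<integral>\<^sup>+x. F k x \<partial>lborel)"
      by (rule nn_integral_suminf) simp
    also have "(\<lambda>k. \<integral>\<^sup>+x. F k x \<partial>lborel) = (\<lambda>k. ennreal (v * 2 ^ DIM('a) * \<rho> ^ k))"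
    proof (rule ext)
      fix k
      have "(\<integral>\<^sup>+x. F k x \<partial>lborel) = ennreal ((2 ^ k) powr (- q)) * emeasure lborel (cball (0::'a) (2 ^ (k + 1)))"
        unfolding F_def by (rule nn_integral_cmult_indicator) simp
      also have "emeasure lborel (cball (0::'a) (2 ^ (k + 1))) = ennreal (v * (2 ^ (k + 1)) ^ DIM('a))"
        unfolding v_def by (rule emeasure_cball) simp
      also have "ennreal ((2 ^ k) powr (- q)) * \<dots> = ennreal ((2 ^ k) powr (- q) * (v * (2 ^ (k + 1)) ^ DIM('a)))"
        by (rule ennreal_mult'[symmetric]) simp
      also have "(2 ^ k) powr (- q) * (v * (2 ^ (k + 1)) ^ DIM('a)) = v * 2 ^ DIM('a) * \<rho> ^ k"
      proof -
        have "(2::real) ^ k = 2 powr real k" by (simp add: powr_realpow)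
        then have "(2 ^ k) powr (- q) * (2 ^ k) powr ?N = 2 powr (real k * (- q) + real k * ?N)"
          by (simp only: powr_powr powr_add)
        also have "real k * (- q) + real k * ?N = (?N - q) * real k" by (simp add: algebra_simps)
        also have "2 powr ((?N - q) * real k) = \<rho> ^ k"
          using \<rho> by (simp add: \<rho>_def powr_powr[symmetric] powr_realpow)
        also have "(2 ^ k) powr ?N = ((2::real) ^ k) ^ DIM('a)" by (rule powr_realpow) simp
        finally have "\<rho> ^ k = (2 ^ k) powr (- q) * ((2::real) ^ k) ^ DIM('a)" by (rule sym)
        then show ?thesis by (simp add: power_mult_distrib)
      qed
      finally show "(\<integral>\<^sup>+x. F k x \<partial>lborel) = ennreal (v * 2 ^ DIM('a) * \<rho> ^ k)" .
    qed
    also have "(\<Sum>k. ennreal (v * 2 ^ DIM('a) * \<rho> ^ k)) = ennreal C"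
      unfolding C_def using v \<rho> by (intro suminf_ennreal_eq sums_mult geometric_sums) auto
    finally show ?thesis .
  qed
  have "?I R \<le> ennreal (C * R powr (?N - q))" if R: "0 < R" for R
  proof -
    have "?I R = ennreal (\<bar>R\<bar> ^ DIM('a)) * (\<integral>\<^sup>+x. ennreal (norm (0 + R *\<^sub>R (x::'a)) powr (- q)) * indicator {x. R \<le> norm x} (0 + R *\<^sub>R x) \<partial>lborel)"
      using R by (intro nn_integral_lborel_affine) auto
    also have "(\<integral>\<^sup>+x. ennreal (norm (0 + R *\<^sub>R (x::'a)) powr (- q)) * indicator {x. R \<le> norm x} (0 + R *\<^sub>R x) \<partial>lborel) =
        (\<integral>\<^sup>+x. ennreal (R powr (- q)) * (ennreal (norm (x::'a) powr (- q)) * indicator {x. 1 \<le> norm x} x) \<partial>lborel)"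
    proof (rule nn_integral_cong)
      fix x :: 'a
      have "R \<le> R * norm x \<longleftrightarrow> 1 \<le> norm x" using R by simp
      then show "ennreal (norm (0 + R *\<^sub>R x) powr (- q)) * indicator {x. R \<le> norm x} (0 + R *\<^sub>R x) =
          ennreal (R powr (- q)) * (ennreal (norm x powr (- q)) * indicator {x. 1 \<le> norm x} x)"
        using R by (auto simp: powr_mult ennreal_mult indicator_def)
    qed
    also have "\<dots> = ennreal (R powr (- q)) * ?I 1" by (rule nn_integral_cmult) measurable
    also have "ennreal (\<bar>R\<bar> ^ DIM('a)) * (ennreal (R powr (- q)) * ?I 1) \<le> ennreal (\<bar>R\<bar> ^ DIM('a)) * (ennreal (R powr (- q)) * ennreal C)"
      by (intro mult_left_mono one) auto
    also have "\<dots> = ennreal (C * R powr (?N - q))"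
      using R C by (simp add: ennreal_mult[symmetric] powr_diff powr_minus powr_realpow field_simps)
    finally show ?thesis .
  qed
  then show ?thesis using C by blast
qed

lemma Lp_norm_lebesgue_on:
  fixes g :: "'a::euclidean_space \<Rightarrow> real"
  assumes p: "p \<noteq> \<top>" and E: "E \<in> sets borel"
  shows "Lp_norm p (lebesgue_on E) g =
    (let I = (\<integral>\<^sup>+x. ennreal (\<bar>g x\<bar> powr enn2real p) * indicator E x \<partial>lborel)
     in if I = \<top> then \<top> else ennreal (enn2real I powr (1 / enn2real p)))"
proof -
  have "E \<in> sets lebesgue" using E by (simp add: sets_completionI_sets)
  then have "(\<integral>\<^sup>+x. ennreal (\<bar>g x\<bar> powr enn2real p) \<partial>lebesgue_on E) =
      (\<integral>\<^sup>+x. ennreal (\<bar>g x\<bar> powr enn2real p) * indicator E x \<partial>lborel)"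
    by (subst nn_integral_restrict_space) (auto simp: nn_integral_completion)
  then show ?thesis using p by (simp add: Lp_norm_def)
qed

lemma Lp_norm_lebesgue_on_le:
  fixes g :: "'a::euclidean_space \<Rightarrow> real"
  assumes p: "p \<noteq> \<top>" "0 < enn2real p" and E: "E \<in> sets borel" and B: "0 \<le> B"
    and le: "(\<integral>\<^sup>+x. ennreal (\<bar>g x\<bar> powr enn2real p) * indicator E x \<partial>lborel) \<le> ennreal (B powr enn2real p)"
  shows "Lp_norm p (lebesgue_on E) g \<le> ennreal B"
proof -
  obtain i where i: "(\<integral>\<^sup>+x. ennreal (\<bar>g x\<bar> powr enn2real p) * indicator E x \<partial>lborel) = ennreal i" "0 \<le> i"
    using le by (cases "\<integral>\<^sup>+x. ennreal (\<bar>g x\<bar> powr enn2real p) * indicator E x \<partial>lborel") (auto simp: top_unique)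
  have "i \<le> B powr enn2real p" using le i by simp
  then have "i powr (1 / enn2real p) \<le> (B powr enn2real p) powr (1 / enn2real p)"
    using i p by (intro powr_mono2) auto
  also have "\<dots> = B" using p B by (simp add: powr_powr)
  finally show ?thesis
    unfolding Lp_norm_lebesgue_on[OF p(1) E] i(1) using i(2) by (simp add: ennreal_leI)
qed

lemma Lp_norm_lebesgue_on_ge:
  fixes g :: "'a::euclidean_space \<Rightarrow> real"
  assumes p: "p \<noteq> \<top>" "0 < enn2real p" and E: "E \<in> sets borel" and B: "0 \<le> B"
    and ge: "ennreal (B powr enn2real p) \<le> (\<integral>\<^sup>+x. ennreal (\<bar>g x\<bar> powr enn2real p) * indicator E x \<partial>lborel)"
  shows "ennreal B \<le> Lp_norm p (lebesgue_on E) g"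
proof (cases "(\<integral>\<^sup>+x. ennreal (\<bar>g x\<bar> powr enn2real p) * indicator E x \<partial>lborel) = \<top>")
  case True
  then show ?thesis unfolding Lp_norm_lebesgue_on[OF p(1) E] by simp
next
  case False
  then obtain i where i: "(\<integral>\<^sup>+x. ennreal (\<bar>g x\<bar> powr enn2real p) * indicator E x \<partial>lborel) = ennreal i" "0 \<le> i"
    by (cases "\<integral>\<^sup>+x. ennreal (\<bar>g x\<bar> powr enn2real p) * indicator E x \<partial>lborel") auto
  have "B powr enn2real p \<le> i" using ge i by simp
  then have "(B powr enn2real p) powr (1 / enn2real p) \<le> i powr (1 / enn2real p)"
    using p by (intro powr_mono2) auto
  also have "(B powr enn2real p) powr (1 / enn2real p) = B" using p B by (simp add: powr_powr)
  finally show ?thesis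
    unfolding Lp_norm_lebesgue_on[OF p(1) E] i(1) using i(2) by (simp add: ennreal_leI)
qed

lemma Lp_norm_top_le:
  fixes g :: "'a::euclidean_space \<Rightarrow> real"
  assumes g: "g \<in> borel_measurable (lebesgue_on E)" and le: "\<And>x. x \<in> E \<Longrightarrow> \<bar>g x\<bar> \<le> B"
  shows "Lp_norm \<top> (lebesgue_on E) g \<le> ennreal B"
proof -
  have "esssup (lebesgue_on E) (\<lambda>x. ennreal \<bar>g x\<bar>) \<le> ennreal B"
  proof (rule esssup_I)
    show "(\<lambda>x. ennreal \<bar>g x\<bar>) \<in> borel_measurable (lebesgue_on E)" using g by measurable
    show "AE x in lebesgue_on E. ennreal \<bar>g x\<bar> \<le> ennreal B"
      by (rule AE_I2) (use le in \<open>auto simp: space_restrict_space intro!: ennreal_leI\<close>)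
  qed
  then show ?thesis by (simp add: Lp_norm_def)
qed

text \<open>
  A set of positive measure on which \<open>|g| \<ge> B\<close> prevents the essential supremum from being smaller than \<open>B\<close>.
\<close>

lemma Lp_norm_top_ge:
  fixes g :: "'a::euclidean_space \<Rightarrow> real"
  assumes E: "E \<in> sets borel" and S: "S \<in> sets borel" "S \<subseteq> E" "0 < emeasure lborel S"
    and ge: "\<And>x. x \<in> S \<Longrightarrow> B \<le> \<bar>g x\<bar>"
  shows "ennreal B \<le> Lp_norm \<top> (lebesgue_on E) g"
proof (rule ccontr)
  let ?e = "esssup (lebesgue_on E) (\<lambda>x. ennreal \<bar>g x\<bar>)"
  assume "\<not> ennreal B \<le> Lp_norm \<top> (lebesgue_on E) g"
  then have lt: "?e < ennreal B" by (simp add: Lp_norm_def)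
  have E': "E \<in> sets lebesgue" and S': "S \<in> sets lebesgue" using E S by (simp_all add: sets_completionI_sets)
  have "AE x in lebesgue_on E. ennreal \<bar>g x\<bar> \<le> ?e" by (rule esssup_AE)
  then have "AE x in lebesgue. x \<in> E \<longrightarrow> ennreal \<bar>g x\<bar> \<le> ?e"
    using E' by (simp add: AE_restrict_space_iff)
  then have "AE x in lebesgue. x \<notin> S"
  proof eventually_elim
    case (elim x)
    show ?case
    proof
      assume x: "x \<in> S"
      then have "ennreal B \<le> ennreal \<bar>g x\<bar>" by (intro ennreal_leI ge)
      also have "\<dots> \<le> ?e" using elim x S by auto
      finally show False using lt by simp
    qed
  qed
  then have "S \<in> null_sets lebesgue" using S' by (simp add: AE_iff_null_sets)
  then show False using S by (simp add: null_sets_def)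
qed

context subordinated
begin

text \<open>
  If \<open>|y| \<le> |x|/2\<close>, then \<open>|x - y| \<ge> |x|/2\<close> and the kernel is small; if \<open>|y| > |x|/2\<close>, then the source is small.
  Both cases yield the factor \<open>|x|\<^bsup>-N\<^esup>\<close>.  The time \<open>t0\<close> is such that \<open>|x|/2 \<ge> R0\<close> throughout the exterior region,
  so that the decay of the source is available in the second case.
\<close>

lemma mild_solution_pointwise:
  fixes f :: "real ^ 'n::finite \<Rightarrow> real \<Rightarrow> real"
  assumes f: "source_measurable f" and L1: "source_L1_bound \<gamma> f" and decay: "source_spatial_decay \<gamma> f"
    and \<nu>: "0 < \<nu>"
  shows "\<exists>C>0. \<exists>t0\<ge>2. \<forall>t\<ge>t0. \<forall>x. \<nu> * t powr (a / (2 * b)) \<le> norm x \<longrightarrow>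
    \<bar>mild_solution a b f x t\<bar> \<le> C * norm x powr (- real CARD('n)) * (t powr (a - 1) * time_growth \<gamma> t)"
proof -
  let ?N = "real CARD('n)"
  obtain f0 :: "(real ^ 'n) \<times> real \<Rightarrow> real" where f0: "f0 \<in> borel_measurable borel"
    and ae: "AE s in lborel. 0 \<le> s \<longrightarrow> (AE y in lborel. f y s = f0 (y, s))"
    by (rule source_representative[OF f])
  have f0' [measurable]: "f0 \<in> borel_measurable (borel \<Otimes>\<^sub>M borel)" unfolding borel_prod by (rule f0)
  obtain C0 where C0: "0 < C0"
    "AE s in lborel. 0 \<le> s \<longrightarrow> (\<integral>\<^sup>+y. ennreal \<bar>f0 (y, s)\<bar> \<partial>lborel) \<le> ennreal (C0 * (1 + s) powr (- \<gamma>))"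
    using source_representative_L1[OF L1 ae] by auto
  obtain C1 R0 where C1: "0 < C1" "0 < R0"
    "\<And>x t. R0 \<le> norm x \<Longrightarrow> 0 \<le> t \<Longrightarrow> \<bar>f x t\<bar> \<le> C1 * norm x powr (- ?N) * (1 + t) powr (- \<gamma>)"
    using decay unfolding source_spatial_decay_def by auto
  obtain CY where CY: "0 < CY" "\<And>t x. 0 < t \<Longrightarrow> (x::real^'n) \<noteq> 0 \<Longrightarrow> Y x t \<le> CY * t powr (a - 1) * norm x powr (- ?N)"
    using Y_le[where 'a="real^'n"] by auto
  obtain CA where CA: "0 < CA" "\<And>t. 2 \<le> t \<Longrightarrow> singular_integral a \<gamma> t
    \<le> ennreal (CA * (t powr (a - 1) * time_growth \<gamma> t))"
    using singular_weight_integral_le[of a \<gamma>] a by auto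
  define \<delta> where "\<delta> = a / (2 * b)"
  have \<delta>: "0 < \<delta>" using a b by (simp add: \<delta>_def)
  define t0 where "t0 = max 2 ((2 * R0 / \<nu>) powr (1 / \<delta>))"
  define K where "K = CY * 2 powr ?N * C0 + C1 * 2 powr ?N * mass"
  have K: "0 < K" unfolding K_def using CY C0 C1 mass_pos by (intro add_pos_pos) auto
  have main: "\<bar>mild_solution a b f x t\<bar> \<le> K * CA * norm x powr (- ?N) * (t powr (a - 1) * time_growth \<gamma> t)"
    if t: "t0 \<le> t" and x: "\<nu> * t powr \<delta> \<le> norm x" for t and x :: "real^'n"
  proof -
    have t2: "2 \<le> t" using t by (simp add: t0_def)
    have "2 * R0 / \<nu> = ((2 * R0 / \<nu>) powr (1 / \<delta>)) powr \<delta>" using \<delta> C1 \<nu> by (simp add: powr_powr)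
    also have "\<dots> \<le> t powr \<delta>" using t \<delta> by (intro powr_mono2) (auto simp: t0_def)
    finally have "2 * R0 \<le> \<nu> * t powr \<delta>" using \<nu> by (simp add: field_simps)
    then have R: "2 * R0 \<le> norm x" using x by linarith
    then have x0: "0 < norm x" using C1 by linarith
    define X where "X = norm x powr (- ?N)"
    have X: "0 < X" using x0 by (simp add: X_def)
    have half: "z powr (- ?N) \<le> 2 powr ?N * X" if "norm x / 2 \<le> z" for z
    proof -
      have "z powr (- ?N) \<le> (norm x / 2) powr (- ?N)" using that x0 by (intro powr_mono2') auto
      then show ?thesis using x0 by (simp add: X_def powr_divide powr_minus field_simps)
    qed
    have slice: "AE s in lborel. (\<integral>\<^sup>+y. ennreal (indicator {0..<t} s * \<bar>f0 (y, s)\<bar> * Y (x - y) (t - s)) \<partial>lborel) \<le>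
        ennreal (K * X) * (ennreal ((t - s) powr (a - 1) * (1 + s) powr (- \<gamma>)) * indicator {0..t} s)"
      using ae C0(2)
    proof eventually_elim
      case (elim s)
      show ?case
      proof (cases "s \<in> {0..<t}")
        case True
        define \<tau> where "\<tau> = t - s"
        have \<tau>: "0 < \<tau>" using True by (simp add: \<tau>_def)
        define w where "w = (1 + s) powr (- \<gamma>)"
        have w: "0 \<le> w" by (simp add: w_def)
        have aef: "AE y in lborel. f y s = f0 (y, s)" using elim(1) True by simp
        have l1: "(\<integral>\<^sup>+y. ennreal \<bar>f0 (y, s)\<bar> \<partial>lborel) \<le> ennreal (C0 * w)" using elim(2) True by (simp add: w_def)
        have Yint: "(\<integral>\<^sup>+y. ennreal (Y (x - y) \<tau>) \<partial>lborel) = ennreal (\<tau> powr (a - 1) * mass)"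
          using nn_integral_lborel_reflect[of "\<lambda>z. ennreal (Y z \<tau>)" x] nn_integral_Y[OF \<tau>, where 'a="real^'n"] by simp
        have "(\<integral>\<^sup>+y. ennreal (\<bar>f0 (y, s)\<bar> * Y (x - y) \<tau>) \<partial>lborel) \<le>
            (\<integral>\<^sup>+y. ennreal (CY * 2 powr ?N * X * \<tau> powr (a - 1)) * ennreal \<bar>f0 (y, s)\<bar> +
              ennreal (C1 * 2 powr ?N * X * w) * ennreal (Y (x - y) \<tau>) \<partial>lborel)"
        proof (rule nn_integral_mono_AE, use aef in eventually_elim)
          fix y assume fy: "f y s = f0 (y, s)"
          have "\<bar>f0 (y, s)\<bar> * Y (x - y) \<tau> \<le>
              CY * 2 powr ?N * X * \<tau> powr (a - 1) * \<bar>f0 (y, s)\<bar> + C1 * 2 powr ?N * X * w * Y (x - y) \<tau>"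
          proof (cases "norm y \<le> norm x / 2")
            case near: True
            have d: "norm x / 2 \<le> norm (x - y)" using near norm_triangle_ineq2[of x y] by linarith
            then have "x - y \<noteq> 0" using x0 by auto
            then have "Y (x - y) \<tau> \<le> CY * \<tau> powr (a - 1) * norm (x - y) powr (- ?N)" by (rule CY(2)[OF \<tau>])
            also have "\<dots> \<le> CY * \<tau> powr (a - 1) * (2 powr ?N * X)"
              using CY by (intro mult_left_mono half d) auto
            finally have "Y (x - y) \<tau> * \<bar>f0 (y, s)\<bar> \<le> CY * \<tau> powr (a - 1) * (2 powr ?N * X) * \<bar>f0 (y, s)\<bar>"
              by (intro mult_right_mono) auto
            moreover have "0 \<le> C1 * 2 powr ?N * X * w * Y (x - y) \<tau>"
              using C1 X w Y_nonneg[of "x - y" \<tau>] by (intro mult_nonneg_nonneg) auto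
            ultimately show ?thesis by (simp add: mult_ac)
          next
            case far: False
            have "\<bar>f0 (y, s)\<bar> \<le> C1 * norm y powr (- ?N) * w"
              using C1(3)[of y s] fy far R True by (simp add: w_def)
            also have "\<dots> \<le> C1 * (2 powr ?N * X) * w"
              using C1 w far by (intro mult_right_mono mult_left_mono half) auto
            finally have "\<bar>f0 (y, s)\<bar> * Y (x - y) \<tau> \<le> C1 * (2 powr ?N * X) * w * Y (x - y) \<tau>"
              by (intro mult_right_mono Y_nonneg)
            moreover have "0 \<le> CY * 2 powr ?N * X * \<tau> powr (a - 1) * \<bar>f0 (y, s)\<bar>"
              using CY X by (intro mult_nonneg_nonneg) auto
            ultimately show ?thesis by (simp add: mult_ac)
          qed
          then have "ennreal (\<bar>f0 (y, s)\<bar> * Y (x - y) \<tau>) \<le>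
              ennreal (CY * 2 powr ?N * X * \<tau> powr (a - 1) * \<bar>f0 (y, s)\<bar> + C1 * 2 powr ?N * X * w * Y (x - y) \<tau>)"
            by (rule ennreal_leI)
          also have "\<dots> = ennreal (CY * 2 powr ?N * X * \<tau> powr (a - 1)) * ennreal \<bar>f0 (y, s)\<bar> +
              ennreal (C1 * 2 powr ?N * X * w) * ennreal (Y (x - y) \<tau>)"
            using CY(1) C1(1) X w Y_nonneg[of "x - y" \<tau>]
            by (simp add: ennreal_mult[symmetric] ennreal_plus[symmetric] del: ennreal_plus)
          finally show "ennreal (\<bar>f0 (y, s)\<bar> * Y (x - y) \<tau>) \<le>
              ennreal (CY * 2 powr ?N * X * \<tau> powr (a - 1)) * ennreal \<bar>f0 (y, s)\<bar> +
              ennreal (C1 * 2 powr ?N * X * w) * ennreal (Y (x - y) \<tau>)" .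
        qed
        also have "\<dots> = ennreal (CY * 2 powr ?N * X * \<tau> powr (a - 1)) * (\<integral>\<^sup>+y. ennreal \<bar>f0 (y, s)\<bar> \<partial>lborel) +
              ennreal (C1 * 2 powr ?N * X * w) * (\<integral>\<^sup>+y. ennreal (Y (x - y) \<tau>) \<partial>lborel)"
          by (subst nn_integral_add) (auto simp: nn_integral_cmult)
        also have "\<dots> \<le> ennreal (CY * 2 powr ?N * X * \<tau> powr (a - 1)) * ennreal (C0 * w) +
              ennreal (C1 * 2 powr ?N * X * w) * ennreal (\<tau> powr (a - 1) * mass)"
          unfolding Yint by (intro add_right_mono mult_left_mono l1) simp
        also have "\<dots> = ennreal (K * X * (\<tau> powr (a - 1) * w))"
          using CY(1) C1(1) C0(1) X w mass_pos
          by (simp add: ennreal_mult[symmetric] ennreal_plus[symmetric] K_def algebra_simps del: ennreal_plus)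
        also have "\<dots> = ennreal (K * X) * ennreal (\<tau> powr (a - 1) * w)"
          using K X w by (intro ennreal_mult) auto
        finally show ?thesis using True by (simp add: \<tau>_def w_def)
      qed simp
    qed
    have "ennreal \<bar>mild_solution a b f x t\<bar> \<le>
        (\<integral>\<^sup>+s. (\<integral>\<^sup>+y. ennreal (indicator {0..<t} s * \<bar>f0 (y, s)\<bar> * Y (x - y) (t - s)) \<partial>lborel) \<partial>lborel)"
      by (rule mild_solution_bound[OF f0 ae])
    also have "\<dots> \<le> (\<integral>\<^sup>+s. ennreal (K * X) * (ennreal ((t - s) powr (a - 1) * (1 + s) powr (- \<gamma>)) * indicator {0..t} s) \<partial>lborel)"
      by (rule nn_integral_mono_AE[OF slice])
    also have "\<dots> = ennreal (K * X) * singular_integral a \<gamma> t"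
      by (rule nn_integral_cmult) measurable
    also have "\<dots> \<le> ennreal (K * X) * ennreal (CA * (t powr (a - 1) * time_growth \<gamma> t))"
      by (rule mult_left_mono[OF CA(2)[OF t2]]) simp
    also have "\<dots> = ennreal (K * CA * X * (t powr (a - 1) * time_growth \<gamma> t))"
      using K X CA(1) t2 time_growth_nonneg[of t \<gamma>] by (simp add: ennreal_mult[symmetric] mult_ac)
    finally show ?thesis
      using K X CA(1) t2 time_growth_nonneg[of t \<gamma>] unfolding X_def
      by (subst (asm) ennreal_le_iff) auto
  qed
  have "2 \<le> t0" by (simp add: t0_def)
  moreover have "0 < K * CA" using K CA by simp
  moreover have "\<forall>t\<ge>t0. \<forall>x. \<nu> * t powr (a / (2 * b)) \<le> norm x \<longrightarrow>
      \<bar>mild_solution a b f x t\<bar> \<le> K * CA * norm x powr (- ?N) * (t powr (a - 1) * time_growth \<gamma> t)"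
    using main[unfolded \<delta>_def] by simp
  ultimately show ?thesis by (intro exI conjI)
qed

end

section \<open>Norms in the exterior region\<close>

lemma cball_borel [measurable]: "cball (x :: 'a::euclidean_space) r \<in> sets borel"
  by simp

lemma exterior_region_borel: "exterior_region \<alpha> \<beta> \<nu> t \<in> sets (borel :: (real ^ 'n::finite) measure)"
  unfolding exterior_region_def by measurable

lemma measurable_exterior_region:
  fixes g :: "real ^ 'n::finite \<Rightarrow> real"
  assumes "g \<in> borel_measurable borel"
  shows "g \<in> borel_measurable (lebesgue_on (exterior_region \<alpha> \<beta> \<nu> t))"
  using assms by (intro measurable_restrict_space1 measurable_completion) simp

lemma enn2real_exponent:
  assumes p: "1 \<le> p" "p \<noteq> \<top>"
  shows "1 \<le> enn2real p" "enn2real (1 / p) = 1 / enn2real p" "p = ennreal (enn2real p)"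
proof -
  obtain P where P: "p = ennreal P" "0 \<le> P" using p by (cases p) auto
  have "1 \<le> P" using p P by (simp flip: ennreal_1)
  then show "1 \<le> enn2real p" using P by simp
  show "enn2real (1 / p) = 1 / enn2real p"
    using P \<open>1 \<le> P\<close> by (simp add: divide_ennreal flip: ennreal_1)
  show "p = ennreal (enn2real p)" using P by simp
qed

lemma decay_rate_eq:
  assumes "0 < t"
  shows "decay_rate N \<alpha> \<beta> \<gamma> p t =
    t powr (\<alpha> - 1 - \<alpha> * real N / (2 * \<beta>) * (1 - enn2real (1 / p))) * time_growth \<gamma> t"
  using assms by (auto simp: decay_rate_def time_growth_def Let_def powr_add[symmetric] algebra_simps)

context subordinated
begin

lemma Lp_upper_subcritical:
  fixes f :: "real ^ 'n::finite \<Rightarrow> real \<Rightarrow> real"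
  assumes f: "source_measurable f" and L1: "source_L1_bound \<gamma> f"
    and N: "2 * b < real CARD('n)" and p: "1 \<le> p" "p < ennreal (critical_exponent CARD('n) b)"
  shows "\<exists>C>0. \<forall>t\<ge>2. Lp_norm p (lebesgue_on (exterior_region a b \<nu> t)) (\<lambda>x. mild_solution a b f x t)
    \<le> ennreal (C * decay_rate CARD('n) a b \<gamma> p t)"
proof -
  define P where "P = enn2real p"
  have pt: "p \<noteq> \<top>" using p by auto
  have P: "1 \<le> P" "enn2real (1 / p) = 1 / P" "p = ennreal P"
    using enn2real_exponent[OF p(1) pt] by (simp_all add: P_def)
  have "P < real CARD('n) / (real CARD('n) - 2 * b)"
    using p(2) P by (simp add: critical_exponent_def ennreal_less_iff)
  then have crit: "real CARD('n) * (1 - 1 / P) < 2 * b"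
    using P N by (simp add: field_simps)
  obtain C where C: "0 < C" "\<And>t. 2 \<le> t \<Longrightarrow> (\<integral>\<^sup>+x. ennreal (\<bar>mild_solution a b f x t\<bar> powr P) \<partial>lborel) \<le>
      ennreal ((C * (t powr (a - 1 - a * real CARD('n) / (2 * b) * (1 - 1 / P)) * time_growth \<gamma> t)) powr P)"
    using mild_solution_Lp_subcritical[OF f L1 P(1) crit] by auto
  have "Lp_norm p (lebesgue_on (exterior_region a b \<nu> t)) (\<lambda>x. mild_solution a b f x t)
    \<le> ennreal (C * decay_rate CARD('n) a b \<gamma> p t)" if t: "2 \<le> t" for t
  proof (rule Lp_norm_lebesgue_on_le[OF pt _ exterior_region_borel])
    show "0 < enn2real p" using P by (simp add: P_def[symmetric])
    show "0 \<le> C * decay_rate CARD('n) a b \<gamma> p t"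
      using C(1) t time_growth_nonneg[of t \<gamma>] by (simp add: decay_rate_eq)
    have "(\<integral>\<^sup>+x. ennreal (\<bar>mild_solution a b f x t\<bar> powr enn2real p) * indicator (exterior_region a b \<nu> t) x \<partial>lborel) \<le>
        (\<integral>\<^sup>+x. ennreal (\<bar>mild_solution a b f x t\<bar> powr P) \<partial>lborel)"
      unfolding P_def by (intro nn_integral_mono) (auto split: split_indicator)
    also have "\<dots> \<le> ennreal ((C * decay_rate CARD('n) a b \<gamma> p t) powr P)"
      using C(2)[OF t] t P by (simp add: decay_rate_eq)
    finally show "(\<integral>\<^sup>+x. ennreal (\<bar>mild_solution a b f x t\<bar> powr enn2real p) * indicator (exterior_region a b \<nu> t) x \<partial>lborel) \<le>
        ennreal ((C * decay_rate CARD('n) a b \<gamma> p t) powr enn2real p)"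
      by (simp add: P_def)
  qed
  then show ?thesis using C(1) by blast
qed

lemma Lp_upper_supercritical:
  fixes f :: "real ^ 'n::finite \<Rightarrow> real \<Rightarrow> real"
  assumes f: "source_measurable f" and L1: "source_L1_bound \<gamma> f" and decay: "source_spatial_decay \<gamma> f"
    and p: "1 < p" and \<nu>: "0 < \<nu>"
  shows "\<exists>C>0. \<exists>t0\<ge>2. \<forall>t\<ge>t0. Lp_norm p (lebesgue_on (exterior_region a b \<nu> t)) (\<lambda>x. mild_solution a b f x t)
    \<le> ennreal (C * decay_rate CARD('n) a b \<gamma> p t)"
proof -
  let ?N = "real CARD('n)"
  obtain C t0 where C: "0 < C" "2 \<le> t0" "\<And>t x. t0 \<le> t \<Longrightarrow> \<nu> * t powr (a / (2 * b)) \<le> norm x \<Longrightarrow>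
    \<bar>mild_solution a b f x t\<bar> \<le> C * norm x powr (- ?N) * (t powr (a - 1) * time_growth \<gamma> t)"
    using mild_solution_pointwise[OF f L1 decay \<nu>] by auto
  have meas: "(\<lambda>x. mild_solution a b f x t) \<in> borel_measurable borel" for t
    by (rule mild_solution_measurable[OF f])
  show ?thesis
  proof (cases "p = \<top>")
    case True
    define K where "K = C * \<nu> powr (- ?N)"
    have K: "0 < K" using C \<nu> by (simp add: K_def)
    have "Lp_norm p (lebesgue_on (exterior_region a b \<nu> t)) (\<lambda>x. mild_solution a b f x t)
      \<le> ennreal (K * decay_rate CARD('n) a b \<gamma> p t)" if t: "t0 \<le> t" for t
    proof -
      have t2: "2 \<le> t" using t C by simp
      have L: "0 \<le> t powr (a - 1) * time_growth \<gamma> t" using t2 by (intro mult_nonneg_nonneg time_growth_nonneg) auto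
      have "\<bar>mild_solution a b f x t\<bar> \<le> K * decay_rate CARD('n) a b \<gamma> p t" if x: "x \<in> exterior_region a b \<nu> t" for x :: "real^'n"
      proof -
        have x': "\<nu> * t powr (a / (2 * b)) \<le> norm x" using x by (simp add: exterior_region_def)
        have "norm x powr (- ?N) \<le> (\<nu> * t powr (a / (2 * b))) powr (- ?N)"
          using x' \<nu> t2 by (intro powr_mono2') auto
        then have "C * norm x powr (- ?N) * (t powr (a - 1) * time_growth \<gamma> t) \<le>
            C * (\<nu> * t powr (a / (2 * b))) powr (- ?N) * (t powr (a - 1) * time_growth \<gamma> t)"
          using C L by (intro mult_right_mono mult_left_mono) auto
        also have "\<dots> = K * (t powr (- (a / (2 * b) * ?N)) * t powr (a - 1)) * time_growth \<gamma> t"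
          using \<nu> t2 by (simp add: powr_mult powr_powr K_def mult_ac)
        also have "t powr (- (a / (2 * b) * ?N)) * t powr (a - 1) = t powr (a - 1 - a * ?N / (2 * b) * (1 - enn2real (1 / p)))"
          using True by (simp add: powr_add[symmetric])
        finally show ?thesis using C(3)[OF t x'] t2 by (simp add: decay_rate_eq mult.assoc)
      qed
      then show ?thesis
        unfolding True by (intro Lp_norm_top_le measurable_exterior_region meas) auto
    qed
    then show ?thesis using K C(2) by blast
  next
    case False
    define P where "P = enn2real p"
    have P: "enn2real (1 / p) = 1 / P" "p = ennreal P"
      using enn2real_exponent[of p] p False by (simp_all add: P_def)
    have P1: "1 < P" using p P(2) by (simp add: ennreal_less_iff flip: ennreal_1)
    have "?N < ?N * P" using P1 by simp
    then obtain D where D: "0 < D" "\<And>R. 0 < R \<Longrightarrow> (\<integral>\<^sup>+x. ennreal (norm (x::real^'n) powr (- (?N * P))) * indicator {x. R \<le> norm x} x \<partial>lborel)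
        \<le> ennreal (D * R powr (?N - ?N * P))"
      using nn_integral_norm_powr_tail[where 'a="real^'n" and q="?N * P"] by auto
    define K where "K = C * (D powr (1 / P) * \<nu> powr (?N / P - ?N))"
    have K: "0 < K" using C D \<nu> by (simp add: K_def)
    have "Lp_norm p (lebesgue_on (exterior_region a b \<nu> t)) (\<lambda>x. mild_solution a b f x t)
      \<le> ennreal (K * decay_rate CARD('n) a b \<gamma> p t)" if t: "t0 \<le> t" for t
    proof (rule Lp_norm_lebesgue_on_le[OF False _ exterior_region_borel])
      have t2: "2 \<le> t" using t C by simp
      define R where "R = \<nu> * t powr (a / (2 * b))"
      have R: "0 < R" using \<nu> t2 by (simp add: R_def)
      define L where "L = t powr (a - 1) * time_growth \<gamma> t"
      have L: "0 \<le> L" unfolding L_def using t2 by (intro mult_nonneg_nonneg time_growth_nonneg) auto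
      show "0 < enn2real p" using P1 by (simp add: P_def)
      show "0 \<le> K * decay_rate CARD('n) a b \<gamma> p t"
        using K t2 time_growth_nonneg[of t \<gamma>] by (simp add: decay_rate_eq)
      have rate: "C * L * (D powr (1 / P) * R powr (?N / P - ?N)) = K * decay_rate CARD('n) a b \<gamma> p t"
      proof -
        have "R powr (?N / P - ?N) = \<nu> powr (?N / P - ?N) * t powr (a / (2 * b) * (?N / P - ?N))"
          using \<nu> t2 by (simp add: R_def powr_mult powr_powr)
        moreover have "t powr (a - 1) * t powr (a / (2 * b) * (?N / P - ?N)) = t powr (a - 1 - a * ?N / (2 * b) * (1 - 1 / P))"
        proof -
          have "a - 1 + a / (2 * b) * (?N / P - ?N) = a - 1 - a * ?N / (2 * b) * (1 - 1 / P)"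
            using P1 b by (simp add: field_simps)
          then show ?thesis by (simp only: powr_add[symmetric])
        qed
        ultimately show ?thesis using t2 P by (simp add: K_def L_def decay_rate_eq mult_ac)
      qed
      have "(\<integral>\<^sup>+x. ennreal (\<bar>mild_solution a b f x t\<bar> powr P) * indicator (exterior_region a b \<nu> t) x \<partial>lborel) \<le>
          (\<integral>\<^sup>+x. ennreal ((C * L) powr P) * (ennreal (norm (x::real^'n) powr (- (?N * P))) * indicator {x. R \<le> norm x} x) \<partial>lborel)"
      proof (rule nn_integral_mono)
        fix x :: "real^'n"
        show "ennreal (\<bar>mild_solution a b f x t\<bar> powr P) * indicator (exterior_region a b \<nu> t) x \<le>
            ennreal ((C * L) powr P) * (ennreal (norm x powr (- (?N * P))) * indicator {x. R \<le> norm x} x)"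
        proof (cases "R \<le> norm x")
          case True
          have "\<bar>mild_solution a b f x t\<bar> \<le> (C * L) * norm x powr (- ?N)"
            using C(3)[OF t, of x] True by (simp add: R_def L_def mult_ac)
          then have "\<bar>mild_solution a b f x t\<bar> powr P \<le> ((C * L) * norm x powr (- ?N)) powr P"
            using P1 by (intro powr_mono2) auto
          also have "\<dots> = (C * L) powr P * norm x powr (- (?N * P))"
            using C L by (simp add: powr_mult powr_powr)
          finally show ?thesis using True by (auto simp: exterior_region_def R_def ennreal_mult[symmetric] intro!: ennreal_leI)
        qed (simp add: exterior_region_def R_def)
      qed
      also have "\<dots> = ennreal ((C * L) powr P) * (\<integral>\<^sup>+x. ennreal (norm (x::real^'n) powr (- (?N * P))) * indicator {x. R \<le> norm x} x \<partial>lborel)"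
        by (rule nn_integral_cmult) measurable
      also have "\<dots> \<le> ennreal ((C * L) powr P) * ennreal (D * R powr (?N - ?N * P))"
        by (intro mult_left_mono D R) simp
      also have "\<dots> = ennreal ((C * L) powr P * (D * R powr (?N - ?N * P)))"
        using D(1) by (simp add: ennreal_mult)
      also have "(C * L) powr P * (D * R powr (?N - ?N * P)) = (C * L * (D powr (1 / P) * R powr (?N / P - ?N))) powr P"
      proof -
        have "(?N / P - ?N) * P = ?N - ?N * P" using P1 by (simp add: field_simps)
        then show ?thesis using C D(1) L P1 R by (simp add: powr_mult powr_powr)
      qed
      finally show "(\<integral>\<^sup>+x. ennreal (\<bar>mild_solution a b f x t\<bar> powr enn2real p) * indicator (exterior_region a b \<nu> t) x \<partial>lborel) \<le>
          ennreal ((K * decay_rate CARD('n) a b \<gamma> p t) powr enn2real p)"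
        by (simp only: rate P_def[symmetric])
    qed
    then show ?thesis using K C(2) by blast
  qed
qed

text \<open>
  The source that shows sharpness.  It has compact support, so that the same one serves below and above the
  critical exponent.
\<close>

definition bump :: "real \<Rightarrow> real ^ 'n::finite \<Rightarrow> real \<Rightarrow> real" where
  "bump \<gamma> y s = (if norm y \<le> 1 then (1 + s) powr (- \<gamma>) else 0)"

lemma bump_borel [measurable]: "(\<lambda>z. bump \<gamma> (fst z :: real ^ 'n::finite) (snd z)) \<in> borel_measurable (borel \<Otimes>\<^sub>M borel)"
  unfolding bump_def by measurable

lemma bump_nonneg: "0 \<le> bump \<gamma> y s"
  by (simp add: bump_def)

lemma bump_source_measurable: "source_measurable (bump \<gamma> :: real ^ 'n::finite \<Rightarrow> real \<Rightarrow> real)"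
proof -
  have "(\<lambda>(x :: real ^ 'n, t). bump \<gamma> x t) \<in> borel_measurable borel"
    using bump_borel[of \<gamma>] unfolding borel_prod by (simp add: case_prod_unfold)
  then show ?thesis
    unfolding source_measurable_def by (intro measurable_restrict_space1 measurable_completion) simp
qed

lemma bump_L1: "source_L1_bound \<gamma> (bump \<gamma> :: real ^ 'n::finite \<Rightarrow> real \<Rightarrow> real)"
  unfolding source_L1_bound_def
proof (intro exI conjI allI impI)
  let ?v = "unit_ball_vol (real CARD('n))"
  show "0 < ?v" by simp
  fix t :: real assume t: "0 \<le> t"
  have m: "(\<lambda>x :: real ^ 'n. bump \<gamma> x t) \<in> borel_measurable borel" unfolding bump_def by measurable
  then show "(\<lambda>x :: real ^ 'n. bump \<gamma> x t) \<in> borel_measurable lebesgue" by (intro measurable_completion) simp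
  have "Lp_norm 1 lebesgue (\<lambda>x :: real ^ 'n. bump \<gamma> x t) =
      (\<integral>\<^sup>+x. ennreal ((1 + t) powr (- \<gamma>)) * indicator (cball 0 1) (x :: real ^ 'n) \<partial>lborel)"
    unfolding Lp_norm_1 nn_integral_completion by (intro nn_integral_cong) (auto simp: bump_def split: split_indicator)
  also have "\<dots> = ennreal ((1 + t) powr (- \<gamma>) * ?v)"
    by (subst nn_integral_cmult_indicator) (simp_all add: emeasure_cball ennreal_mult)
  finally show "Lp_norm 1 lebesgue (\<lambda>x :: real ^ 'n. bump \<gamma> x t) \<le> ennreal (?v / (1 + t) powr \<gamma>)"
    by (simp add: powr_minus divide_inverse mult.commute)
qed

lemma bump_decay: "source_spatial_decay \<gamma> (bump \<gamma> :: real ^ 'n::finite \<Rightarrow> real \<Rightarrow> real)"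
  unfolding source_spatial_decay_def
  by (intro exI[of _ 1] conjI exI[of _ 2]) (auto simp: bump_def)

text \<open>
  The solution is defined by integrals that are \<open>0\<close> for functions that are not integrable.  As the integrals
  converge here, it can be written with integrals in the extended nonnegative reals, which are monotone.
\<close>

lemma mild_solution_bump:
  fixes x :: "real ^ 'n::finite"
  assumes t: "2 \<le> t"
  shows "ennreal (mild_solution a b (bump \<gamma>) x t) =
    (\<integral>\<^sup>+s. ennreal ((1 + s) powr (- \<gamma>)) * indicator {0..t} s * (\<integral>\<^sup>+y. ennreal (Y (x - y) (t - s)) * indicator (cball 0 1) y \<partial>lborel) \<partial>lborel)"
    and "0 \<le> mild_solution a b (bump \<gamma>) x t"
proof -
  let ?f0 = "\<lambda>z :: (real ^ 'n) \<times> real. bump \<gamma> (fst z) (snd z)"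
  have f0: "?f0 \<in> borel_measurable borel" using bump_borel unfolding borel_prod .
  have eq: "mild_solution a b (bump \<gamma>) x t =
    (LINT s|lborel. indicator {0..t} s * (LINT y|lborel. Y (x - y) (t - s) * bump \<gamma> y s))"
    using mild_solution_eq[OF f0, of "bump \<gamma>" x t] by simp
  have [measurable]: "(\<lambda>z. bump \<gamma> (snd z :: real ^ 'n) (fst z)) \<in> borel_measurable (borel \<Otimes>\<^sub>M borel)"
    unfolding bump_def by measurable
  define G where "G s = (LINT y|lborel. Y (x - y) (t - s) * bump \<gamma> y s)" for s
  have Gm [measurable]: "G \<in> borel_measurable borel"
    unfolding G_def by (rule lborel.borel_measurable_lebesgue_integral) (simp add: case_prod_unfold)
  have G0: "0 \<le> G s" for s
    unfolding G_def by (intro integral_nonneg_AE) (auto simp: Y_nonneg bump_nonneg)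
  have slice: "ennreal (G s) = ennreal ((1 + s) powr (- \<gamma>)) * (\<integral>\<^sup>+y. ennreal (Y (x - y) (t - s)) * indicator (cball 0 1) y \<partial>lborel)"
    and slice_le: "ennreal (G s) \<le> ennreal (mass * ((t - s) powr (a - 1) * (1 + s) powr (- \<gamma>)))"
    if s: "s \<in> {0..t}" for s
  proof -
    have pt: "ennreal (Y (x - y) (t - s) * bump \<gamma> y s) = ennreal ((1 + s) powr (- \<gamma>)) * (ennreal (Y (x - y) (t - s)) * indicator (cball 0 1) y)" for y
      by (auto simp: bump_def ennreal_mult Y_nonneg mult.commute split: split_indicator)
    have bs [measurable]: "(\<lambda>y :: real ^ 'n. bump \<gamma> y s) \<in> borel_measurable borel" unfolding bump_def by measurable
    have nn: "(\<integral>\<^sup>+y. ennreal (Y (x - y) (t - s) * bump \<gamma> y s) \<partial>lborel) =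
        ennreal ((1 + s) powr (- \<gamma>)) * (\<integral>\<^sup>+y. ennreal (Y (x - y) (t - s)) * indicator (cball 0 1) y \<partial>lborel)"
      unfolding pt by (rule nn_integral_cmult) measurable
    have total: "(\<integral>\<^sup>+y. ennreal (Y (x - y) (t - s)) \<partial>lborel) = ennreal ((t - s) powr (a - 1) * mass)"
    proof (cases "s = t")
      case True
      then show ?thesis by (simp add: Y_zero)
    next
      case False
      then have "0 < t - s" using s by simp
      then show ?thesis
        using nn_integral_lborel_reflect[of "\<lambda>z. ennreal (Y z (t - s))" x] nn_integral_Y[of "t - s", where 'a="real^'n"] by simp
    qed
    have "(\<integral>\<^sup>+y. ennreal (Y (x - y) (t - s)) * indicator (cball 0 1) y \<partial>lborel) \<le> (\<integral>\<^sup>+y. ennreal (Y (x - y) (t - s)) \<partial>lborel)"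
      by (intro nn_integral_mono) (auto split: split_indicator)
    then have "ennreal ((1 + s) powr (- \<gamma>)) * (\<integral>\<^sup>+y. ennreal (Y (x - y) (t - s)) * indicator (cball 0 1) y \<partial>lborel) \<le>
        ennreal ((1 + s) powr (- \<gamma>)) * ennreal ((t - s) powr (a - 1) * mass)"
      unfolding total by (intro mult_left_mono) auto
    also have "\<dots> = ennreal (mass * ((t - s) powr (a - 1) * (1 + s) powr (- \<gamma>)))"
      using mass_pos by (simp add: ennreal_mult[symmetric] mult_ac)
    finally have le: "(\<integral>\<^sup>+y. ennreal (Y (x - y) (t - s) * bump \<gamma> y s) \<partial>lborel) \<le>
        ennreal (mass * ((t - s) powr (a - 1) * (1 + s) powr (- \<gamma>)))" unfolding nn .
    have "integrable lborel (\<lambda>y. Y (x - y) (t - s) * bump \<gamma> y s)"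
    proof (rule integrableI_nonneg)
      show "(\<integral>\<^sup>+y. ennreal (Y (x - y) (t - s) * bump \<gamma> y s) \<partial>lborel) < \<infinity>"
        using le by (rule le_less_trans) simp
    qed (auto simp: Y_nonneg bump_nonneg)
    then have "ennreal (G s) = (\<integral>\<^sup>+y. ennreal (Y (x - y) (t - s) * bump \<gamma> y s) \<partial>lborel)"
      unfolding G_def by (intro nn_integral_eq_integral[symmetric]) (auto simp: Y_nonneg bump_nonneg)
    then show "ennreal (G s) = ennreal ((1 + s) powr (- \<gamma>)) * (\<integral>\<^sup>+y. ennreal (Y (x - y) (t - s)) * indicator (cball 0 1) y \<partial>lborel)"
      "ennreal (G s) \<le> ennreal (mass * ((t - s) powr (a - 1) * (1 + s) powr (- \<gamma>)))"
      using nn le by simp_all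
  qed
  obtain CA where CA: "0 < CA" "\<And>t. 2 \<le> t \<Longrightarrow> singular_integral a \<gamma> t
    \<le> ennreal (CA * (t powr (a - 1) * time_growth \<gamma> t))"
    using singular_weight_integral_le[of a \<gamma>] a by auto
  have "(\<integral>\<^sup>+s. ennreal (indicator {0..t} s * G s) \<partial>lborel) \<le>
      (\<integral>\<^sup>+s. ennreal mass * (ennreal ((t - s) powr (a - 1) * (1 + s) powr (- \<gamma>)) * indicator {0..t} s) \<partial>lborel)"
  proof (rule nn_integral_mono)
    fix s
    show "ennreal (indicator {0..t} s * G s) \<le> ennreal mass * (ennreal ((t - s) powr (a - 1) * (1 + s) powr (- \<gamma>)) * indicator {0..t} s)"
      using slice_le[of s] mass_pos by (cases "s \<in> {0..t}") (simp_all add: ennreal_mult[symmetric])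
  qed
  also have "\<dots> = ennreal mass * singular_integral a \<gamma> t"
    by (rule nn_integral_cmult) measurable
  also have "\<dots> \<le> ennreal mass * ennreal (CA * (t powr (a - 1) * time_growth \<gamma> t))"
    by (rule mult_left_mono[OF CA(2)[OF t]]) simp
  also have "\<dots> < \<infinity>" by (simp add: ennreal_mult_less_top)
  finally have fin: "(\<integral>\<^sup>+s. ennreal (indicator {0..t} s * G s) \<partial>lborel) < \<infinity>" .
  have "integrable lborel (\<lambda>s. indicator {0..t} s * G s)"
    using fin by (intro integrableI_nonneg) (auto simp: G0)
  then have "ennreal (mild_solution a b (bump \<gamma>) x t) = (\<integral>\<^sup>+s. ennreal (indicator {0..t} s * G s) \<partial>lborel)"
    unfolding eq G_def[symmetric] by (intro nn_integral_eq_integral[symmetric]) (auto simp: G0)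
  also have "\<dots> = (\<integral>\<^sup>+s. ennreal ((1 + s) powr (- \<gamma>)) * indicator {0..t} s * (\<integral>\<^sup>+y. ennreal (Y (x - y) (t - s)) * indicator (cball 0 1) y \<partial>lborel) \<partial>lborel)"
    by (intro nn_integral_cong) (auto simp: slice split: split_indicator)
  finally show "ennreal (mild_solution a b (bump \<gamma>) x t) =
    (\<integral>\<^sup>+s. ennreal ((1 + s) powr (- \<gamma>)) * indicator {0..t} s * (\<integral>\<^sup>+y. ennreal (Y (x - y) (t - s)) * indicator (cball 0 1) y \<partial>lborel) \<partial>lborel)" .
  show "0 \<le> mild_solution a b (bump \<gamma>) x t"
    unfolding eq G_def[symmetric] by (intro integral_nonneg_AE) (auto simp: G0)
qed

text \<open>
  For \<open>s \<le> t/2\<close> and \<open>|y| \<le> 1\<close> the point \<open>x - y\<close> is nonzero and of norm at most \<open>M (t - s)\<^bsup>\<delta>\<^esup>\<close>, with \<open>M\<close> chosen for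
  this purpose, so the lower bound of the kernel applies.
\<close>

lemma mild_solution_bump_lower:
  assumes \<nu>: "0 < \<nu>"
  shows "\<exists>c>0. \<exists>t1\<ge>2. \<forall>t\<ge>t1. \<forall>x::real ^ 'n::finite.
    \<nu> * t powr (a / (2 * b)) \<le> norm x \<longrightarrow> norm x \<le> 2 * \<nu> * t powr (a / (2 * b)) \<longrightarrow>
    c * (t powr (a - 1 - a * real CARD('n) / (2 * b)) * time_growth \<gamma> t) \<le> mild_solution a b (bump \<gamma>) x t"
proof -
  define \<delta> where "\<delta> = a / (2 * b)"
  have \<delta>: "0 < \<delta>" using a b by (simp add: \<delta>_def)
  define \<rho> where "\<rho> = a - 1 - a * real CARD('n) / (2 * b)"
  have \<rho>: "\<rho> \<le> 0"
  proof -
    have "0 \<le> a * real CARD('n) / (2 * b)" using a b by simp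
    then show ?thesis using a by (simp add: \<rho>_def)
  qed
  define M where "M = 2 powr \<delta> * (2 * \<nu> + 1)"
  have M: "0 < M" using \<nu> by (simp add: M_def)
  obtain c where c: "0 < c" "\<And>t x. 0 < t \<Longrightarrow> (x::real^'n) \<noteq> 0 \<Longrightarrow> norm x \<le> M * t powr \<delta> \<Longrightarrow> c * t powr \<rho> \<le> Y x t"
    using Y_lower[OF M, where 'a="real^'n"] by (auto simp: \<rho>_def \<delta>_def)
  obtain d where d: "0 < d" "\<And>t. 2 \<le> t \<Longrightarrow> ennreal (d * time_growth \<gamma> t) \<le> weight_integral \<gamma> (t / 2)"
    using weight_integral_ge[of \<gamma>] by auto
  define v where "v = unit_ball_vol (real CARD('n))"
  have v: "0 < v" by (simp add: v_def)
  define t1 where "t1 = max 2 ((2 / \<nu>) powr (1 / \<delta>))"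
  have main: "c * v * d * (t powr \<rho> * time_growth \<gamma> t) \<le> mild_solution a b (bump \<gamma>) x t"
    if t: "t1 \<le> t" and x: "\<nu> * t powr \<delta> \<le> norm x" "norm x \<le> 2 * \<nu> * t powr \<delta>" for t and x :: "real^'n"
  proof -
    have t2: "2 \<le> t" using t by (simp add: t1_def)
    have "2 / \<nu> = ((2 / \<nu>) powr (1 / \<delta>)) powr \<delta>" using \<delta> \<nu> by (simp add: powr_powr)
    also have "\<dots> \<le> t powr \<delta>" using t \<delta> by (intro powr_mono2) (auto simp: t1_def)
    finally have "2 \<le> \<nu> * t powr \<delta>" using \<nu> by (simp add: field_simps)
    then have x2: "2 \<le> norm x" using x by linarith
    have L: "0 \<le> time_growth \<gamma> t" using t2 by (intro time_growth_nonneg) auto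
    have td: "1 \<le> t powr \<delta>" using t2 \<delta> by (intro ge_one_powr_ge_zero) auto
    have Y: "c * t powr \<rho> \<le> Y (x - y) (t - s)" if s: "0 \<le> s" "s \<le> t / 2" and y: "norm y \<le> 1" for s and y :: "real^'n"
    proof -
      have ts: "0 < t - s" "t / 2 \<le> t - s" "t - s \<le> t" using s t2 by auto
      have "norm (x - y) \<le> 2 * \<nu> * t powr \<delta> + 1" using norm_triangle_ineq4[of x y] x y by linarith
      also have "\<dots> \<le> (2 * \<nu> + 1) * t powr \<delta>" using td by (simp add: algebra_simps)
      also have "\<dots> = M * (t / 2) powr \<delta>" using t2 by (simp add: M_def powr_divide)
      also have "\<dots> \<le> M * (t - s) powr \<delta>" using M ts t2 \<delta> by (intro mult_left_mono powr_mono2) auto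
      finally have le: "norm (x - y) \<le> M * (t - s) powr \<delta>" .
      have "x - y \<noteq> 0" using x2 y by auto
      then have "c * (t - s) powr \<rho> \<le> Y (x - y) (t - s)" by (rule c(2)[OF ts(1) _ le])
      moreover have "t powr \<rho> \<le> (t - s) powr \<rho>" using ts \<rho> by (intro powr_mono2') auto
      then have "c * t powr \<rho> \<le> c * (t - s) powr \<rho>" using c by simp
      ultimately show ?thesis by linarith
    qed
    have "ennreal (c * v * d * (t powr \<rho> * time_growth \<gamma> t)) = ennreal (c * t powr \<rho> * v) * ennreal (d * time_growth \<gamma> t)"
      using c(1) v d(1) L by (simp add: ennreal_mult[symmetric] mult_ac)
    also have "\<dots> \<le> ennreal (c * t powr \<rho> * v) * weight_integral \<gamma> (t / 2)"
      by (intro mult_left_mono d t2) simp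
    also have "\<dots> = (\<integral>\<^sup>+s. ennreal (c * t powr \<rho> * v) * (ennreal ((1 + s) powr (- \<gamma>)) * indicator {0..t/2} s) \<partial>lborel)"
      by (rule nn_integral_cmult[symmetric]) measurable
    also have "\<dots> \<le> (\<integral>\<^sup>+s. ennreal ((1 + s) powr (- \<gamma>)) * indicator {0..t} s * (\<integral>\<^sup>+y. ennreal (Y (x - y) (t - s)) * indicator (cball 0 1) y \<partial>lborel) \<partial>lborel)"
    proof (rule nn_integral_mono)
      fix s
      show "ennreal (c * t powr \<rho> * v) * (ennreal ((1 + s) powr (- \<gamma>)) * indicator {0..t/2} s) \<le>
          ennreal ((1 + s) powr (- \<gamma>)) * indicator {0..t} s * (\<integral>\<^sup>+y. ennreal (Y (x - y) (t - s)) * indicator (cball 0 1) y \<partial>lborel)"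
      proof (cases "s \<in> {0..t/2}")
        case True
        have "ennreal (c * t powr \<rho> * v) = (\<integral>\<^sup>+y. ennreal (c * t powr \<rho>) * indicator (cball 0 1) (y::real^'n) \<partial>lborel)"
          using c(1) v by (subst nn_integral_cmult_indicator) (simp_all add: emeasure_cball v_def ennreal_mult)
        also have "\<dots> \<le> (\<integral>\<^sup>+y. ennreal (Y (x - y) (t - s)) * indicator (cball 0 1) y \<partial>lborel)"
          by (intro nn_integral_mono) (use Y[of s] True in \<open>auto split: split_indicator intro!: ennreal_leI\<close>)
        finally have "ennreal ((1 + s) powr (- \<gamma>)) * ennreal (c * t powr \<rho> * v) \<le>
            ennreal ((1 + s) powr (- \<gamma>)) * (\<integral>\<^sup>+y. ennreal (Y (x - y) (t - s)) * indicator (cball 0 1) y \<partial>lborel)"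
          by (intro mult_left_mono) auto
        then show ?thesis using True t2 by (simp add: mult.commute)
      qed simp
    qed
    also have "\<dots> = ennreal (mild_solution a b (bump \<gamma>) x t)"
      by (rule mild_solution_bump(1)[OF t2, symmetric])
    finally show ?thesis
      using mild_solution_bump(2)[OF t2, of \<gamma> x] by (subst (asm) ennreal_le_iff) auto
  qed
  have "2 \<le> t1" by (simp add: t1_def)
  moreover have "0 < c * v * d" using c v d by simp
  moreover have "\<forall>t\<ge>t1. \<forall>x. \<nu> * t powr (a / (2 * b)) \<le> norm x \<longrightarrow> norm x \<le> 2 * \<nu> * t powr (a / (2 * b)) \<longrightarrow>
      c * v * d * (t powr (a - 1 - a * real CARD('n) / (2 * b)) * time_growth \<gamma> t) \<le> mild_solution a b (bump \<gamma>) (x::real^'n) t"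
    using main[unfolded \<delta>_def \<rho>_def] by simp
  ultimately show ?thesis by (intro exI conjI)
qed

text \<open>
  The shell \<open>\<nu> t\<^bsup>\<delta>\<^esup> \<le> |x| \<le> 2\<nu> t\<^bsup>\<delta>\<^esup>\<close> contains a ball of radius \<open>\<nu> t\<^bsup>\<delta>\<^esup> / 2\<close>, on which the solution is bounded below.
\<close>

lemma Lp_lower:
  assumes p: "1 \<le> p" and \<nu>: "0 < \<nu>"
  shows "\<exists>c>0. \<exists>t1\<ge>2. \<forall>t\<ge>t1. ennreal (c * decay_rate CARD('n::finite) a b \<gamma> p t) \<le>
    Lp_norm p (lebesgue_on (exterior_region a b \<nu> t)) (\<lambda>x::real ^ 'n. mild_solution a b (bump \<gamma>) x t)"
proof -
  let ?N = "real CARD('n)"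
  let ?u = "\<lambda>t x. mild_solution a b (bump \<gamma>) (x::real^'n) t"
  define \<delta> where "\<delta> = a / (2 * b)"
  obtain c t1 where c: "0 < c" "2 \<le> t1" "\<And>t x. t1 \<le> t \<Longrightarrow> \<nu> * t powr \<delta> \<le> norm (x::real^'n) \<Longrightarrow> norm x \<le> 2 * \<nu> * t powr \<delta> \<Longrightarrow>
    c * (t powr (a - 1 - a * ?N / (2 * b)) * time_growth \<gamma> t) \<le> ?u t x"
    using mild_solution_bump_lower[where 'n='n and \<gamma>=\<gamma>, OF \<nu>] by (auto simp: \<delta>_def)
  obtain B :: "real^'n" where B: "B \<in> Basis" using nonempty_Basis by blast
  \<comment> \<open>Centred at distance \<open>3/2\<close> of the inner radius, the ball lies inside the shell.\<close>
  define S where "S t = cball ((3 / 2 * (\<nu> * t powr \<delta>)) *\<^sub>R B) (\<nu> * t powr \<delta> / 2)" for t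
  have S_norm: "\<nu> * t powr \<delta> \<le> norm x" "norm x \<le> 2 * \<nu> * t powr \<delta>" if "x \<in> S t" for t x
  proof -
    define R where "R = \<nu> * t powr \<delta>"
    have R: "0 \<le> R" using \<nu> by (simp add: R_def)
    have n: "norm ((3 / 2 * R) *\<^sub>R B) = 3 / 2 * R" using B R by simp
    have "norm ((3 / 2 * R) *\<^sub>R B - x) \<le> R / 2" using that by (simp add: S_def R_def dist_norm)
    then show "\<nu> * t powr \<delta> \<le> norm x" "norm x \<le> 2 * \<nu> * t powr \<delta>"
      using norm_triangle_ineq2[of "(3 / 2 * R) *\<^sub>R B" x] norm_triangle_ineq3[of "(3 / 2 * R) *\<^sub>R B" x] n
      unfolding R_def[symmetric] mult.assoc by linarith+
  qed
  have S_sub: "S t \<subseteq> exterior_region a b \<nu> t" for t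
    using S_norm(1) by (auto simp: exterior_region_def \<delta>_def)
  have S_borel: "S t \<in> sets borel" for t by (simp add: S_def)
  define v where "v = unit_ball_vol ?N"
  have v: "0 < v" by (simp add: v_def)
  have S_meas: "emeasure lborel (S t) = ennreal (v * (\<nu> / 2 * t powr \<delta>) ^ CARD('n))" for t
    using \<nu> unfolding S_def by (subst emeasure_cball) (auto simp: v_def)
  show ?thesis
  proof (cases "p = \<top>")
    case True
    have "ennreal (c * decay_rate CARD('n) a b \<gamma> p t) \<le> Lp_norm p (lebesgue_on (exterior_region a b \<nu> t)) (?u t)" if t: "t1 \<le> t" for t
    proof -
      have t2: "2 \<le> t" using t c by simp
      have "0 < v * (\<nu> / 2 * t powr \<delta>) ^ CARD('n)" using v \<nu> t2 by simp
      then have pos: "0 < emeasure lborel (S t)" by (simp only: S_meas ennreal_less_zero_iff)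
      show ?thesis
        unfolding True
      proof (rule Lp_norm_top_ge[OF exterior_region_borel S_borel S_sub pos])
        fix x assume "x \<in> S t"
        then have "c * (t powr (a - 1 - a * ?N / (2 * b)) * time_growth \<gamma> t) \<le> ?u t x"
          using c(3)[OF t] S_norm by blast
        then show "c * decay_rate CARD('n) a b \<gamma> \<top> t \<le> \<bar>?u t x\<bar>"
          using t2 by (simp add: decay_rate_eq)
      qed
    qed
    then show ?thesis using c(1,2) by blast
  next
    case False
    define P where "P = enn2real p"
    have P: "1 \<le> P" "enn2real (1 / p) = 1 / P"
      using enn2real_exponent[OF p False] by (simp_all add: P_def)
    define k where "k = c * (v powr (1 / P) * (\<nu> / 2) powr (?N / P))"
    have k: "0 < k" using c v \<nu> by (simp add: k_def)
    have "ennreal (k * decay_rate CARD('n) a b \<gamma> p t) \<le> Lp_norm p (lebesgue_on (exterior_region a b \<nu> t)) (?u t)" if t: "t1 \<le> t" for t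
    proof (rule Lp_norm_lebesgue_on_ge[OF False _ exterior_region_borel])
      have t2: "2 \<le> t" using t c by simp
      have L: "0 \<le> time_growth \<gamma> t" using t2 by (intro time_growth_nonneg) auto
      show "0 < enn2real p" using P by (simp add: P_def)
      show "0 \<le> k * decay_rate CARD('n) a b \<gamma> p t" using k t2 L by (simp add: decay_rate_eq)
      define m where "m = c * (t powr (a - 1 - a * ?N / (2 * b)) * time_growth \<gamma> t)"
      have m: "0 \<le> m" using c L by (simp add: m_def)
      have "k * decay_rate CARD('n) a b \<gamma> p t = m * (v powr (1 / P) * (\<nu> / 2 * t powr \<delta>) powr (?N / P))"
      proof -
        have "t powr (a - 1 - a * ?N / (2 * b)) * t powr (\<delta> * (?N / P)) = t powr (a - 1 - a * ?N / (2 * b) * (1 - 1 / P))"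
        proof -
          have "a - 1 - a * ?N / (2 * b) + \<delta> * (?N / P) = a - 1 - a * ?N / (2 * b) * (1 - 1 / P)"
            using P b by (simp add: \<delta>_def field_simps)
          then show ?thesis by (simp only: powr_add[symmetric])
        qed
        moreover have "(\<nu> / 2 * t powr \<delta>) powr (?N / P) = (\<nu> / 2) powr (?N / P) * t powr (\<delta> * (?N / P))"
          using \<nu> by (subst powr_mult) (simp_all add: powr_powr)
        ultimately show ?thesis using t2 P by (simp add: decay_rate_eq k_def m_def mult_ac)
      qed
      then have "(k * decay_rate CARD('n) a b \<gamma> p t) powr P = m powr P * (v * (\<nu> / 2 * t powr \<delta>) powr ?N)"
        using m v \<nu> P by (simp add: powr_mult powr_powr)
      also have "(\<nu> / 2 * t powr \<delta>) powr ?N = (\<nu> / 2 * t powr \<delta>) ^ CARD('n)"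
        using \<nu> t2 by (intro powr_realpow) simp
      finally have "ennreal ((k * decay_rate CARD('n) a b \<gamma> p t) powr P) = ennreal (m powr P) * emeasure lborel (S t)"
        using v \<nu> by (simp only: S_meas) (simp add: ennreal_mult)
      also have "\<dots> = (\<integral>\<^sup>+x. ennreal (m powr P) * indicator (S t) x \<partial>lborel)"
        using S_borel by (simp add: nn_integral_cmult)
      also have "\<dots> \<le> (\<integral>\<^sup>+x. ennreal (\<bar>?u t x\<bar> powr P) * indicator (exterior_region a b \<nu> t) x \<partial>lborel)"
      proof (rule nn_integral_mono)
        fix x :: "real^'n"
        show "ennreal (m powr P) * indicator (S t) x \<le> ennreal (\<bar>?u t x\<bar> powr P) * indicator (exterior_region a b \<nu> t) x"
        proof (cases "x \<in> S t")
          case True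
          then have "m \<le> ?u t x" unfolding m_def using c(3)[OF t] S_norm by blast
          then have "m powr P \<le> \<bar>?u t x\<bar> powr P" using m P by (intro powr_mono2) auto
          moreover have "x \<in> exterior_region a b \<nu> t" using True S_sub by blast
          ultimately show ?thesis using True by (simp add: ennreal_leI)
        qed simp
      qed
      finally show "ennreal ((k * decay_rate CARD('n) a b \<gamma> p t) powr enn2real p) \<le>
          (\<integral>\<^sup>+x. ennreal (\<bar>?u t x\<bar> powr enn2real p) * indicator (exterior_region a b \<nu> t) x \<partial>lborel)"
        by (simp only: P_def)
    qed
    then show ?thesis using k c(2) by blast
  qed
qed

end

theorem theorem1p1:
  fixes \<alpha> \<beta> \<gamma> :: real and p :: ennreal
  assumes "0 < \<alpha>" "\<alpha> < 1" and "0 < \<beta>" "\<beta> \<le> 1"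
    and "real CARD('n::finite) > 4 * \<beta>" and "1 \<le> p"
  shows
    "(\<forall>f :: real ^ 'n \<Rightarrow> real \<Rightarrow> real.
        source_measurable f \<longrightarrow> source_L1_bound \<gamma> f \<longrightarrow>
        (p \<ge> ennreal (critical_exponent CARD('n) \<beta>) \<longrightarrow> source_spatial_decay \<gamma> f) \<longrightarrow>
        (\<forall>\<nu>>0. \<exists>C>0. \<exists>t\<^sub>0\<ge>2. \<forall>t\<ge>t\<^sub>0.
           (\<lambda>x. mild_solution \<alpha> \<beta> f x t)
             \<in> borel_measurable (lebesgue_on (exterior_region \<alpha> \<beta> \<nu> t)) \<and>
           Lp_norm p (lebesgue_on (exterior_region \<alpha> \<beta> \<nu> t)) (\<lambda>x. mild_solution \<alpha> \<beta> f x t)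
             \<le> ennreal (C * decay_rate CARD('n) \<alpha> \<beta> \<gamma> p t)))
     \<and>
     (\<forall>\<nu>>0. \<exists>f :: real ^ 'n \<Rightarrow> real \<Rightarrow> real.
        source_measurable f \<and> source_L1_bound \<gamma> f \<and>
        (p \<ge> ennreal (critical_exponent CARD('n) \<beta>) \<longrightarrow> source_spatial_decay \<gamma> f) \<and>
        (\<exists>c>0. \<exists>t\<^sub>1\<ge>2. \<forall>t\<ge>t\<^sub>1.
           (\<lambda>x. mild_solution \<alpha> \<beta> f x t)
             \<in> borel_measurable (lebesgue_on (exterior_region \<alpha> \<beta> \<nu> t)) \<and>
           Lp_norm p (lebesgue_on (exterior_region \<alpha> \<beta> \<nu> t)) (\<lambda>x. mild_solution \<alpha> \<beta> f x t)
             \<ge> ennreal (c * decay_rate CARD('n) \<alpha> \<beta> \<gamma> p t)))"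
proof -
  obtain \<mu> where "mixing_measure \<alpha> \<beta> \<mu>"
    using mixing_measure_exists[of \<alpha> \<beta>] assms by auto
  then interpret subordinated \<alpha> \<beta> \<mu>
    using assms by unfold_locales auto
  have N: "2 * \<beta> < real CARD('n)" using assms by simp
  have meas: "(\<lambda>x. mild_solution \<alpha> \<beta> f x t) \<in> borel_measurable (lebesgue_on (exterior_region \<alpha> \<beta> \<nu> t))"
    if "source_measurable f" for f :: "real ^ 'n \<Rightarrow> real \<Rightarrow> real" and \<nu> t
    by (rule measurable_exterior_region[OF mild_solution_measurable[OF that]])
  have upper: "\<exists>C>0. \<exists>t0\<ge>2. \<forall>t\<ge>t0.
      Lp_norm p (lebesgue_on (exterior_region \<alpha> \<beta> \<nu> t)) (\<lambda>x. mild_solution \<alpha> \<beta> f x t)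
        \<le> ennreal (C * decay_rate CARD('n) \<alpha> \<beta> \<gamma> p t)"
    if f: "source_measurable f" "source_L1_bound \<gamma> f"
      and decay: "p \<ge> ennreal (critical_exponent CARD('n) \<beta>) \<longrightarrow> source_spatial_decay \<gamma> f" and \<nu>: "0 < \<nu>"
    for f :: "real ^ 'n \<Rightarrow> real \<Rightarrow> real" and \<nu>
  proof (cases "p \<ge> ennreal (critical_exponent CARD('n) \<beta>)")
    case True
    have "1 < critical_exponent CARD('n) \<beta>"
      using N assms by (simp add: critical_exponent_def field_simps)
    then have "1 < ennreal (critical_exponent CARD('n) \<beta>)" by (simp flip: ennreal_1 add: ennreal_less_iff)
    then have "1 < p" using True by (rule less_le_trans)
    then show ?thesis using decay True by (intro Lp_upper_supercritical f \<nu>) auto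
  next
    case False
    then have "p < ennreal (critical_exponent CARD('n) \<beta>)" by simp
    from Lp_upper_subcritical[OF f N \<open>1 \<le> p\<close> this] show ?thesis by (meson order_refl)
  qed
  have lower: "\<exists>c>0. \<exists>t1\<ge>2. \<forall>t\<ge>t1. ennreal (c * decay_rate CARD('n) \<alpha> \<beta> \<gamma> p t) \<le>
      Lp_norm p (lebesgue_on (exterior_region \<alpha> \<beta> \<nu> t)) (\<lambda>x::real ^ 'n. mild_solution \<alpha> \<beta> (bump \<gamma>) x t)"
    if "0 < \<nu>" for \<nu>
    by (rule Lp_lower[OF \<open>1 \<le> p\<close> that])
  show ?thesis
  proof (intro conjI allI impI, goal_cases)
    case (1 f \<nu>)
    then show ?case using upper[of f \<nu>] meas[of f] by simp
  next
    case (2 \<nu>)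
    show ?case
      using lower[OF 2] meas[OF bump_source_measurable]
      by (intro exI[of _ "bump \<gamma>"]) (simp add: bump_source_measurable bump_L1 bump_decay)
  qed
qed

end
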